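(* Let $M=\mathbb R^6\times\mathbb S^1$, with Cartesian coordinates $(q^i,p_i)_{i=1,2,3}$ on $\mathbb R^6$ and angle coordinate $\phi$ on $\mathbb S^1$, be equipped with the contact distribution $C=\ker\theta$, $\theta=d\phi-\sum_{i=1}^3p_i\,dq^i$. Put $H_i=\frac12\left((q^i)^2+(p_i)^2\right)$ and, for a real number $\alpha>0$, $H_{(\alpha)}=H_1+\alpha H_2$ and $$S_\alpha:=H_{(\alpha)}^{-1}(1/4)\cap H_3^{-1}(1/2)\subset M,$$ which is a $5$-dimensional regular coisotropic submanifold of $(M,C)$. If $\alpha\in\mathbb Q$, then the coisotropic submanifold $S_\alpha$ of $(M,C)$ is formally obstructed, i.e. there is an infinitesimal coisotropic deformation of $S_\alpha$ that cannot be prolonged to a formal coisotropic deformation.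
   Context: **Jacobi structure.** The contact manifold $(M,C)$ carries a Jacobi structure, with line bundle $L=TM/C$, trivialized by $\theta$ (so $\Gamma(L)=C^\infty(M)$), and bracket $\{f,g\}=\theta([X_f,X_g])$, where $X_f$ is the unique vector field preserving $C$ with $\theta(X_f)=f$. $J\equiv\{-,-\}$. A submanifold $S$ is coisotropic if $X_f$ is tangent to $S$ whenever $f|_S=0$; it is regular if moreover $TS\cap C$ has rank $\dim S-1$ everywhere. **Setting for deformations.** For $S$ closed coisotropic in a Jacobi manifold $(M,L,J)$ put $\ell=L|_S$, $NS=TM|_S/TS$, $\pi:NS\to S$. A fat tubular neighborhood is a line bundle embedding $\tau:L_{NS}:=\pi^*\ell\hookrightarrow L$ covering a tubular neighborhood $NS\hookrightarrow M$ and restricting to the inclusion $\ell\hookrightarrow L$ over the zero section. Fix one and replace $(M,L,J)$ by the induced Jacobi structure on $L=L_{NS}\to NS$, $S$ being the zero section. $\mathcal D^kL$ is the space of alternating maps $\Gamma(L)^k\to\Gamma(L)$ that are first order differential operators in each entry, i.e. $L$-valued $k$-forms on the first jet bundle $J^1L$. $P$ sends $\square\in\mathcal D^kL$ to the restriction to $S$ of the $k$-form $\square$, pulled back along $\gamma:N^*S\otimes\ell\to J^1L|_S$, $\gamma(df\otimes\lambda)=j^1(f\lambda)-fj^1\lambda$. For $s\in\Gamma(NS)$, $I(s)$ is the derivation of $L=\pi^*\ell$ annihilating $\pi^*\Gamma(\ell)$ whose symbol is the fiberwise constant vertical vector field defined by $s$. For a derivation $\Delta$ of $L$ and $\square\in\mathcal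 D^2L$, $\mathcal L_\Delta\square(\lambda,\mu)=\Delta(\square(\lambda,\mu))-\square(\Delta\lambda,\mu)-\square(\lambda,\Delta\mu)$. **Formal deformations.** An infinitesimal coisotropic deformation of $S$ is a section $s$ of $NS$ such that $\epsilon s$ is a coisotropic section up to $O(\epsilon^2)$ (a section is coisotropic if its image is a coisotropic submanifold); equivalently $P(\mathcal L_{I(s)}J)=0$. A formal coisotropic deformation is a series $s(\varepsilon)=\sum_{i\ge1}\varepsilon^is_i\in\Gamma(NS)[[\varepsilon]]$ with $P(\exp\mathcal L_{I(s(\varepsilon))}J)=0$, where $I(s(\varepsilon))=\sum_i\varepsilon^iI(s_i)$ and $\exp\mathcal L=\sum_n\frac1{n!}\mathcal L^n$. An infinitesimal coisotropic deformation $s$ can be prolonged to a formal coisotropic deformation if there is one with $s_1=s$. The submanifold is formally obstructed if some infinitesimal coisotropic deformation cannot be prolonged. *)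

theory Defs
  imports "HOL-Analysis.Analysis"
begin

section \<open>Smooth maps and submanifolds of Euclidean spaces\<close>

text \<open>All manifolds are embedded submanifolds of a Euclidean space, given by their underlying sets.\<close>

primrec Ck_on :: "nat \<Rightarrow> 'a::euclidean_space set \<Rightarrow> ('a \<Rightarrow> 'b::euclidean_space) \<Rightarrow> bool" where
  "Ck_on 0 U f \<longleftrightarrow> continuous_on U f"
| "Ck_on (Suc k) U f \<longleftrightarrow>
     (\<forall>x\<in>U. f differentiable (at x)) \<and> (\<forall>v. Ck_on k U (\<lambda>x. frechet_derivative f (at x) v))"

text \<open>To be used for open \<open>U\<close> only; \<open>smooth_fun\<close> below is for arbitrary subsets.\<close>

definition smooth_on :: "'a::euclidean_space set \<Rightarrow> ('a \<Rightarrow> 'b::euclidean_space) \<Rightarrow> bool" where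
  "smooth_on U f \<longleftrightarrow> (\<forall>k. Ck_on k U f)"

definition smooth_fun :: "'a::euclidean_space set \<Rightarrow> ('a \<Rightarrow> 'b::euclidean_space) \<Rightarrow> bool" where
  "smooth_fun A f \<longleftrightarrow>
     (\<forall>x\<in>A. \<exists>U g. open U \<and> x \<in> U \<and> smooth_on U g \<and> (\<forall>y\<in>A \<inter> U. f y = g y))"

definition embedded_submanifold :: "nat \<Rightarrow> 'a::euclidean_space set \<Rightarrow> bool" where
  "embedded_submanifold d S \<longleftrightarrow>
     (\<forall>x\<in>S. \<exists>U V (\<psi> :: 'a \<Rightarrow> 'a) \<psi>' T. open U \<and> x \<in> U \<and> open V \<and> homeomorphism U V \<psi> \<psi>' \<and>
        smooth_on U \<psi> \<and> smooth_on V \<psi>' \<and> subspace T \<and> dim T = d \<and> \<psi> ` (S \<inter> U) = T \<inter> V)"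

definition tangent_space :: "'a::euclidean_space set \<Rightarrow> 'a \<Rightarrow> 'a set" where
  "tangent_space M x = {v. \<exists>(c :: real \<Rightarrow> 'a) e. e > 0 \<and> smooth_on {-e<..<e} c \<and>
     c ` {-e<..<e} \<subseteq> M \<and> c 0 = x \<and> (c has_vector_derivative v) (at 0)}"

text \<open>Derivative along \<open>v \<in> T\<^sub>xW\<close>. The Frechet derivative within \<open>W\<close> is unique only on
  \<open>T\<^sub>xW\<close>, so this is not meaningful for other \<open>v\<close>.\<close>

definition dir_deriv ::
    "'a::euclidean_space set \<Rightarrow> ('a \<Rightarrow> 'b::euclidean_space) \<Rightarrow> 'a \<Rightarrow> 'a \<Rightarrow> 'b" where
  "dir_deriv W f x v = frechet_derivative f (at x within W) v"

definition vector_field :: "'a::euclidean_space set \<Rightarrow> ('a \<Rightarrow> 'a) \<Rightarrow> bool" where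
  "vector_field W X \<longleftrightarrow> smooth_fun W X \<and> (\<forall>x\<in>W. X x \<in> tangent_space W x)"

definition lie_bracket :: "'a::euclidean_space set \<Rightarrow> ('a \<Rightarrow> 'a) \<Rightarrow> ('a \<Rightarrow> 'a) \<Rightarrow> 'a \<Rightarrow> 'a" where
  "lie_bracket W X Y x = dir_deriv W Y x (X x) - dir_deriv W X x (Y x)"


section \<open>The Jacobi structure of a contact form\<close>

text \<open>A one-form on \<open>M\<close> is a function \<open>\<theta>\<close> whose values \<open>\<theta> x v\<close> are relevant for
  \<open>x \<in> M\<close>, \<open>v \<in> T\<^sub>xM\<close>. It is a contact form, \<open>C = ker \<theta>\<close>, and it trivializes \<open>L = TM/C\<close>, so that
  sections of \<open>L\<close> over an open \<open>W \<subseteq> M\<close> are smooth functions on \<open>W\<close>.\<close>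

definition preserves_contact :: "'a::euclidean_space set \<Rightarrow> ('a \<Rightarrow> 'a \<Rightarrow> real) \<Rightarrow> ('a \<Rightarrow> 'a) \<Rightarrow> bool" where
  "preserves_contact W \<theta> X \<longleftrightarrow>
     (\<forall>Y. vector_field W Y \<and> (\<forall>x\<in>W. \<theta> x (Y x) = 0) \<longrightarrow> (\<forall>x\<in>W. \<theta> x (lie_bracket W X Y x) = 0))"

text \<open>The vector field \<open>X\<^sub>f\<close>; it is set to \<open>0\<close> off \<open>W\<close> to make it unique as a function on
  the ambient space.\<close>

definition contact_field ::
    "'a::euclidean_space set \<Rightarrow> ('a \<Rightarrow> 'a \<Rightarrow> real) \<Rightarrow> ('a \<Rightarrow> real) \<Rightarrow> 'a \<Rightarrow> 'a" where
  "contact_field W \<theta> f = (THE X. vector_field W X \<and> preserves_contact W \<theta> X \<and>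
     (\<forall>x\<in>W. \<theta> x (X x) = f x) \<and> (\<forall>x. x \<notin> W \<longrightarrow> X x = 0))"

definition jacobi_bracket ::
    "'a::euclidean_space set \<Rightarrow> ('a \<Rightarrow> 'a \<Rightarrow> real) \<Rightarrow> ('a \<Rightarrow> real) \<Rightarrow> ('a \<Rightarrow> real) \<Rightarrow> 'a \<Rightarrow> real" where
  "jacobi_bracket W \<theta> f g x =
     \<theta> x (lie_bracket W (contact_field W \<theta> f) (contact_field W \<theta> g) x)"

definition coisotropic :: "'a::euclidean_space set \<Rightarrow> ('a \<Rightarrow> 'a \<Rightarrow> real) \<Rightarrow> 'a set \<Rightarrow> bool" where
  "coisotropic M \<theta> S \<longleftrightarrow>
     (\<forall>f. smooth_fun M f \<and> (\<forall>x\<in>S. f x = 0) \<longrightarrow> (\<forall>x\<in>S. contact_field M \<theta> f x \<in> tangent_space S x))"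

definition regular_coisotropic_submanifold ::
    "'a::euclidean_space set \<Rightarrow> ('a \<Rightarrow> 'a \<Rightarrow> real) \<Rightarrow> nat \<Rightarrow> 'a set \<Rightarrow> bool" where
  "regular_coisotropic_submanifold M \<theta> d S \<longleftrightarrow>
     S \<subseteq> M \<and> embedded_submanifold d S \<and> coisotropic M \<theta> S \<and>
     (\<forall>x\<in>S. dim {v \<in> tangent_space S x. \<theta> x v = 0} = d - 1)"


section \<open>The normal bundle and fat tubular neighborhoods\<close>

text \<open>A point of \<open>NS = TM|\<^sub>S/TS\<close> is a pair of \<open>x \<in> S\<close> and a coset of \<open>T\<^sub>xS\<close> in \<open>T\<^sub>xM\<close>.
  Since \<open>TM|\<^sub>S \<rightarrow> NS\<close> is a surjective submersion, a map on \<open>NS\<close> is smooth iff its pullback to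
  \<open>TM|\<^sub>S\<close> is. Values of maps off \<open>NS\<close> are irrelevant throughout.\<close>

definition normal_class :: "'a::euclidean_space set \<Rightarrow> 'a \<Rightarrow> 'a \<Rightarrow> 'a set" where
  "normal_class S x v = {v + w | w. w \<in> tangent_space S x}"

definition tangent_along :: "'a::euclidean_space set \<Rightarrow> 'a set \<Rightarrow> ('a \<times> 'a) set" where
  "tangent_along M S = {(x, v). x \<in> S \<and> v \<in> tangent_space M x}"

definition normal_bundle :: "'a::euclidean_space set \<Rightarrow> 'a set \<Rightarrow> ('a \<times> 'a set) set" where
  "normal_bundle M S = (\<lambda>(x, v). (x, normal_class S x v)) ` tangent_along M S"

definition zero_point :: "'a::euclidean_space set \<Rightarrow> 'a \<Rightarrow> 'a \<times> 'a set" where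
  "zero_point S x = (x, normal_class S x 0)"

definition smooth_NS ::
    "'a::euclidean_space set \<Rightarrow> 'a set \<Rightarrow> ('a \<times> 'a set \<Rightarrow> 'b::euclidean_space) \<Rightarrow> bool" where
  "smooth_NS M S u \<longleftrightarrow> smooth_fun (tangent_along M S) (\<lambda>(x, v). u (x, normal_class S x v))"

definition section_NS :: "'a::euclidean_space set \<Rightarrow> 'a set \<Rightarrow> ('a \<Rightarrow> 'a set) \<Rightarrow> bool" where
  "section_NS M S s \<longleftrightarrow> (\<exists>v. smooth_fun S v \<and> (\<forall>x\<in>S. v x \<in> tangent_space M x) \<and>
     (\<forall>x\<in>S. s x = normal_class S x (v x)))"

text \<open>As \<open>L = M \<times> \<real>\<close>, \<open>\<ell> = S \<times> \<real>\<close> and \<open>L\<^sub>N\<^sub>S = \<pi>\<^sup>*\<ell> = NS \<times> \<real>\<close>, a line bundle embedding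
  \<open>L\<^sub>N\<^sub>S \<rightarrow> L\<close> has the form \<open>(\<nu>, r) \<mapsto> (\<tau> \<nu>, h \<nu> * r)\<close> with \<open>\<tau>\<close> a diffeomorphism onto an open
  subset of \<open>M\<close> and \<open>h\<close> nowhere zero. It restricts to the inclusion \<open>\<ell> \<rightarrow> L\<close> over the zero section
  iff \<open>\<tau>\<close> is the inclusion of \<open>S\<close> and \<open>h = 1\<close> there.\<close>

definition fat_tubular_nbhd ::
    "'a::euclidean_space set \<Rightarrow> 'a set \<Rightarrow> ('a \<times> 'a set \<Rightarrow> 'a) \<Rightarrow> ('a \<times> 'a set \<Rightarrow> real) \<Rightarrow> bool" where
  "fat_tubular_nbhd M S \<tau> h \<longleftrightarrow>
     smooth_NS M S \<tau> \<and> inj_on \<tau> (normal_bundle M S) \<and>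
     openin (top_of_set M) (\<tau> ` normal_bundle M S) \<and>
     (\<forall>u :: 'a \<times> 'a set \<Rightarrow> real. smooth_NS M S u \<longrightarrow>
        smooth_fun (\<tau> ` normal_bundle M S) (u \<circ> the_inv_into (normal_bundle M S) \<tau>)) \<and>
     smooth_NS M S h \<and> (\<forall>\<nu>\<in>normal_bundle M S. h \<nu> \<noteq> 0) \<and>
     (\<forall>x\<in>S. \<tau> (zero_point S x) = x \<and> h (zero_point S x) = 1)"

text \<open>The induced Jacobi structure on \<open>L\<^sub>N\<^sub>S\<close>: the section \<open>u\<close> of \<open>L\<^sub>N\<^sub>S\<close> corresponds to the section
  \<open>(h u) \<circ> \<tau>\<^sup>-\<^sup>1\<close> of \<open>L\<close> over the image of \<open>\<tau>\<close>.\<close>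

definition push_section ::
    "'a::euclidean_space set \<Rightarrow> 'a set \<Rightarrow> ('a \<times> 'a set \<Rightarrow> 'a) \<Rightarrow> ('a \<times> 'a set \<Rightarrow> real) \<Rightarrow>
     ('a \<times> 'a set \<Rightarrow> real) \<Rightarrow> 'a \<Rightarrow> real" where
  "push_section M S \<tau> h u = (\<lambda>\<nu>. h \<nu> * u \<nu>) \<circ> the_inv_into (normal_bundle M S) \<tau>"

definition jacobi_NS ::
    "'a::euclidean_space set \<Rightarrow> ('a \<Rightarrow> 'a \<Rightarrow> real) \<Rightarrow> 'a set \<Rightarrow> ('a \<times> 'a set \<Rightarrow> 'a) \<Rightarrow>
     ('a \<times> 'a set \<Rightarrow> real) \<Rightarrow> ('a \<times> 'a set \<Rightarrow> real) \<Rightarrow> ('a \<times> 'a set \<Rightarrow> real) \<Rightarrow> 'a \<times> 'a set \<Rightarrow> real" where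
  "jacobi_NS M \<theta> S \<tau> h u w \<nu> =
     jacobi_bracket (\<tau> ` normal_bundle M S) \<theta> (push_section M S \<tau> h u) (push_section M S \<tau> h w) (\<tau> \<nu>)
       / h \<nu>"


section \<open>Formal deformations\<close>

text \<open>The derivation \<open>I(s)\<close>: differentiation along the constant vertical vector field \<open>s\<close>. The set
  comprehension is the coset \<open>c + t s(x)\<close>.\<close>

definition vert_deriv :: "('a::euclidean_space \<Rightarrow> 'a set) \<Rightarrow> ('a \<times> 'a set \<Rightarrow> real) \<Rightarrow> 'a \<times> 'a set \<Rightarrow> real" where
  "vert_deriv s u = (\<lambda>(x, c). deriv (\<lambda>t. u (x, {a + t *\<^sub>R b | a b. a \<in> c \<and> b \<in> s x})) 0)"

definition lie_deriv ::
    "(('n \<Rightarrow> real) \<Rightarrow> 'n \<Rightarrow> real) \<Rightarrow> (('n \<Rightarrow> real) \<Rightarrow> ('n \<Rightarrow> real) \<Rightarrow> 'n \<Rightarrow> real) \<Rightarrow>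
     ('n \<Rightarrow> real) \<Rightarrow> ('n \<Rightarrow> real) \<Rightarrow> 'n \<Rightarrow> real" where
  "lie_deriv \<Delta> B u w = (\<lambda>\<nu>. \<Delta> (B u w) \<nu> - B (\<Delta> u) w \<nu> - B u (\<Delta> w) \<nu>)"

text \<open>\<open>P_form S B f l g m x\<close> is the value of \<open>P(B)\<close> on \<open>d\<^sub>xf \<otimes> l(x)\<close>, \<open>d\<^sub>xg \<otimes> m(x)\<close>, obtained
  by inserting \<open>\<gamma>(df \<otimes> l) = j\<^sup>1(f l) - f j\<^sup>1l\<close> into the bilinear form on jets with
  \<open>(j\<^sup>1u, j\<^sup>1w) \<mapsto> B(u, w)\<close>.\<close>

definition P_form ::
    "'a::euclidean_space set \<Rightarrow>
     (('a \<times> 'a set \<Rightarrow> real) \<Rightarrow> ('a \<times> 'a set \<Rightarrow> real) \<Rightarrow> 'a \<times> 'a set \<Rightarrow> real) \<Rightarrow>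
     ('a \<times> 'a set \<Rightarrow> real) \<Rightarrow> ('a \<times> 'a set \<Rightarrow> real) \<Rightarrow>
     ('a \<times> 'a set \<Rightarrow> real) \<Rightarrow> ('a \<times> 'a set \<Rightarrow> real) \<Rightarrow> 'a \<Rightarrow> real" where
  "P_form S B f l g m x =
     (let z = zero_point S x; fl = (\<lambda>\<nu>. f \<nu> * l \<nu>); gm = (\<lambda>\<nu>. g \<nu> * m \<nu>) in
      B fl gm z - f z * B l gm z - g z * B fl m z + f z * g z * B l m z)"

text \<open>\<open>d\<^sub>xf \<in> N\<^sup>*\<^sub>xS\<close>, where \<open>S\<close> is the zero section.\<close>

definition conormal_at :: "'a::euclidean_space set \<Rightarrow> ('a \<times> 'a set \<Rightarrow> real) \<Rightarrow> 'a \<Rightarrow> bool" where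
  "conormal_at S f x \<longleftrightarrow> (\<forall>w\<in>tangent_space S x. dir_deriv S (\<lambda>y. f (zero_point S y)) x w = 0)"

definition P_zero ::
    "'a::euclidean_space set \<Rightarrow> 'a set \<Rightarrow>
     (('a \<times> 'a set \<Rightarrow> real) \<Rightarrow> ('a \<times> 'a set \<Rightarrow> real) \<Rightarrow> 'a \<times> 'a set \<Rightarrow> real) \<Rightarrow> bool" where
  "P_zero M S B \<longleftrightarrow> (\<forall>x\<in>S. \<forall>f l g m.
     smooth_NS M S f \<and> smooth_NS M S l \<and> smooth_NS M S g \<and> smooth_NS M S m \<and>
     conormal_at S f x \<and> conormal_at S g x \<longrightarrow> P_form S B f l g m x = 0)"

text \<open>For \<open>s(\<epsilon>) = (\<Sum>i\<ge>1. \<epsilon>\<^sup>i s\<^sub>i)\<close>, \<open>lie_power_coeff s B n k\<close> is the coefficient of \<open>\<epsilon>\<^sup>k\<close> in the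
  \<open>n\<close>-th power of the Lie derivative along \<open>I(s(\<epsilon>))\<close>, applied to \<open>B\<close>. It vanishes for \<open>n > k\<close>.\<close>

fun lie_power_coeff ::
    "(nat \<Rightarrow> 'a::euclidean_space \<Rightarrow> 'a set) \<Rightarrow>
     (('a \<times> 'a set \<Rightarrow> real) \<Rightarrow> ('a \<times> 'a set \<Rightarrow> real) \<Rightarrow> 'a \<times> 'a set \<Rightarrow> real) \<Rightarrow> nat \<Rightarrow> nat \<Rightarrow>
     ('a \<times> 'a set \<Rightarrow> real) \<Rightarrow> ('a \<times> 'a set \<Rightarrow> real) \<Rightarrow> 'a \<times> 'a set \<Rightarrow> real" where
  "lie_power_coeff s B 0 k = (\<lambda>u w \<nu>. if k = 0 then B u w \<nu> else 0)"
| "lie_power_coeff s B (Suc n) k =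
     (\<lambda>u w \<nu>. \<Sum>i=1..k. lie_deriv (vert_deriv (s i)) (lie_power_coeff s B n (k - i)) u w \<nu>)"

definition exp_lie_coeff ::
    "(nat \<Rightarrow> 'a::euclidean_space \<Rightarrow> 'a set) \<Rightarrow>
     (('a \<times> 'a set \<Rightarrow> real) \<Rightarrow> ('a \<times> 'a set \<Rightarrow> real) \<Rightarrow> 'a \<times> 'a set \<Rightarrow> real) \<Rightarrow> nat \<Rightarrow>
     ('a \<times> 'a set \<Rightarrow> real) \<Rightarrow> ('a \<times> 'a set \<Rightarrow> real) \<Rightarrow> 'a \<times> 'a set \<Rightarrow> real" where
  "exp_lie_coeff s B k = (\<lambda>u w \<nu>. \<Sum>n\<le>k. lie_power_coeff s B n k u w \<nu> / fact n)"

definition infinitesimal_coisotropic_deformation ::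
    "'a::euclidean_space set \<Rightarrow> ('a \<Rightarrow> 'a \<Rightarrow> real) \<Rightarrow> 'a set \<Rightarrow> ('a \<times> 'a set \<Rightarrow> 'a) \<Rightarrow>
     ('a \<times> 'a set \<Rightarrow> real) \<Rightarrow> ('a \<Rightarrow> 'a set) \<Rightarrow> bool" where
  "infinitesimal_coisotropic_deformation M \<theta> S \<tau> h s \<longleftrightarrow>
     section_NS M S s \<and> P_zero M S (lie_deriv (vert_deriv s) (jacobi_NS M \<theta> S \<tau> h))"

text \<open>The value \<open>s 0\<close> is not used.\<close>

definition formal_coisotropic_deformation ::
    "'a::euclidean_space set \<Rightarrow> ('a \<Rightarrow> 'a \<Rightarrow> real) \<Rightarrow> 'a set \<Rightarrow> ('a \<times> 'a set \<Rightarrow> 'a) \<Rightarrow>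
     ('a \<times> 'a set \<Rightarrow> real) \<Rightarrow> (nat \<Rightarrow> 'a \<Rightarrow> 'a set) \<Rightarrow> bool" where
  "formal_coisotropic_deformation M \<theta> S \<tau> h s \<longleftrightarrow>
     (\<forall>i\<ge>1. section_NS M S (s i)) \<and> (\<forall>k. P_zero M S (exp_lie_coeff s (jacobi_NS M \<theta> S \<tau> h) k))"

definition formally_prolongable ::
    "'a::euclidean_space set \<Rightarrow> ('a \<Rightarrow> 'a \<Rightarrow> real) \<Rightarrow> 'a set \<Rightarrow> ('a \<times> 'a set \<Rightarrow> 'a) \<Rightarrow>
     ('a \<times> 'a set \<Rightarrow> real) \<Rightarrow> ('a \<Rightarrow> 'a set) \<Rightarrow> bool" where
  "formally_prolongable M \<theta> S \<tau> h s \<longleftrightarrow>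
     (\<exists>\<sigma>. formal_coisotropic_deformation M \<theta> S \<tau> h \<sigma> \<and> (\<forall>x\<in>S. \<sigma> 1 x = s x))"

text \<open>The fat tubular neighborhood is an auxiliary choice; obstructedness is required for each.\<close>

definition formally_obstructed ::
    "'a::euclidean_space set \<Rightarrow> ('a \<Rightarrow> 'a \<Rightarrow> real) \<Rightarrow> 'a set \<Rightarrow> bool" where
  "formally_obstructed M \<theta> S \<longleftrightarrow>
     (\<forall>\<tau> h. fat_tubular_nbhd M S \<tau> h \<longrightarrow>
        (\<exists>s. infinitesimal_coisotropic_deformation M \<theta> S \<tau> h s \<and> \<not> formally_prolongable M \<theta> S \<tau> h s))"


section \<open>The contact manifold \<open>\<real>\<^sup>6 \<times> S\<^sup>1\<close>\<close>

text \<open>Points are triples \<open>(q, p, z)\<close> with \<open>z = e\<^bsup>i\<phi>\<^esup>\<close> in the unit circle of the complex plane.\<close>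

type_synonym ambient = "(real ^ 3) \<times> (real ^ 3) \<times> complex"

definition M_ex :: "ambient set" where
  "M_ex = {(q, p, z). cmod z = 1}"

text \<open>On the unit circle \<open>dz = i z d\<phi>\<close>, hence \<open>d\<phi> = Im (cnj z dz)\<close>.\<close>

definition theta_ex :: "ambient \<Rightarrow> ambient \<Rightarrow> real" where
  "theta_ex = (\<lambda>(q, p, z) (dq, dp, dz). Im (cnj z * dz) - (\<Sum>i\<in>UNIV. p $ i * dq $ i))"

definition H_ex :: "3 \<Rightarrow> ambient \<Rightarrow> real" where
  "H_ex i = (\<lambda>(q, p, z). ((q $ i)\<^sup>2 + (p $ i)\<^sup>2) / 2)"

definition S_ex :: "real \<Rightarrow> ambient set" where
  "S_ex \<alpha> = {x \<in> M_ex. H_ex 1 x + \<alpha> * H_ex 2 x = 1/4 \<and> H_ex 3 x = 1/2}"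

end

theory Submission
  imports Defs
begin

text \<open>Let \<open>\<alpha> = a / b\<close>. Put \<open>F\<^sub>1 = H\<^sub>(\<^sub>\<alpha>\<^sub>) - 1/4\<close>, \<open>F\<^sub>2 = H\<^sub>3 - 1/2\<close> and let \<open>X\<^sub>1\<close>, \<open>X\<^sub>2\<close> be their contact fields,
  which span the characteristic foliation of \<open>S\<close>. With \<open>z\<^sub>j = q\<^sup>j + i p\<^sub>j\<close>, the functions \<open>f\<^sub>1 = H\<^sub>1\<close> and
  \<open>f\<^sub>2 = Im (z\<^sub>1\<^sup>a cnj z\<^sub>2\<^sup>b)\<close> commute with \<open>F\<^sub>1\<close> and \<open>F\<^sub>2\<close> because of the resonance \<open>b \<alpha> = a\<close>, but
  \<open>{f\<^sub>1, f\<^sub>2} = a Re (z\<^sub>1\<^sup>a cnj z\<^sub>2\<^sup>b)\<close>. The obstructed infinitesimal deformation is the section of \<open>NS\<close> that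
  moves \<open>F\<^sub>1\<close>, \<open>F\<^sub>2\<close> by \<open>f\<^sub>1\<close>, \<open>f\<^sub>2\<close>. Evaluated on \<open>F\<^sub>1\<close>, \<open>F\<^sub>2\<close>, the second order equation of a formal
  prolongation reads \<open>{f\<^sub>1, f\<^sub>2} = X\<^sub>1 G\<^sub>2 - X\<^sub>2 G\<^sub>1\<close> on \<open>S\<close> for some smooth \<open>G\<^sub>1\<close>, \<open>G\<^sub>2\<close>, whichever fat tubular
  neighborhood is used. As \<open>{f\<^sub>1, f\<^sub>2}\<close> is constant along the leaves, integrating over large squares in a
  leaf, on which \<open>G\<^sub>1\<close>, \<open>G\<^sub>2\<close> are bounded, forces it to vanish, and it does not vanish on every leaf.\<close>

section \<open>Calculus of smooth maps\<close>

text \<open>No formula for \<open>I(s)\<close> is at hand, since the fat tubular neighborhood is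
  arbitrary. Everything is therefore carried over to the open set \<open>W = \<tau>(NS)\<close>,
  where \<open>I(s)\<close> becomes an operator \<open>d g = V g + \<kappa> g\<close>, and of
  \<open>V\<close> only its effect on the defining functions is kept: \<open>V F_i = f_i\<close> on
  S. Half the second Lie derivative of the bracket on F_1, F_2 contains the cross term
  \<open>{d F_1, d F_2}\<close>; every other term contains a bracket with some F_i, which is a
  derivative along X_i. The obstacle is that \<open>d F_i\<close> agrees with f_i on S only, while
  brackets and \<open>V\<close> differentiate across S. Two facts overcome it: the bracket of
  functions that are constant along the leaves depends only on their restrictions to S, and the
  commutators [V, X_i] are tangent to S. Then \<tau>, \<kappa> and the second order section enter
  only through the primitives G_i. The choice f_1 = H_1 is made because its contact field rotates
  z_1 and fixes z_2, so it turns the phase of the resonant monomial, which the two characteristic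
  fields preserve.\<close>

lemma Ck_on_Suc_imp: "Ck_on (Suc k) U f \<Longrightarrow> Ck_on k U f"
proof (induction k arbitrary: f)
  case 0
  then show ?case by (auto intro!: continuous_at_imp_continuous_on differentiable_imp_continuous_within)
next
  case (Suc k)
  then show ?case by (metis Ck_on.simps(2))
qed

lemma Ck_on_subset: "Ck_on k U f \<Longrightarrow> V \<subseteq> U \<Longrightarrow> Ck_on k V f"
proof (induction k arbitrary: f)
  case 0
  then show ?case by (auto intro: continuous_on_subset)
next
  case (Suc k)
  then show ?case by (simp add: subset_iff)
qed

lemma differentiable_transform_open:
  assumes "open U" "x \<in> U" "\<And>y. y \<in> U \<Longrightarrow> f y = g y" "f differentiable (at x)"
  shows "g differentiable (at x)"
proof -
  obtain f' where "(f has_derivative f') (at x)"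
    using assms(4) by (auto simp: differentiable_def)
  then have "(g has_derivative f') (at x)"
    using assms(1-3) by (rule has_derivative_transform_within_open)
  then show ?thesis by (auto simp: differentiable_def)
qed

lemma Ck_on_cong_imp:
  "open U \<Longrightarrow> (\<And>x. x \<in> U \<Longrightarrow> f x = g x) \<Longrightarrow> Ck_on k U f \<Longrightarrow> Ck_on k U g"
proof (induction k arbitrary: f g)
  case 0
  then show ?case by (auto cong: continuous_on_cong)
next
  case (Suc k)
  have fd: "f differentiable (at x)" if "x \<in> U" for x using Suc.prems(3) that by simp
  have eq: "frechet_derivative f (at x) = frechet_derivative g (at x)" if "x \<in> U" for x
    by (rule frechet_derivative_transform_within_open[OF fd[OF that] Suc.prems(1) that])
      (simp add: Suc.prems(2))
  have "g differentiable (at x)" if "x \<in> U" for x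
    using differentiable_transform_open[OF Suc.prems(1) that Suc.prems(2) fd[OF that]] by simp
  moreover have "Ck_on k U (\<lambda>x. frechet_derivative g (at x) v)" for v
    by (rule Suc.IH[of "\<lambda>x. frechet_derivative f (at x) v"]) (use Suc.prems eq in auto)
  ultimately show ?case by simp
qed

text \<open>Continuity and differentiability at a point see only a neighborhood of it. This turns
  the local extensions in \<open>smooth_fun\<close> into \<open>smooth_on\<close> on open
  sets.\<close>

lemma Ck_on_local:
  "(\<And>x. x \<in> U \<Longrightarrow> \<exists>V. open V \<and> x \<in> V \<and> Ck_on k V f) \<Longrightarrow> Ck_on k U f"
proof (induction k arbitrary: f)
  case 0
  then show ?case
    by (auto intro!: continuous_at_imp_continuous_on) (metis continuous_on_eq_continuous_at)
next
  case (Suc k)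
  have "f differentiable (at x)" if "x \<in> U" for x
    using Suc.prems[OF that] by auto
  moreover have "Ck_on k U (\<lambda>x. frechet_derivative f (at x) v)" for v
  proof (rule Suc.IH)
    fix x assume "x \<in> U"
    then show "\<exists>V. open V \<and> x \<in> V \<and> Ck_on k V (\<lambda>x. frechet_derivative f (at x) v)"
      using Suc.prems[of x] by auto
  qed
  ultimately show ?case by simp
qed

lemma frechet_derivative_eqI: "(f has_derivative f') (at x) \<Longrightarrow> frechet_derivative f (at x) = f'"
  using frechet_derivative_at by metis

lemma Ck_on_const: "Ck_on k U (\<lambda>x. c)"
proof (induction k arbitrary: c)
  case (Suc k)
  then show ?case by (simp add: frechet_derivative_const)
qed auto

text \<open>\<open>Ck_on\<close> speaks of \<open>frechet_derivative\<close>, a choice operator; the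
  inductions for sums, products, compositions, inverse and square root supply an explicit derivative
  through this rule.\<close>

lemma Ck_on_SucI:
  assumes "open U" "\<And>x. x \<in> U \<Longrightarrow> (f has_derivative f' x) (at x)" "\<And>v. Ck_on k U (\<lambda>x. f' x v)"
  shows "Ck_on (Suc k) U f"
proof -
  have "frechet_derivative f (at x) = f' x" if "x \<in> U" for x
    using frechet_derivative_eqI assms(2) that by blast
  then have "Ck_on k U (\<lambda>x. frechet_derivative f (at x) v)" for v
    by (intro Ck_on_cong_imp[OF assms(1) _ assms(3)[of v]]) simp
  then show ?thesis using assms(2) by (auto simp: differentiable_def)
qed

lemma Ck_on_SucD:
  assumes "Ck_on (Suc k) U f" "x \<in> U"
  shows "(f has_derivative frechet_derivative f (at x)) (at x)"
  using assms by (simp add: frechet_derivative_works)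

lemma Ck_on_add:
  "open U \<Longrightarrow> Ck_on k U f \<Longrightarrow> Ck_on k U g \<Longrightarrow> Ck_on k U (\<lambda>x. f x + g x)"
proof (induction k arbitrary: f g)
  case 0
  then show ?case by (auto intro: continuous_intros)
next
  case (Suc k)
  show ?case
  proof (rule Ck_on_SucI[where f' = "\<lambda>x v. frechet_derivative f (at x) v + frechet_derivative g (at x) v"])
    show "((\<lambda>x. f x + g x) has_derivative
        (\<lambda>v. frechet_derivative f (at x) v + frechet_derivative g (at x) v)) (at x)" if "x \<in> U" for x
      using that Ck_on_SucD Suc.prems by (intro has_derivative_add) blast+
  qed (use Suc in auto)
qed

lemma Ck_on_sum:
  assumes "open U" "\<And>i. i \<in> I \<Longrightarrow> Ck_on k U (f i)"
  shows "Ck_on k U (\<lambda>x. \<Sum>i\<in>I. f i x)"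
proof (cases "finite I")
  case True
  then show ?thesis using assms(2)
    by (induction) (auto intro!: Ck_on_const Ck_on_add assms(1))
qed (simp add: Ck_on_const)

lemma Ck_on_bounded_linear:
  assumes L: "bounded_linear L"
  shows "open U \<Longrightarrow> Ck_on k U f \<Longrightarrow> Ck_on k U (\<lambda>x. L (f x))"
proof (induction k arbitrary: f)
  case 0
  then show ?case using L by (auto intro: bounded_linear.continuous_on)
next
  case (Suc k)
  show ?case
  proof (rule Ck_on_SucI[where f' = "\<lambda>x v. L (frechet_derivative f (at x) v)"])
    show "((\<lambda>x. L (f x)) has_derivative (\<lambda>v. L (frechet_derivative f (at x) v))) (at x)"
      if "x \<in> U" for x
      using that Ck_on_SucD Suc.prems by (intro bounded_linear.has_derivative[OF L]) blast+
  qed (use Suc in auto)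
qed

lemma Ck_on_bounded_bilinear:
  assumes B: "bounded_bilinear B"
  shows "open U \<Longrightarrow> Ck_on k U f \<Longrightarrow> Ck_on k U g \<Longrightarrow> Ck_on k U (\<lambda>x. B (f x) (g x))"
proof (induction k arbitrary: f g)
  case 0
  then show ?case using B by (auto intro: bounded_bilinear.continuous_on)
next
  case (Suc k)
  show ?case
  proof (rule Ck_on_SucI[where f' = "\<lambda>x v. B (f x) (frechet_derivative g (at x) v) +
      B (frechet_derivative f (at x) v) (g x)"])
    show "((\<lambda>x. B (f x) (g x)) has_derivative (\<lambda>v. B (f x) (frechet_derivative g (at x) v) +
      B (frechet_derivative f (at x) v) (g x))) (at x)"
      if "x \<in> U" for x
      by (intro bounded_bilinear.FDERIV[OF B] Ck_on_SucD[OF Suc.prems(2) that] Ck_on_SucD[OF Suc.prems(3) that])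
    show "Ck_on k U (\<lambda>x. B (f x) (frechet_derivative g (at x) v) +
      B (frechet_derivative f (at x) v) (g x))" for v
      using Suc.prems by (intro Ck_on_add Suc.IH) (auto intro: Ck_on_Suc_imp simp del: Ck_on.simps(2),
        auto)
  qed (use Suc in auto)
qed

lemma linear_sum_Basis:
  fixes L :: "'a::euclidean_space \<Rightarrow> 'b::real_vector"
  assumes "linear L"
  shows "L v = (\<Sum>b\<in>Basis. (v \<bullet> b) *\<^sub>R L b)"
proof -
  have "L v = L (\<Sum>b\<in>Basis. (v \<bullet> b) *\<^sub>R b)" by (simp add: euclidean_representation)
  also have "\<dots> = (\<Sum>b\<in>Basis. (v \<bullet> b) *\<^sub>R L b)"
    using assms by (simp add: linear_sum linear_cmul)
  finally show ?thesis .
qed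

text \<open>By the chain rule the derivative is \<open>g'(f x) (f' x v)\<close>, whose direction
  moves with \<open>x\<close>, whereas \<open>Ck_on\<close> controls \<open>g'\<close> in fixed
  directions. Expanding \<open>f' x v\<close> in the basis makes the directions constant, and the
  induction hypothesis applies to each \<open>g'(f x) b\<close>.\<close>

lemma Ck_on_compose:
  fixes f :: "'a::euclidean_space \<Rightarrow> 'b::euclidean_space" and g :: "'b \<Rightarrow> 'c::euclidean_space"
  shows "open U \<Longrightarrow> open V \<Longrightarrow> f ` U \<subseteq> V \<Longrightarrow> Ck_on k U f \<Longrightarrow> Ck_on k V g \<Longrightarrow> Ck_on k U (\<lambda>x. g (f x))"
proof (induction k arbitrary: f g)
  case 0
  then show ?case by (auto intro: continuous_on_compose2)
next
  case (Suc k)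
  let ?f' = "\<lambda>x. frechet_derivative f (at x)" and ?g' = "\<lambda>x. frechet_derivative g (at x)"
  have gd: "(g has_derivative ?g' (f x)) (at (f x))" if "x \<in> U" for x
    using that Suc.prems by (intro Ck_on_SucD[of k V]) auto
  show ?case
  proof (rule Ck_on_SucI[where f' = "\<lambda>x v. \<Sum>b\<in>Basis. (?f' x v \<bullet> b) *\<^sub>R ?g' (f x) b"])
    fix x assume x: "x \<in> U"
    have "((\<lambda>x. g (f x)) has_derivative (\<lambda>v. ?g' (f x) (?f' x v))) (at x)"
      using has_derivative_compose[OF Ck_on_SucD[OF Suc.prems(4) x] gd[OF x]] .
    also have "(\<lambda>v. ?g' (f x) (?f' x v)) = (\<lambda>v. \<Sum>b\<in>Basis. (?f' x v \<bullet> b) *\<^sub>R ?g' (f x) b)"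
      using linear_sum_Basis[OF has_derivative_linear[OF gd[OF x]]] by blast
    finally show "((\<lambda>x. g (f x)) has_derivative \<dots>) (at x)" .
  next
    fix v
    have *: "Ck_on k U f" "\<And>b. Ck_on k V (\<lambda>x. ?g' x b)" "Ck_on k U (\<lambda>x. ?f' x v)"
      using Suc.prems by (auto intro: Ck_on_Suc_imp simp del: Ck_on.simps(2)) auto
    show "Ck_on k U (\<lambda>x. \<Sum>b\<in>Basis. (?f' x v \<bullet> b) *\<^sub>R ?g' (f x) b)"
      using Suc.prems(1-3) *
      by (intro Ck_on_sum Ck_on_bounded_bilinear[OF bounded_bilinear_scaleR]
          Ck_on_bounded_linear[OF bounded_linear_inner_left] Suc.IH) auto
  qed (use Suc.prems in auto)
qed

text \<open>The derivative is a polynomial in the function itself, so the induction hypothesis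
  covers it.\<close>

lemma Ck_on_inverse: "Ck_on k (- {0}) (inverse :: real \<Rightarrow> real)"
proof (induction k)
  case 0
  then show ?case by (auto intro!: continuous_intros)
next
  case (Suc k)
  have o: "open (- {0 :: real})" by auto
  show ?case
    by (rule Ck_on_SucI[OF o, where f' = "\<lambda>x v. - (inverse x * v * inverse x)"])
      (auto intro!: has_derivative_inverse' Ck_on_bounded_linear[OF bounded_linear_minus[OF bounded_linear_ident]]
        Ck_on_bounded_bilinear[OF bounded_bilinear_mult] o Suc Ck_on_const)
qed

lemma Ck_on_sqrt: "Ck_on k {0<..} sqrt"
proof (induction k)
  case 0
  then show ?case by (auto intro!: continuous_intros)
next
  case (Suc k)
  have o: "open {0 :: real<..}" by auto
  have "Ck_on k {0<..} (\<lambda>x. inverse (sqrt x))"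
    by (rule Ck_on_compose[OF o _ _ Suc Ck_on_inverse]) auto
  then have "Ck_on k {0<..} (\<lambda>x. inverse (sqrt x) * (v / 2))" for v
    by (intro Ck_on_bounded_bilinear[OF bounded_bilinear_mult] o Ck_on_const)
  then show ?case
    by (intro Ck_on_SucI[OF o, where f' = "\<lambda>x v. inverse (sqrt x) * (v / 2)"])
      (auto intro!: derivative_eq_intros simp: field_simps)
qed

lemma Ck_on_ident: "Ck_on k U (\<lambda>x. x)"
proof (induction k)
  case (Suc k)
  then show ?case by (simp add: frechet_derivative_eqI[OF has_derivative_ident] Ck_on_const)
qed auto

section \<open>Symmetry of second derivatives\<close>

lemma second_difference_mvt:
  fixes F :: "'a::euclidean_space \<Rightarrow> real"
  assumes F: "Ck_on 2 U F" and t: "0 < t"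
    and sub: "\<And>a b. 0 \<le> a \<Longrightarrow> a \<le> t \<Longrightarrow> 0 \<le> b \<Longrightarrow> b \<le> t \<Longrightarrow> x + a *\<^sub>R v + b *\<^sub>R w \<in> U"
  shows "\<exists>a b. 0 \<le> a \<and> a \<le> t \<and> 0 \<le> b \<and> b \<le> t \<and>
    F (x + t *\<^sub>R v + t *\<^sub>R w) - F (x + t *\<^sub>R v) - F (x + t *\<^sub>R w) + F x =
    t * t * frechet_derivative (\<lambda>y. frechet_derivative F (at y) v) (at (x + a *\<^sub>R v + b *\<^sub>R w)) w"
proof -
  let ?D = "\<lambda>y. frechet_derivative F (at y)" and ?Dv = "\<lambda>y. frechet_derivative F (at y) v"
  have F1: "Ck_on (Suc 1) U F" and F2: "Ck_on (Suc 0) U ?Dv"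
    using F by (simp_all add: numeral_2_eq_2)
  have d1: "(F has_derivative ?D y) (at y)" if "y \<in> U" for y
    using Ck_on_SucD[OF F1 that] .
  have d2: "(?Dv has_derivative frechet_derivative ?Dv (at y)) (at y)" if "y \<in> U" for y
    using Ck_on_SucD[OF F2 that] .
  \<comment> \<open>The mean value theorem is applied to \<open>p\<close>, a difference in the
    direction \<open>w\<close>, along \<open>v\<close>; a second application, to the derivative of
    \<open>F\<close> along \<open>v\<close>, runs along \<open>w\<close>.\<close>
  define p where "p s = F (x + s *\<^sub>R v + t *\<^sub>R w) - F (x + s *\<^sub>R v + 0 *\<^sub>R w)" for s
  have line: "((\<lambda>s. F (x + s *\<^sub>R v + b *\<^sub>R w)) has_real_derivative ?Dv (x + s *\<^sub>R v + b *\<^sub>R w)) (at s)"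
    if "0 \<le> s" "s \<le> t" "0 \<le> b" "b \<le> t" for s b
  proof -
    have "((\<lambda>s. x + s *\<^sub>R v + b *\<^sub>R w) has_derivative (\<lambda>h. h *\<^sub>R v)) (at s)"
      by (auto intro!: derivative_eq_intros)
    from has_derivative_compose[OF this d1[OF sub[OF that]]]
    have "((\<lambda>s. F (x + s *\<^sub>R v + b *\<^sub>R w)) has_derivative (\<lambda>h. ?D (x + s *\<^sub>R v + b *\<^sub>R w) (h *\<^sub>R v))) (at s)" .
    moreover have "?D (x + s *\<^sub>R v + b *\<^sub>R w) (h *\<^sub>R v) = ?Dv (x + s *\<^sub>R v + b *\<^sub>R w) * h" for h
      using has_derivative_linear[OF d1[OF sub[OF that]]] by (simp add: linear_cmul mult.commute)
    ultimately show ?thesis by (simp add: has_field_derivative_def)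
  qed
  have "\<exists>z. 0 < z \<and> z < t \<and> p t - p 0 = (t - 0) * (?Dv (x + z *\<^sub>R v + t *\<^sub>R w) - ?Dv (x + z *\<^sub>R v + 0 *\<^sub>R w))"
    using t unfolding p_def by (intro MVT2) (auto intro!: DERIV_diff line simp del: scaleR_zero_left)
  then obtain a where a: "0 < a" "a < t"
    and pa: "p t - p 0 = t * (?Dv (x + a *\<^sub>R v + t *\<^sub>R w) - ?Dv (x + a *\<^sub>R v + 0 *\<^sub>R w))" by auto
  have line2: "((\<lambda>s. ?Dv (x + a *\<^sub>R v + s *\<^sub>R w)) has_real_derivative
      frechet_derivative ?Dv (at (x + a *\<^sub>R v + s *\<^sub>R w)) w) (at s)"
    if "0 \<le> s" "s \<le> t" for s
  proof -
    have U: "x + a *\<^sub>R v + s *\<^sub>R w \<in> U" using sub a that by simp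
    have "((\<lambda>s. x + a *\<^sub>R v + s *\<^sub>R w) has_derivative (\<lambda>h. h *\<^sub>R w)) (at s)"
      by (auto intro!: derivative_eq_intros)
    from has_derivative_compose[OF this d2[OF U]]
    have "((\<lambda>s. ?Dv (x + a *\<^sub>R v + s *\<^sub>R w)) has_derivative
      (\<lambda>h. frechet_derivative ?Dv (at (x + a *\<^sub>R v + s *\<^sub>R w)) (h *\<^sub>R w))) (at s)" .
    moreover have "frechet_derivative ?Dv (at (x + a *\<^sub>R v + s *\<^sub>R w)) (h *\<^sub>R w) =
       frechet_derivative ?Dv (at (x + a *\<^sub>R v + s *\<^sub>R w)) w * h" for h
      using has_derivative_linear[OF d2[OF U]] by (simp add: linear_cmul mult.commute)
    ultimately show ?thesis by (simp add: has_field_derivative_def)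
  qed
  have "\<exists>z. 0 < z \<and> z < t \<and> ?Dv (x + a *\<^sub>R v + t *\<^sub>R w) - ?Dv (x + a *\<^sub>R v + 0 *\<^sub>R w) =
      (t - 0) * frechet_derivative ?Dv (at (x + a *\<^sub>R v + z *\<^sub>R w)) w"
    using t by (intro MVT2) (auto intro!: line2 simp del: scaleR_zero_left)
  then obtain b where b: "0 < b" "b < t" and
    pb: "?Dv (x + a *\<^sub>R v + t *\<^sub>R w) - ?Dv (x + a *\<^sub>R v + 0 *\<^sub>R w) =
      t * frechet_derivative ?Dv (at (x + a *\<^sub>R v + b *\<^sub>R w)) w" by auto
  have "p t - p 0 = t * t * frechet_derivative ?Dv (at (x + a *\<^sub>R v + b *\<^sub>R w)) w"
    using pa pb by simp
  moreover have "p t - p 0 = F (x + t *\<^sub>R v + t *\<^sub>R w) - F (x + t *\<^sub>R v) - F (x + t *\<^sub>R w) + F x"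
    by (simp add: p_def)
  ultimately show ?thesis using a b by (intro exI[of _ a] exI[of _ b]) auto
qed

text \<open>The second difference of \<open>F\<close> over a small parallelogram is symmetric in
  \<open>v\<close> and \<open>w\<close>; divided by \<open>t * t\<close> it is a value near
  \<open>x\<close> of either mixed derivative, and both are continuous at \<open>x\<close>.\<close>

lemma second_derivative_symmetric_real:
  fixes F :: "'a::euclidean_space \<Rightarrow> real"
  assumes F: "Ck_on 2 U F" and U: "open U" "x \<in> U"
  shows "frechet_derivative (\<lambda>y. frechet_derivative F (at y) v) (at x) w =
    frechet_derivative (\<lambda>y. frechet_derivative F (at y) w) (at x) v"
proof -
  define A where "A y = frechet_derivative (\<lambda>y. frechet_derivative F (at y) v) (at y) w" for y
  define B where "B y = frechet_derivative (\<lambda>y. frechet_derivative F (at y) w) (at y) v" for y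
  have "isCont A x" "isCont B x"
    using F U unfolding A_def B_def by (auto simp: numeral_2_eq_2 continuous_on_eq_continuous_at)
  have "\<bar>A x - B x\<bar> \<le> e" if e: "e > 0" for e
  proof -
    obtain r1 where r1: "r1 > 0" "\<And>y. dist y x < r1 \<Longrightarrow> \<bar>A y - A x\<bar> < e / 2"
      using \<open>isCont A x\<close> e unfolding continuous_at_eps_delta
      by (metis dist_real_def half_gt_zero)
    obtain r2 where r2: "r2 > 0" "\<And>y. dist y x < r2 \<Longrightarrow> \<bar>B y - B x\<bar> < e / 2"
      using \<open>isCont B x\<close> e unfolding continuous_at_eps_delta
      by (metis dist_real_def half_gt_zero)
    obtain r3 where r3: "r3 > 0" "ball x r3 \<subseteq> U"
      using U openE by blast
    define r where "r = min r1 (min r2 r3)"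
    \<comment> \<open>Keeps the parallelogram spanned by \<open>t v\<close> and \<open>t w\<close>
      within \<open>r / 2\<close> of \<open>x\<close>; the summand 1 covers
      \<open>v = w = 0\<close>.\<close>
    define t where "t = r / (2 * (norm v + norm w + 1))"
    have r: "r > 0" using r1 r2 r3 by (simp add: r_def)
    have n: "norm v + norm w + 1 > 0" by (simp add: add_nonneg_pos)
    then have t: "t > 0" using r by (simp add: t_def)
    have near: "dist (x + a *\<^sub>R v + b *\<^sub>R w) x < r" if "0 \<le> a" "a \<le> t" "0 \<le> b" "b \<le> t" for a b
    proof -
      have "dist (x + a *\<^sub>R v + b *\<^sub>R w) x = norm (a *\<^sub>R v + b *\<^sub>R w)" by (simp add: dist_norm algebra_simps)
      also have "\<dots> \<le> a * norm v + b * norm w"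
        using norm_triangle_ineq[of "a *\<^sub>R v" "b *\<^sub>R w"] that by simp
      also have "\<dots> \<le> t * norm v + t * norm w"
        using that by (intro add_mono mult_right_mono) auto
      also have "\<dots> \<le> t * (norm v + norm w + 1)" using t by (simp add: algebra_simps)
      also have "\<dots> = r / 2" using n by (simp add: t_def divide_simps)
      also have "\<dots> < r" using r by simp
      finally show ?thesis .
    qed
    have inU: "x + a *\<^sub>R v + b *\<^sub>R w \<in> U" if "0 \<le> a" "a \<le> t" "0 \<le> b" "b \<le> t" for a b
      using near[OF that] r3 by (auto simp: r_def dist_commute subset_iff)
    obtain a b where ab: "0 \<le> a" "a \<le> t" "0 \<le> b" "b \<le> t" and
      1: "F (x + t *\<^sub>R v + t *\<^sub>R w) - F (x + t *\<^sub>R v) - F (x + t *\<^sub>R w) + F x = t * t * A (x + a *\<^sub>R v + b *\<^sub>R w)"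
      using second_difference_mvt[OF F t, of x v w] inU unfolding A_def by blast
    have inU': "x + a *\<^sub>R w + b *\<^sub>R v \<in> U" if "0 \<le> a" "a \<le> t" "0 \<le> b" "b \<le> t" for a b
      using inU[of b a] that by (simp add: algebra_simps)
    obtain b' a' where ab': "0 \<le> a'" "a' \<le> t" "0 \<le> b'" "b' \<le> t" and
      2: "F (x + t *\<^sub>R w + t *\<^sub>R v) - F (x + t *\<^sub>R w) - F (x + t *\<^sub>R v) + F x = t * t * B (x + b' *\<^sub>R w + a' *\<^sub>R v)"
      using second_difference_mvt[OF F t, of x w v] inU' unfolding B_def by blast
    have "t * t * A (x + a *\<^sub>R v + b *\<^sub>R w) = t * t * B (x + a' *\<^sub>R v + b' *\<^sub>R w)"
      using 1 2 by (simp add: algebra_simps)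
    then have "A (x + a *\<^sub>R v + b *\<^sub>R w) = B (x + a' *\<^sub>R v + b' *\<^sub>R w)" using t by simp
    moreover have "\<bar>A (x + a *\<^sub>R v + b *\<^sub>R w) - A x\<bar> < e / 2"
      using near[OF ab] by (intro r1) (simp add: r_def)
    moreover have "\<bar>B (x + a' *\<^sub>R v + b' *\<^sub>R w) - B x\<bar> < e / 2"
      using near[OF ab'] by (intro r2) (simp add: r_def)
    ultimately show ?thesis by linarith
  qed
  then have "\<bar>A x - B x\<bar> \<le> 0" by (rule field_le_epsilon[of _ 0, simplified])
  then show ?thesis by (simp add: A_def B_def)
qed

section \<open>Smooth functions on arbitrary subsets of a Euclidean space\<close>

lemma smooth_funI:
  assumes "smooth_on U f" "open U" "A \<subseteq> U"
  shows "smooth_fun A f"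
  using assms unfolding smooth_fun_def by blast

lemma smooth_fun_imp_smooth_on:
  assumes "smooth_fun U f" "open U"
  shows "smooth_on U f"
  unfolding smooth_on_def
proof
  fix k
  show "Ck_on k U f"
  proof (rule Ck_on_local)
    fix x assume "x \<in> U"
    then obtain V g where V: "open V" "x \<in> V" "smooth_on V g" "\<forall>y\<in>U \<inter> V. f y = g y"
      using assms(1) unfolding smooth_fun_def by blast
    then have "Ck_on k (V \<inter> U) g"
      by (auto simp: smooth_on_def intro: Ck_on_subset)
    then have "Ck_on k (V \<inter> U) f"
      using V assms(2) by (elim Ck_on_cong_imp[rotated 2]) auto
    then show "\<exists>V. open V \<and> x \<in> V \<and> Ck_on k V f"
      using V(1,2) assms(2) \<open>x \<in> U\<close> by (intro exI[of _ "V \<inter> U"]) auto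
  qed
qed

lemma smooth_fun_open_iff: "open U \<Longrightarrow> smooth_fun U f \<longleftrightarrow> smooth_on U f"
  using smooth_funI smooth_fun_imp_smooth_on by blast

lemma smooth_fun_subset: "smooth_fun A f \<Longrightarrow> B \<subseteq> A \<Longrightarrow> smooth_fun B f"
  unfolding smooth_fun_def
proof
  fix x assume A: "\<forall>x\<in>A. \<exists>U g. open U \<and> x \<in> U \<and> smooth_on U g \<and> (\<forall>y\<in>A \<inter> U. f y = g y)"
    and "B \<subseteq> A" "x \<in> B"
  then obtain U g where "open U" "x \<in> U" "smooth_on U g" "\<forall>y\<in>A \<inter> U. f y = g y"
    by blast
  then show "\<exists>U g. open U \<and> x \<in> U \<and> smooth_on U g \<and> (\<forall>y\<in>B \<inter> U. f y = g y)"
    using \<open>B \<subseteq> A\<close> by (intro exI[of _ U] exI[of _ g]) auto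
qed

lemma smooth_fun_cong: "(\<And>x. x \<in> A \<Longrightarrow> f x = g x) \<Longrightarrow> smooth_fun A f \<Longrightarrow> smooth_fun A g"
  unfolding smooth_fun_def by (metis IntD1)

lemma smooth_on_subset: "smooth_on U f \<Longrightarrow> V \<subseteq> U \<Longrightarrow> smooth_on V f"
  unfolding smooth_on_def using Ck_on_subset by blast

lemma smooth_on_imp_continuous_on: "smooth_on U f \<Longrightarrow> continuous_on U f"
  unfolding smooth_on_def by (metis Ck_on.simps(1))

lemma smooth_on_has_derivative:
  assumes "smooth_on U f" "x \<in> U"
  shows "(f has_derivative frechet_derivative f (at x)) (at x)"
  using Ck_on_SucD[of 0 U f x] assms unfolding smooth_on_def by blast

lemma smooth_on_frechet_derivative:
  assumes "smooth_on U f"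
  shows "smooth_on U (\<lambda>x. frechet_derivative f (at x) v)"
  unfolding smooth_on_def
proof
  fix k
  have "Ck_on (Suc k) U f" using assms unfolding smooth_on_def by blast
  then show "Ck_on k U (\<lambda>x. frechet_derivative f (at x) v)" by simp
qed

lemma smooth_on_compose:
  assumes "open U" "open V" "f ` U \<subseteq> V" "smooth_on U f" "smooth_on V g"
  shows "smooth_on U (\<lambda>x. g (f x))"
  unfolding smooth_on_def
  by (rule allI, rule Ck_on_compose[OF assms(1-3)]) (use assms(4,5) in \<open>simp_all add: smooth_on_def\<close>)

lemma smooth_fun_compose:
  assumes f: "smooth_fun A f" and g: "smooth_fun B g" and "f ` A \<subseteq> B"
  shows "smooth_fun A (\<lambda>x. g (f x))"
  unfolding smooth_fun_def
proof
  fix x assume x: "x \<in> A"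
  obtain U f1 where U: "open U" "x \<in> U" "smooth_on U f1" "\<forall>y\<in>A \<inter> U. f y = f1 y"
    using f x unfolding smooth_fun_def by blast
  have "f x \<in> B" using x assms(3) by blast
  then obtain V g1 where V: "open V" "f x \<in> V" "smooth_on V g1" "\<forall>y\<in>B \<inter> V. g y = g1 y"
    using g unfolding smooth_fun_def by blast
  \<comment> \<open>Off \<open>A\<close> the extension of \<open>f\<close> may leave the domain of
    the extension of \<open>g\<close>, so the neighborhood is cut down to the points where it stays
    inside.\<close>
  define U' where "U' = U \<inter> f1 -` V"
  have o: "open U'" unfolding U'_def
    by (rule continuous_open_preimage[OF smooth_on_imp_continuous_on[OF U(3)] U(1) V(1)])
  have s: "smooth_on U' (\<lambda>x. g1 (f1 x))"
    by (rule smooth_on_compose[OF o V(1) _ _ V(3)]) (auto simp: U'_def intro: smooth_on_subset[OF U(3)])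
  have xU: "x \<in> U'" using U V x by (simp add: U'_def)
  have eq: "\<forall>y\<in>A \<inter> U'. g (f y) = g1 (f1 y)"
  proof
    fix y assume y: "y \<in> A \<inter> U'"
    have "f y = f1 y" using y U(4) by (simp add: U'_def)
    moreover have "f y \<in> B" using y assms(3) by blast
    ultimately show "g (f y) = g1 (f1 y)" using V(4) y by (simp add: U'_def)
  qed
  show "\<exists>U h. open U \<and> x \<in> U \<and> smooth_on U h \<and> (\<forall>y\<in>A \<inter> U. g (f y) = h y)"
    by (rule exI[of _ U'], rule exI[of _ "\<lambda>x. g1 (f1 x)"]) (intro conjI o s xU eq)
qed

lemma smooth_fun_const: "smooth_fun A (\<lambda>x. c)"
  by (rule smooth_funI[of UNIV]) (auto simp: smooth_on_def Ck_on_const)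

lemma smooth_fun_ident: "smooth_fun A (\<lambda>x. x)"
  by (rule smooth_funI[of UNIV]) (auto simp: smooth_on_def Ck_on_ident)

lemma smooth_fun_bounded_linear_UNIV: "bounded_linear L \<Longrightarrow> smooth_fun A L"
  by (rule smooth_funI[of UNIV]) (auto simp: smooth_on_def intro: Ck_on_bounded_linear[OF _ _ Ck_on_ident])

lemma smooth_fun_bounded_linear: "bounded_linear L \<Longrightarrow> smooth_fun A f \<Longrightarrow> smooth_fun A (\<lambda>x. L (f x))"
  by (rule smooth_fun_compose[OF _ smooth_fun_bounded_linear_UNIV]) auto

lemma smooth_fun_bounded_bilinear:
  assumes B: "bounded_bilinear B" and f: "smooth_fun A f" and g: "smooth_fun A g"
  shows "smooth_fun A (\<lambda>x. B (f x) (g x))"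
  unfolding smooth_fun_def
proof
  fix x assume x: "x \<in> A"
  obtain U f1 where U: "open U" "x \<in> U" "smooth_on U f1" "\<forall>y\<in>A \<inter> U. f y = f1 y"
    using f x unfolding smooth_fun_def by blast
  obtain V g1 where V: "open V" "x \<in> V" "smooth_on V g1" "\<forall>y\<in>A \<inter> V. g y = g1 y"
    using g x unfolding smooth_fun_def by blast
  have "smooth_on (U \<inter> V) (\<lambda>x. B (f1 x) (g1 x))"
    using U V unfolding smooth_on_def
    by (intro allI Ck_on_bounded_bilinear[OF B]) (auto intro: Ck_on_subset)
  then show "\<exists>U h. open U \<and> x \<in> U \<and> smooth_on U h \<and> (\<forall>y\<in>A \<inter> U. B (f y) (g y) = h y)"
    using U V by (intro exI[of _ "U \<inter> V"] exI[of _ "\<lambda>x. B (f1 x) (g1 x)"] conjI ballI) (simp_all add: open_Int)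
qed

lemma smooth_fun_Pair:
  assumes f: "smooth_fun A f" and g: "smooth_fun A g"
  shows "smooth_fun A (\<lambda>x. (f x, g x))"
  unfolding smooth_fun_def
proof
  fix x assume x: "x \<in> A"
  obtain U f1 where U: "open U" "x \<in> U" "smooth_on U f1" "\<forall>y\<in>A \<inter> U. f y = f1 y"
    using f x unfolding smooth_fun_def by blast
  obtain V g1 where V: "open V" "x \<in> V" "smooth_on V g1" "\<forall>y\<in>A \<inter> V. g y = g1 y"
    using g x unfolding smooth_fun_def by blast
  have "smooth_on (U \<inter> V) (\<lambda>x. (f1 x, 0) + (0, g1 x))"
    using U V unfolding smooth_on_def
    by (intro allI Ck_on_add Ck_on_bounded_linear[OF bounded_linear_Pair[OF bounded_linear_ident bounded_linear_zero]]
        Ck_on_bounded_linear[OF bounded_linear_Pair[OF bounded_linear_zero bounded_linear_ident]])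
      (auto intro: Ck_on_subset)
  then have "smooth_on (U \<inter> V) (\<lambda>x. (f1 x, g1 x))" by simp
  then show "\<exists>U h. open U \<and> x \<in> U \<and> smooth_on U h \<and> (\<forall>y\<in>A \<inter> U. (f y, g y) = h y)"
    using U V by (intro exI[of _ "U \<inter> V"] exI[of _ "\<lambda>x. (f1 x, g1 x)"] conjI ballI) (simp_all add: open_Int)
qed

lemma smooth_fun_add:
  assumes "smooth_fun A f" "smooth_fun A g"
  shows "smooth_fun A (\<lambda>x. f x + g x)"
  using smooth_fun_bounded_linear[OF bounded_linear_add[OF bounded_linear_fst bounded_linear_snd]
      smooth_fun_Pair[OF assms]] by simp

lemma smooth_fun_minus: "smooth_fun A f \<Longrightarrow> smooth_fun A (\<lambda>x. - f x)"
  by (rule smooth_fun_bounded_linear[OF bounded_linear_minus[OF bounded_linear_ident]])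

lemma smooth_fun_diff: "smooth_fun A f \<Longrightarrow> smooth_fun A g \<Longrightarrow> smooth_fun A (\<lambda>x. f x - g x)"
  using smooth_fun_add[OF _ smooth_fun_minus, of A f g] by simp

lemma smooth_fun_sum: "(\<And>i. i \<in> I \<Longrightarrow> smooth_fun A (f i)) \<Longrightarrow> smooth_fun A (\<lambda>x. \<Sum>i\<in>I. f i x)"
proof (cases "finite I")
  case True
  then show "(\<And>i. i \<in> I \<Longrightarrow> smooth_fun A (f i)) \<Longrightarrow> ?thesis"
    by (induction) (auto intro!: smooth_fun_const smooth_fun_add)
qed (simp add: smooth_fun_const)

lemmas smooth_fun_mult = smooth_fun_bounded_bilinear[OF bounded_bilinear_mult]
lemmas smooth_fun_scaleR = smooth_fun_bounded_bilinear[OF bounded_bilinear_scaleR]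
lemmas smooth_fun_inner = smooth_fun_bounded_bilinear[OF bounded_bilinear_inner]

lemma smooth_fun_fst: "smooth_fun A f \<Longrightarrow> smooth_fun A (\<lambda>x. fst (f x))"
  by (rule smooth_fun_bounded_linear[OF bounded_linear_fst])

lemma smooth_fun_snd: "smooth_fun A f \<Longrightarrow> smooth_fun A (\<lambda>x. snd (f x))"
  by (rule smooth_fun_bounded_linear[OF bounded_linear_snd])

lemma smooth_fun_inverse:
  fixes f :: "'a::euclidean_space \<Rightarrow> real"
  assumes "smooth_fun A f" "\<And>x. x \<in> A \<Longrightarrow> f x \<noteq> 0"
  shows "smooth_fun A (\<lambda>x. inverse (f x))"
proof -
  have "smooth_fun (- {0}) (inverse :: real \<Rightarrow> real)"
    by (rule smooth_funI[of "- {0}"]) (auto simp: smooth_on_def Ck_on_inverse)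
  then show ?thesis using assms by (intro smooth_fun_compose[of A f "- {0}" inverse]) auto
qed

lemma smooth_fun_divide:
  fixes f :: "'a::euclidean_space \<Rightarrow> real"
  assumes "smooth_fun A f" "smooth_fun A g" "\<And>x. x \<in> A \<Longrightarrow> g x \<noteq> 0"
  shows "smooth_fun A (\<lambda>x. f x / g x)"
  unfolding divide_inverse using assms by (intro smooth_fun_mult smooth_fun_inverse) auto

lemma smooth_fun_sqrt:
  fixes f :: "'a::euclidean_space \<Rightarrow> real"
  assumes "smooth_fun A f" "\<And>x. x \<in> A \<Longrightarrow> f x > 0"
  shows "smooth_fun A (\<lambda>x. sqrt (f x))"
proof -
  have "smooth_fun {0<..} sqrt"
    by (rule smooth_funI[of "{0<..}"]) (auto simp: smooth_on_def Ck_on_sqrt)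
  then show ?thesis using assms by (intro smooth_fun_compose[of A f "{0<..}" sqrt]) auto
qed

lemma smooth_fun_power:
  fixes f :: "'a::euclidean_space \<Rightarrow> 'b::{euclidean_space, real_normed_algebra_1}"
  shows "smooth_fun A f \<Longrightarrow> smooth_fun A (\<lambda>x. f x ^ n)"
  by (induction n) (auto intro: smooth_fun_const smooth_fun_mult)

text \<open>Smoothness of the inverse of a tubular neighborhood map is given in terms of real
  functions only; vector-valued maps are reached through their coordinates.\<close>

lemma smooth_fun_componentwise:
  assumes "\<And>b. b \<in> Basis \<Longrightarrow> smooth_fun A (\<lambda>x. f x \<bullet> b)"
  shows "smooth_fun A f"
proof -
  have "smooth_fun A (\<lambda>x. \<Sum>b\<in>Basis. (f x \<bullet> b) *\<^sub>R b)"
    by (intro smooth_fun_sum smooth_fun_scaleR smooth_fun_const assms)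
  then show ?thesis by (simp add: euclidean_representation)
qed

lemma smooth_fun_imp_continuous_on:
  assumes "smooth_fun A f"
  shows "continuous_on A f"
  unfolding continuous_on_eq_continuous_within
proof
  fix x assume x: "x \<in> A"
  obtain U g where U: "open U" "x \<in> U" "smooth_on U g" "\<forall>y\<in>A \<inter> U. f y = g y"
    using assms x unfolding smooth_fun_def by blast
  have "continuous (at x within A) g"
    using smooth_on_imp_continuous_on[OF U(3)] U(1,2)
    by (simp add: continuous_on_eq_continuous_at continuous_at_imp_continuous_at_within)
  moreover obtain e where "e > 0" "ball x e \<subseteq> U" using U openE by blast
  ultimately show "continuous (at x within A) f"
    using U(4) x by (elim continuous_transform_within[where \<delta> = e]) (auto simp: subset_iff dist_commute)
qed

section \<open>Tangent vectors and derivatives on subsets\<close>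

text \<open>Again the moving direction is expanded in the basis, since smoothness of the derivative
  is known for constant directions.\<close>

lemma smooth_on_frechet_derivative_along:
  assumes "open U" "smooth_on U g" "smooth_on U w"
  shows "smooth_on U (\<lambda>x. frechet_derivative g (at x) (w x))"
proof -
  have "smooth_fun U (\<lambda>x. \<Sum>b\<in>Basis. (w x \<bullet> b) *\<^sub>R frechet_derivative g (at x) b)"
    using assms
    by (intro smooth_fun_sum smooth_fun_scaleR smooth_fun_bounded_linear[OF bounded_linear_inner_left])
      (auto intro: smooth_funI smooth_on_frechet_derivative)
  moreover have "(\<Sum>b\<in>Basis. (w x \<bullet> b) *\<^sub>R frechet_derivative g (at x) b) = frechet_derivative g (at x) (w x)"
    if "x \<in> U" for x
    using linear_sum_Basis[OF has_derivative_linear[OF smooth_on_has_derivative[OF assms(2) that]]] by metis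
  ultimately show ?thesis
    using smooth_fun_cong smooth_fun_imp_smooth_on assms(1) by (metis (no_types, lifting))
qed

lemma second_derivative_symmetric:
  fixes F :: "'a::euclidean_space \<Rightarrow> 'b::euclidean_space"
  assumes F: "smooth_on U F" and U: "open U" "x \<in> U"
  shows "frechet_derivative (\<lambda>y. frechet_derivative F (at y) v) (at x) w =
    frechet_derivative (\<lambda>y. frechet_derivative F (at y) w) (at x) v"
proof (rule euclidean_eqI)
  fix b :: 'b assume "b \<in> Basis"
  have Fb: "smooth_on U (\<lambda>y. F y \<bullet> b)"
    using F U unfolding smooth_on_def by (auto intro: Ck_on_bounded_linear[OF bounded_linear_inner_left])
  have 1: "frechet_derivative (\<lambda>y. F y \<bullet> b) (at y) u = frechet_derivative F (at y) u \<bullet> b" if "y \<in> U" for y u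
    using frechet_derivative_eqI[OF has_derivative_inner_left[OF smooth_on_has_derivative[OF F that]]] by simp
  have 2: "frechet_derivative (\<lambda>y. frechet_derivative (\<lambda>y. F y \<bullet> b) (at y) u) (at x) u' =
      frechet_derivative (\<lambda>y. frechet_derivative F (at y) u) (at x) u' \<bullet> b" for u u'
  proof -
    have "((\<lambda>y. frechet_derivative F (at y) u \<bullet> b) has_derivative
        (\<lambda>u'. frechet_derivative (\<lambda>y. frechet_derivative F (at y) u) (at x) u' \<bullet> b)) (at x)"
      by (rule has_derivative_inner_left[OF smooth_on_has_derivative[OF smooth_on_frechet_derivative[OF F] U(2)]])
    then have "((\<lambda>y. frechet_derivative (\<lambda>y. F y \<bullet> b) (at y) u) has_derivative
        (\<lambda>u'. frechet_derivative (\<lambda>y. frechet_derivative F (at y) u) (at x) u' \<bullet> b)) (at x)"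
      by (rule has_derivative_transform_within_open[OF _ U]) (simp add: 1)
    from frechet_derivative_eqI[OF this] show ?thesis by simp
  qed
  have "Ck_on 2 U (\<lambda>y. F y \<bullet> b)" using Fb by (simp add: smooth_on_def)
  from second_derivative_symmetric_real[OF this U, of v w]
  show "frechet_derivative (\<lambda>y. frechet_derivative F (at y) v) (at x) w \<bullet> b =
    frechet_derivative (\<lambda>y. frechet_derivative F (at y) w) (at x) v \<bullet> b"
    by (simp add: 2)
qed

lemma tangent_space_mono: "S \<subseteq> W \<Longrightarrow> tangent_space S x \<subseteq> tangent_space W x"
  unfolding tangent_space_def by blast

lemma vector_field_tangent: "vector_field W X \<Longrightarrow> x \<in> W \<Longrightarrow> X x \<in> tangent_space W x"
  unfolding vector_field_def by blast

text \<open>Both derivatives can be composed with a curve in \<open>W\<close> of velocity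
  \<open>v\<close>, and the derivative of the composite at an interior point of an interval is
  unique. This makes \<open>dir_deriv\<close> well defined on tangent vectors.\<close>

lemma has_derivative_tangent_unique:
  assumes "(f has_derivative f1) (at x within W)" "(f has_derivative f2) (at x within W)"
    and v: "v \<in> tangent_space W x"
  shows "f1 v = f2 v"
proof -
  obtain c e where c: "e > 0" "c ` {-e<..<e} \<subseteq> W" "c 0 = x" "(c has_vector_derivative v) (at 0)"
    using v unfolding tangent_space_def by blast
  have cd: "(c has_derivative (\<lambda>h. h *\<^sub>R v)) (at 0 within {-e<..<e})"
    using c(4) has_derivative_at_withinI unfolding has_vector_derivative_def by blast
  have "((\<lambda>t. f (c t)) has_derivative (\<lambda>h. f' (h *\<^sub>R v))) (at 0)"
    if "(f has_derivative f') (at x within W)" for f'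
  proof -
    have "(f has_derivative f') (at (c 0) within c ` {-e<..<e})"
      using that c(2,3) has_derivative_subset by blast
    from diff_chain_within[OF cd this] have "((\<lambda>t. f (c t)) has_derivative (\<lambda>h. f' (h *\<^sub>R v))) (at 0 within {-e<..<e})"
      by (simp add: o_def)
    moreover have "at 0 within {-e<..<e} = at 0" using c(1) by (intro at_within_open) auto
    ultimately show ?thesis by metis
  qed
  from has_derivative_unique[OF this[OF assms(1)] this[OF assms(2)]]
  show ?thesis by (metis scaleR_one)
qed

lemma dir_deriv_eqI:
  assumes "(f has_derivative f') (at x within W)" "v \<in> tangent_space W x"
  shows "dir_deriv W f x v = f' v"
  unfolding dir_deriv_def
  using has_derivative_tangent_unique[OF _ assms(1) assms(2)] assms(1)
  by (metis differentiable_def frechet_derivative_works)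

lemma smooth_fun_has_derivative:
  assumes "smooth_fun W f" "x \<in> W"
  shows "(f has_derivative dir_deriv W f x) (at x within W)"
proof -
  obtain U g where U: "open U" "x \<in> U" "smooth_on U g" "\<forall>y\<in>W \<inter> U. f y = g y"
    using assms unfolding smooth_fun_def by blast
  have "(g has_derivative frechet_derivative g (at x)) (at x within W)"
    using smooth_on_has_derivative[OF U(3,2)] has_derivative_at_withinI by blast
  moreover obtain e where "e > 0" "ball x e \<subseteq> U" using U openE by blast
  ultimately have "(f has_derivative frechet_derivative g (at x)) (at x within W)"
    using assms(2) U(4)
    by (elim has_derivative_transform_within[where d = e]) (auto simp: subset_iff dist_commute)
  then have "f differentiable (at x within W)" by (auto simp: differentiable_def)
  moreover have "dir_deriv W f x = frechet_derivative f (at x within W)"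
    by (rule ext) (simp add: dir_deriv_def)
  ultimately show ?thesis by (simp add: frechet_derivative_works)
qed

lemma has_derivative_extension:
  assumes "open U" "x \<in> U" "x \<in> W" "\<And>y. y \<in> W \<Longrightarrow> y \<in> U \<Longrightarrow> f y = g y" "(g has_derivative g') (at x)"
  shows "(f has_derivative g') (at x within W)"
proof -
  have "(g has_derivative g') (at x within W)"
    using assms(5) has_derivative_at_withinI by blast
  moreover obtain e where "e > 0" "ball x e \<subseteq> U" using assms(1,2) openE by blast
  ultimately show ?thesis
    using assms(3,4)
    by (elim has_derivative_transform_within[where d = e]) (auto simp: subset_iff dist_commute)
qed

lemma dir_deriv_extension:
  assumes "open U" "x \<in> U" "smooth_on U g" "\<And>y. y \<in> W \<Longrightarrow> y \<in> U \<Longrightarrow> f y = g y"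
    "x \<in> W" "v \<in> tangent_space W x"
  shows "dir_deriv W f x v = frechet_derivative g (at x) v"
  by (rule dir_deriv_eqI[OF has_derivative_extension[OF assms(1,2,5,4) smooth_on_has_derivative[OF assms(3,2)]] assms(6)])

lemma linear_dir_deriv: "smooth_fun W f \<Longrightarrow> x \<in> W \<Longrightarrow> linear (dir_deriv W f x)"
  using smooth_fun_has_derivative has_derivative_linear by blast

lemma dir_deriv_cong:
  assumes "\<And>y. y \<in> W \<Longrightarrow> f y = g y" "x \<in> W"
  shows "dir_deriv W f x = dir_deriv W g x"
proof -
  have "(f has_derivative f') (at x within W) \<longleftrightarrow> (g has_derivative f') (at x within W)" for f'
    using has_derivative_transform[of x W f g f'] has_derivative_transform[of x W g f f'] assms by auto
  then show ?thesis unfolding dir_deriv_def frechet_derivative_def by (intro ext) simp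
qed

lemma smooth_fun_dir_deriv:
  assumes f: "smooth_fun W f" and X: "vector_field W X"
  shows "smooth_fun W (\<lambda>x. dir_deriv W f x (X x))"
  unfolding smooth_fun_def
proof
  fix x assume x: "x \<in> W"
  obtain U g where U: "open U" "x \<in> U" "smooth_on U g" "\<forall>y\<in>W \<inter> U. f y = g y"
    using f x unfolding smooth_fun_def by blast
  obtain V Y where V: "open V" "x \<in> V" "smooth_on V Y" "\<forall>y\<in>W \<inter> V. X y = Y y"
    using X x unfolding vector_field_def smooth_fun_def by blast
  have "smooth_on (U \<inter> V) (\<lambda>x. frechet_derivative g (at x) (Y x))"
    using U V by (intro smooth_on_frechet_derivative_along) (auto intro: smooth_on_subset)
  moreover have "dir_deriv W f y (X y) = frechet_derivative g (at y) (Y y)" if "y \<in> W" "y \<in> U \<inter> V" for y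
  proof -
    have "dir_deriv W f y (X y) = frechet_derivative g (at y) (X y)"
      using that U X by (intro dir_deriv_extension[of U]) (auto simp: vector_field_def)
    then show ?thesis using V(4) that by simp
  qed
  ultimately show "\<exists>U h. open U \<and> x \<in> U \<and> smooth_on U h \<and> (\<forall>y\<in>W \<inter> U. dir_deriv W f y (X y) = h y)"
    using U V by (intro exI[of _ "U \<inter> V"] exI[of _ "\<lambda>x. frechet_derivative g (at x) (Y x)"] conjI ballI) (simp_all add: open_Int)
qed

text \<open>The second derivatives of the extension \<open>g\<close> cancel by symmetry. The right
  side uses \<open>g\<close> and not \<open>dir_deriv\<close> because the bracket is not yet known
  to be tangent to \<open>W\<close>; this identity, applied to a defining function, is what will
  show it.\<close>

lemma dir_deriv_commutator:
  fixes f :: "'a::euclidean_space \<Rightarrow> 'b::euclidean_space"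
  assumes X: "vector_field W X" and Y: "vector_field W Y"
    and U: "open U" "smooth_on U g" "\<And>y. y \<in> W \<Longrightarrow> y \<in> U \<Longrightarrow> f y = g y"
    and x: "x \<in> W" "x \<in> U"
  shows "dir_deriv W (\<lambda>y. dir_deriv W f y (Y y)) x (X x) - dir_deriv W (\<lambda>y. dir_deriv W f y (X y)) x (Y x) =
    frechet_derivative g (at x) (lie_bracket W X Y x)"
proof -
  let ?g' = "\<lambda>y. frechet_derivative g (at y)"
  have lin: "linear (?g' x)"
    using has_derivative_linear[OF smooth_on_has_derivative[OF U(2) x(2)]] .
  \<comment> \<open>Product rule for \<open>g'(y) (Z y)\<close>: one term differentiates
    \<open>g'\<close> with the direction frozen at \<open>Z x\<close>, the other differentiates
    \<open>Z\<close>.\<close>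
  have *: "dir_deriv W (\<lambda>y. dir_deriv W f y (Z y)) x v =
      frechet_derivative (\<lambda>y. ?g' y (Z x)) (at x) v + ?g' x (dir_deriv W Z x v)"
    if Z: "vector_field W Z" and v: "v \<in> tangent_space W x" for Z v
  proof -
    have dZ: "(Z has_derivative dir_deriv W Z x) (at x within W)"
      using smooth_fun_has_derivative Z x by (auto simp: vector_field_def)
    have db: "((\<lambda>y. ?g' y b) has_derivative frechet_derivative (\<lambda>y. ?g' y b) (at x)) (at x)" for b
      by (rule smooth_on_has_derivative[OF smooth_on_frechet_derivative[OF U(2)] x(2)])
    have d: "((\<lambda>y. \<Sum>b\<in>Basis. (Z y \<bullet> b) *\<^sub>R ?g' y b) has_derivative
      (\<lambda>v. \<Sum>b\<in>Basis. (Z x \<bullet> b) *\<^sub>R frechet_derivative (\<lambda>y. ?g' y b) (at x) v +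
         (dir_deriv W Z x v \<bullet> b) *\<^sub>R ?g' x b)) (at x within W)"
      by (intro has_derivative_sum has_derivative_scaleR has_derivative_inner_left dZ
          has_derivative_at_withinI[OF db])
    have eq: "dir_deriv W f y (Z y) = (\<Sum>b\<in>Basis. (Z y \<bullet> b) *\<^sub>R ?g' y b)" if "y \<in> W" "y \<in> U" for y
    proof -
      have "dir_deriv W f y (Z y) = ?g' y (Z y)"
        using that U Z by (intro dir_deriv_extension[of U]) (auto simp: vector_field_def)
      also have "\<dots> = (\<Sum>b\<in>Basis. (Z y \<bullet> b) *\<^sub>R ?g' y b)"
        using linear_sum_Basis[OF has_derivative_linear[OF smooth_on_has_derivative[OF U(2) that(2)]]] .
      finally show ?thesis .
    qed
    obtain e where e: "e > 0" "ball x e \<subseteq> U" using U x openE by blast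
    have d2: "((\<lambda>y. dir_deriv W f y (Z y)) has_derivative
      (\<lambda>v. \<Sum>b\<in>Basis. (Z x \<bullet> b) *\<^sub>R frechet_derivative (\<lambda>y. ?g' y b) (at x) v +
         (dir_deriv W Z x v \<bullet> b) *\<^sub>R ?g' x b)) (at x within W)"
      by (rule has_derivative_transform_within[OF d e(1) x(1)])
        (use e eq in \<open>auto simp: subset_iff dist_commute\<close>)
    have "((\<lambda>y. \<Sum>b\<in>Basis. (Z x \<bullet> b) *\<^sub>R ?g' y b) has_derivative
       (\<lambda>v. \<Sum>b\<in>Basis. (Z x \<bullet> b) *\<^sub>R frechet_derivative (\<lambda>y. ?g' y b) (at x) v)) (at x)"
      by (intro has_derivative_sum has_derivative_scaleR_right db)
    then have "((\<lambda>y. ?g' y (Z x)) has_derivative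
       (\<lambda>v. \<Sum>b\<in>Basis. (Z x \<bullet> b) *\<^sub>R frechet_derivative (\<lambda>y. ?g' y b) (at x) v)) (at x)"
      by (rule has_derivative_transform_within_open[OF _ U(1) x(2)])
        (use linear_sum_Basis[OF has_derivative_linear[OF smooth_on_has_derivative[OF U(2)]]] in metis)
    from frechet_derivative_eqI[OF this]
    have "frechet_derivative (\<lambda>y. ?g' y (Z x)) (at x) v =
       (\<Sum>b\<in>Basis. (Z x \<bullet> b) *\<^sub>R frechet_derivative (\<lambda>y. ?g' y b) (at x) v)" by simp
    moreover have "?g' x (dir_deriv W Z x v) = (\<Sum>b\<in>Basis. (dir_deriv W Z x v \<bullet> b) *\<^sub>R ?g' x b)"
      by (rule linear_sum_Basis[OF lin])
    ultimately show ?thesis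
      using dir_deriv_eqI[OF d2 v] by (simp add: sum.distrib)
  qed
  have "X x \<in> tangent_space W x" "Y x \<in> tangent_space W x"
    using X Y x by (auto simp: vector_field_def)
  then show ?thesis
    using *[OF Y, of "X x"] *[OF X, of "Y x"] second_derivative_symmetric[OF U(2,1) x(2), of "Y x" "X x"]
    by (simp add: lie_bracket_def linear_diff[OF lin])
qed

lemma has_vector_derivative_dir_deriv:
  assumes f: "smooth_fun W f" and c: "(c has_vector_derivative v) (at t within T)" "c ` T \<subseteq> W" "t \<in> T"
  shows "((\<lambda>t. f (c t)) has_vector_derivative dir_deriv W f (c t) v) (at t within T)"
proof -
  have ct: "c t \<in> W" using c by auto
  have "(f has_derivative dir_deriv W f (c t)) (at (c t) within c ` T)"
    using smooth_fun_has_derivative[OF f ct] c(2) has_derivative_subset by blast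
  from diff_chain_within[OF c(1)[unfolded has_vector_derivative_def] this]
  show ?thesis
    using linear_dir_deriv[OF f ct] by (simp add: has_vector_derivative_def o_def linear_cmul)
qed

lemma dir_deriv_subset:
  assumes "smooth_fun W f" "S \<subseteq> W" "x \<in> S" "v \<in> tangent_space S x"
  shows "dir_deriv S f x v = dir_deriv W f x v"
  using assms by (intro dir_deriv_eqI) (meson has_derivative_subset smooth_fun_has_derivative subsetD)

lemma dir_deriv_tangent_zero:
  assumes "smooth_fun W f" "S \<subseteq> W" "x \<in> S" "v \<in> tangent_space S x" "\<And>y. y \<in> S \<Longrightarrow> f y = 0"
  shows "dir_deriv W f x v = 0"
proof -
  have "(f has_derivative (\<lambda>v. 0)) (at x within S)"
    using assms(3,5) by (intro has_derivative_transform[OF _ _ has_derivative_const[of 0]]) auto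
  then show ?thesis using dir_deriv_eqI assms(4) dir_deriv_subset[OF assms(1-4)] by metis
qed

lemma dir_deriv_add:
  assumes "smooth_fun W f" "smooth_fun W g" "x \<in> W" "v \<in> tangent_space W x"
  shows "dir_deriv W (\<lambda>x. f x + g x) x v = dir_deriv W f x v + dir_deriv W g x v"
  by (intro dir_deriv_eqI has_derivative_add smooth_fun_has_derivative assms)

lemma dir_deriv_diff:
  assumes "smooth_fun W f" "smooth_fun W g" "x \<in> W" "v \<in> tangent_space W x"
  shows "dir_deriv W (\<lambda>x. f x - g x) x v = dir_deriv W f x v - dir_deriv W g x v"
  by (intro dir_deriv_eqI has_derivative_diff smooth_fun_has_derivative assms)

lemma dir_deriv_mult:
  fixes f g :: "'a::euclidean_space \<Rightarrow> real"
  assumes "smooth_fun W f" "smooth_fun W g" "x \<in> W" "v \<in> tangent_space W x"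
  shows "dir_deriv W (\<lambda>x. f x * g x) x v = f x * dir_deriv W g x v + dir_deriv W f x v * g x"
  by (rule dir_deriv_eqI) (intro has_derivative_mult smooth_fun_has_derivative assms)+

lemma dir_deriv_const: "x \<in> W \<Longrightarrow> v \<in> tangent_space W x \<Longrightarrow> dir_deriv W (\<lambda>x. c) x v = 0"
  by (intro dir_deriv_eqI) auto

text \<open>A curve in \<open>M\<close> through \<open>x\<close> stays in the relatively open set
  \<open>W\<close> for a short time.\<close>

lemma tangent_space_openin:
  assumes W: "openin (top_of_set M) W" and x: "x \<in> W"
  shows "tangent_space W x = tangent_space M x"
proof
  obtain T where T: "open T" "W = M \<inter> T" using W by (metis openin_open)
  show "tangent_space W x \<subseteq> tangent_space M x" using tangent_space_mono T by blast
  show "tangent_space M x \<subseteq> tangent_space W x"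
  proof
    fix v assume "v \<in> tangent_space M x"
    then obtain c e where c: "e > 0" "smooth_on {-e<..<e} c" "c ` {-e<..<e} \<subseteq> M" "c 0 = x"
      "(c has_vector_derivative v) (at 0)" unfolding tangent_space_def by blast
    have "open ({-e<..<e} \<inter> c -` T)"
      by (rule continuous_open_preimage[OF smooth_on_imp_continuous_on[OF c(2)] _ T(1)]) simp
    moreover have "0 \<in> {-e<..<e} \<inter> c -` T" using c T x by auto
    ultimately obtain d where d: "d > 0" "ball 0 d \<subseteq> {-e<..<e} \<inter> c -` T" using openE by blast
    have b: "{-d<..<d} = ball 0 d" by (auto simp: dist_real_def)
    show "v \<in> tangent_space W x"
      unfolding tangent_space_def using d c T b smooth_on_subset[OF c(2), of "{-d<..<d}"]
      by (intro CollectI exI[of _ c] exI[of _ d]) (auto simp: subset_iff)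
  qed
qed

section \<open>Intersections of quadrics\<close>

lemma open_Collect_ball_less:
  fixes f :: "'i \<Rightarrow> 'a::topological_space \<Rightarrow> real"
  assumes "finite J" "\<And>j. j \<in> J \<Longrightarrow> continuous_on UNIV (f j)"
  shows "open {x. \<forall>j\<in>J. 0 < f j x}"
proof -
  have "{x. \<forall>j\<in>J. 0 < f j x} = (\<Inter>j\<in>J. {x. 0 < f j x})" by auto
  moreover have "open (\<Inter>j\<in>J. {x. 0 < f j x})"
    using assms by (intro open_INT ballI open_Collect_less continuous_on_const) auto
  ultimately show ?thesis by simp
qed

lemma dim_orthogonal_family:
  fixes n :: "'i \<Rightarrow> 'a::euclidean_space"
  assumes J: "finite J" and orth: "\<And>i j. i \<in> J \<Longrightarrow> j \<in> J \<Longrightarrow> i \<noteq> j \<Longrightarrow> n i \<bullet> n j = 0"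
    and nz: "\<And>j. j \<in> J \<Longrightarrow> n j \<noteq> 0"
  shows "dim {v. \<forall>j\<in>J. n j \<bullet> v = 0} = DIM('a) - card J"
proof -
  have inj: "inj_on n J"
  proof (rule inj_onI)
    fix i j assume "i \<in> J" "j \<in> J" "n i = n j"
    then show "i = j" using orth[of i j] nz[of i] by (metis inner_eq_zero_iff)
  qed
  have "pairwise orthogonal (n ` J)"
    using orth by (auto simp: pairwise_def orthogonal_def)
  then have "independent (n ` J)"
    using nz by (intro pairwise_orthogonal_independent) auto
  then have d: "dim (span (n ` J)) = card J"
    by (simp add: dim_eq_card_independent card_image[OF inj])
  have e: "{v. \<forall>j\<in>J. n j \<bullet> v = 0} = {y \<in> UNIV. \<forall>x\<in>span (n ` J). orthogonal x y}"
  proof (intro subset_antisym subsetI)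
    fix v assume v: "v \<in> {v. \<forall>j\<in>J. n j \<bullet> v = 0}"
    have "orthogonal v x" if "x \<in> span (n ` J)" for x
      by (rule orthogonal_to_span[OF that]) (use v in \<open>auto simp: orthogonal_def inner_commute\<close>)
    then show "v \<in> {y \<in> UNIV. \<forall>x\<in>span (n ` J). orthogonal x y}"
      by (auto simp: orthogonal_commute)
  qed (auto simp: orthogonal_def span_base)
  have "dim {v. \<forall>j\<in>J. n j \<bullet> v = 0} + card J = DIM('a)"
    unfolding e using dim_subspace_orthogonal_to_vectors[of "span (n ` J)" UNIV] d by simp
  then show ?thesis by simp
qed

text \<open>The model is a space split into blocks of coordinates: \<open>G j\<close> is the
  symmetric operator of a quadratic form living on block \<open>j\<close>, and \<open>A j\<close>
  acts, as far as the \<open>G k\<close> can see, like the projection onto that block. Adding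
  multiples of \<open>A j x\<close> thus rescales one form and leaves the others alone.\<close>

locale quadrics =
  fixes J :: "'i set" and G A :: "'i \<Rightarrow> 'a::euclidean_space \<Rightarrow> 'a" and c :: "'i \<Rightarrow> real"
  assumes finite_J: "finite J"
    and linear_G: "\<And>j. linear (G j)" and linear_A: "\<And>j. linear (A j)"
    and G_sym: "\<And>j x y. G j x \<bullet> y = x \<bullet> G j y"
    and G_A: "\<And>j k x. j \<in> J \<Longrightarrow> k \<in> J \<Longrightarrow> G k (A j x) = (if j = k then G k x else 0)"
    and c_pos: "\<And>j. j \<in> J \<Longrightarrow> c j > 0"
begin

definition Q :: "'i \<Rightarrow> 'a \<Rightarrow> real" where
  "Q j x = (G j x \<bullet> x) / 2"

definition quadric :: "'a set" where
  "quadric = {x. \<forall>j\<in>J. Q j x = c j}"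

text \<open>Rescales block \<open>j\<close> by \<open>sqrt (c j / Q j x)\<close>: a smooth
  retraction of the region where all \<open>Q j\<close> are positive onto the quadric. It serves to
  produce curves in the quadric.\<close>

definition retr :: "'a \<Rightarrow> 'a" where
  "retr x = x + (\<Sum>j\<in>J. (sqrt (c j / Q j x) - 1) *\<^sub>R A j x)"

lemma bounded_linear_G: "bounded_linear (G j)" and bounded_linear_A: "bounded_linear (A j)"
  using linear_G linear_A by (simp_all add: linear_conv_bounded_linear)

lemma has_derivative_Q: "(Q j has_derivative (\<lambda>v. G j x \<bullet> v)) (at x)"
proof -
  have "((\<lambda>x. (G j x \<bullet> x) / 2) has_derivative (\<lambda>v. (G j x \<bullet> v + G j v \<bullet> x) / 2)) (at x)"
    by (auto intro!: derivative_eq_intros bounded_linear.has_derivative[OF bounded_linear_G])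
  moreover have "(\<lambda>v. (G j x \<bullet> v + G j v \<bullet> x) / 2) = (\<lambda>v. G j x \<bullet> v)"
    using G_sym[of j x] by (simp add: inner_commute)
  ultimately show ?thesis unfolding Q_def by simp
qed

lemma smooth_fun_Q: "smooth_fun B f \<Longrightarrow> smooth_fun B (\<lambda>x. Q j (f x))"
  unfolding Q_def divide_inverse
  by (intro smooth_fun_mult smooth_fun_inner smooth_fun_const smooth_fun_bounded_linear[OF bounded_linear_G])

lemma continuous_on_Q: "continuous_on B (Q j)"
  by (rule smooth_fun_imp_continuous_on[OF smooth_fun_Q[OF smooth_fun_ident]])

lemma G_retr:
  assumes "k \<in> J" shows "G k (retr x) = sqrt (c k / Q k x) *\<^sub>R G k x"
proof -
  have "G k (retr x) = G k x + (\<Sum>j\<in>J. (sqrt (c j / Q j x) - 1) *\<^sub>R G k (A j x))"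
    unfolding retr_def by (simp add: linear_add[OF linear_G] linear_sum[OF linear_G] linear_cmul[OF linear_G])
  also have "(\<Sum>j\<in>J. (sqrt (c j / Q j x) - 1) *\<^sub>R G k (A j x)) =
      (\<Sum>j\<in>J. if j = k then (sqrt (c k / Q k x) - 1) *\<^sub>R G k x else 0)"
    using assms by (intro sum.cong refl) (simp add: G_A)
  also have "\<dots> = (sqrt (c k / Q k x) - 1) *\<^sub>R G k x"
    using assms finite_J by simp
  finally show ?thesis by (simp add: algebra_simps)
qed

lemma retr_in_quadric:
  assumes "\<forall>j\<in>J. 0 < Q j x" shows "retr x \<in> quadric"
  unfolding quadric_def
proof (intro CollectI ballI)
  fix k assume k: "k \<in> J"
  define s where "s = sqrt (c k / Q k x)"
  have Gs: "G k (retr x) = s *\<^sub>R G k x" by (simp add: G_retr[OF k] s_def)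
  have "Q k (retr x) = s * (G k x \<bullet> retr x) / 2" by (simp add: Q_def Gs)
  also have "\<dots> = s * s * Q k x"
    using inner_commute[of x "G k x"] by (simp add: G_sym Gs Q_def)
  also have "\<dots> = c k"
    using assms k c_pos[OF k] by (simp add: s_def less_imp_le less_imp_neq[THEN not_sym])
  finally show "Q k (retr x) = c k" .
qed

lemma retr_eq_self: "x \<in> quadric \<Longrightarrow> retr x = x"
  using c_pos by (simp add: retr_def quadric_def order_less_imp_not_eq2)

lemma smooth_on_retr: "smooth_on {x. \<forall>j\<in>J. 0 < Q j x} retr"
proof -
  have "open {x. \<forall>j\<in>J. 0 < Q j x}"
    by (intro open_Collect_ball_less finite_J continuous_on_Q)
  moreover have "smooth_fun {x. \<forall>j\<in>J. 0 < Q j x} retr"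
    unfolding retr_def
    by (intro smooth_fun_add smooth_fun_sum smooth_fun_scaleR smooth_fun_diff smooth_fun_sqrt
        smooth_fun_divide smooth_fun_Q smooth_fun_const smooth_fun_ident
        smooth_fun_bounded_linear[OF bounded_linear_A])
      (auto intro!: divide_pos_pos c_pos simp: less_imp_neq[THEN not_sym])
  ultimately show ?thesis by (simp add: smooth_fun_open_iff)
qed

lemma Q_line:
  "Q j (x + t *\<^sub>R v) = Q j x + t * (G j x \<bullet> v) + t\<^sup>2 * Q j v"
proof -
  have "G j v \<bullet> x = G j x \<bullet> v" by (metis G_sym inner_commute)
  then show ?thesis
    by (simp add: Q_def linear_add[OF linear_G] linear_cmul[OF linear_G] algebra_simps
      inner_add_left inner_add_right power2_eq_square field_simps)
qed

text \<open>Velocities of curves annihilate the differentials of the \<open>Q j\<close>. Conversely,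
  the straight line with velocity \<open>v\<close> violates the equations to second order only,
  because \<open>Q j (x + t v) = c j + t^2 Q j v\<close>; \<open>retr\<close> moves it into the
  quadric without changing the velocity.\<close>

lemma tangent_space_quadric:
  assumes x: "x \<in> quadric"
  shows "tangent_space quadric x = {v. \<forall>j\<in>J. G j x \<bullet> v = 0}"
proof (intro subset_antisym subsetI)
  fix v assume "v \<in> tangent_space quadric x"
  then obtain g e where g: "e > 0" "g ` {-e<..<e} \<subseteq> quadric" "g 0 = x" "(g has_vector_derivative v) (at 0)"
    unfolding tangent_space_def by blast
  have "G j x \<bullet> v = 0" if j: "j \<in> J" for j
  proof -
    have "((\<lambda>t. Q j (g t)) has_derivative (\<lambda>h. G j x \<bullet> (h *\<^sub>R v))) (at 0)"
      using has_derivative_compose[OF g(4)[unfolded has_vector_derivative_def] has_derivative_Q[of j "g 0"]]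
      by (simp add: g(3))
    moreover have "((\<lambda>t. Q j (g t)) has_derivative (\<lambda>h. 0)) (at 0)"
      by (rule has_derivative_transform_within_open[OF has_derivative_const[of "c j"], where s = "{-e<..<e}"])
        (use g(1,2) j in \<open>auto simp: quadric_def image_subset_iff\<close>)
    ultimately have "(\<lambda>h. G j x \<bullet> (h *\<^sub>R v)) = (\<lambda>h. 0)" by (rule has_derivative_unique)
    then show ?thesis by (metis scaleR_one)
  qed
  then show "v \<in> {v. \<forall>j\<in>J. G j x \<bullet> v = 0}" by simp
next
  fix v assume v: "v \<in> {v. \<forall>j\<in>J. G j x \<bullet> v = 0}"
  let ?g = "\<lambda>t. retr (x + t *\<^sub>R v)" and ?P = "{x. \<forall>j\<in>J. 0 < Q j x}"
  have oP: "open ?P" by (intro open_Collect_ball_less finite_J continuous_on_Q)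
  have "open ((\<lambda>t. x + t *\<^sub>R v) -` ?P)"
    by (intro open_vimage oP continuous_intros)
  moreover have "0 \<in> (\<lambda>t. x + t *\<^sub>R v) -` ?P" using x c_pos by (simp add: quadric_def)
  ultimately obtain e where e: "e > 0" "ball 0 e \<subseteq> (\<lambda>t. x + t *\<^sub>R v) -` ?P" using openE by blast
  have b: "{-e<..<e} = ball 0 e" by (auto simp: dist_real_def)
  have inP: "(\<lambda>t. x + t *\<^sub>R v) ` {-e<..<e} \<subseteq> ?P" using e b by blast
  have "smooth_fun {-e<..<e} (\<lambda>t. x + t *\<^sub>R v)"
    by (intro smooth_fun_add smooth_fun_const smooth_fun_scaleR smooth_fun_ident)
  then have "smooth_on {-e<..<e} (\<lambda>t. x + t *\<^sub>R v)" by (simp add: smooth_fun_open_iff)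
  then have sm: "smooth_on {-e<..<e} ?g"
    by (rule smooth_on_compose[OF _ oP inP _ smooth_on_retr, rotated]) simp
  have im: "?g ` {-e<..<e} \<subseteq> quadric" using inP retr_in_quadric by blast
  \<comment> \<open>The scaling factors depend on \<open>t\<close> through \<open>t^2\<close> only,
    so they contribute nothing to the velocity at \<open>0\<close>.\<close>
  have "((\<lambda>t. sqrt (a / (a + t\<^sup>2 * q)) - 1) has_real_derivative 0) (at 0)" if "a > 0" for a q :: real
    using that by (auto intro!: derivative_eq_intros)
  then have s: "((\<lambda>t. sqrt (c j / (c j + t\<^sup>2 * Q j v)) - 1) has_real_derivative 0) (at 0)" if "j \<in> J" for j
    using c_pos[OF that] by blast
  have t: "((\<lambda>t. (sqrt (c j / (c j + t\<^sup>2 * Q j v)) - 1) *\<^sub>R A j (x + t *\<^sub>R v)) has_vector_derivative 0) (at 0)"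
    if j: "j \<in> J" for j
  proof -
    have "((\<lambda>t. A j (x + t *\<^sub>R v)) has_vector_derivative A j v) (at 0)"
      by (rule bounded_linear.has_vector_derivative[OF bounded_linear_A]) (auto intro!: derivative_eq_intros)
    from has_vector_derivative_scaleR[OF s[OF j] this]
    show ?thesis using c_pos[OF j] by simp
  qed
  have "((\<lambda>t. x + t *\<^sub>R v) has_vector_derivative v) (at 0)" by (auto intro!: derivative_eq_intros)
  moreover have "((\<lambda>t. \<Sum>j\<in>J. (sqrt (c j / (c j + t\<^sup>2 * Q j v)) - 1) *\<^sub>R A j (x + t *\<^sub>R v)) has_vector_derivative (\<Sum>j\<in>J. 0)) (at 0)"
    by (intro has_vector_derivative_sum t)
  ultimately have "((\<lambda>t. (x + t *\<^sub>R v) + (\<Sum>j\<in>J. (sqrt (c j / (c j + t\<^sup>2 * Q j v)) - 1) *\<^sub>R A j (x + t *\<^sub>R v))) has_vector_derivative v + (\<Sum>j\<in>J. 0)) (at 0)"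
    by (rule has_vector_derivative_add)
  moreover have "(x + t *\<^sub>R v) + (\<Sum>j\<in>J. (sqrt (c j / (c j + t\<^sup>2 * Q j v)) - 1) *\<^sub>R A j (x + t *\<^sub>R v)) = ?g t" for t
  proof -
    have "Q j (x + t *\<^sub>R v) = c j + t\<^sup>2 * Q j v" if "j \<in> J" for j
      using x v that by (simp add: Q_line quadric_def)
    then show ?thesis by (simp add: retr_def)
  qed
  ultimately have "(?g has_vector_derivative v) (at 0)" by simp
  then show "v \<in> tangent_space quadric x"
    unfolding tangent_space_def using e(1) sm im retr_eq_self[OF x]
    by (intro CollectI exI[of _ ?g] exI[of _ e]) simp
qed

text \<open>The chart replaces, for each \<open>j\<close>, one coordinate on which \<open>Q\<^sub>j\<close> depends by \<open>Q\<^sub>j\<close> itself; its inverse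
  solves a quadratic equation for that coordinate.\<close>

lemma embedded_submanifold_quadric:
  assumes "\<And>x. x \<in> quadric \<Longrightarrow> \<exists>e w. (\<forall>i\<in>J. \<forall>j\<in>J. e i \<bullet> e j = (if i = j then 1 else 0)) \<and>
    (\<forall>i\<in>J. \<forall>j\<in>J. G j (e i) = (if i = j then w j *\<^sub>R e j else 0)) \<and>
    (\<forall>j\<in>J. w j > (0::real) \<and> x \<bullet> e j \<noteq> 0)"
  shows "embedded_submanifold (DIM('a) - card J) quadric"
  unfolding embedded_submanifold_def
proof
  fix x0 assume x0: "x0 \<in> quadric"
  obtain e w where on: "\<And>i j. i \<in> J \<Longrightarrow> j \<in> J \<Longrightarrow> e i \<bullet> e j = (if i = j then 1 else 0)"
    and Ge: "\<And>i j. i \<in> J \<Longrightarrow> j \<in> J \<Longrightarrow> G j (e i) = (if i = j then w j *\<^sub>R e j else 0)"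
    and w: "\<And>j. j \<in> J \<Longrightarrow> w j > (0::real)" and xe: "\<And>j. j \<in> J \<Longrightarrow> x0 \<bullet> e j \<noteq> 0"
    using assms[OF x0] by blast
  \<comment> \<open>The quadratic equation for the coordinate along \<open>e j\<close> has two
    roots; the sign at \<open>x0\<close> selects one, and \<open>U\<close> is the region where all
    these coordinates keep their sign.\<close>
  define s where "s j = sgn (x0 \<bullet> e j)" for j
  define perp where "perp x = x - (\<Sum>j\<in>J. (x \<bullet> e j) *\<^sub>R e j)" for x
  define psi where "psi x = perp x + (\<Sum>j\<in>J. (Q j x - c j) *\<^sub>R e j)" for x
  \<comment> \<open>The share of \<open>Q j\<close> left to the coordinate along \<open>e j\<close>
    once the new coordinate \<open>Q j x - c j\<close> and the part orthogonal to all
    \<open>e i\<close> are prescribed.\<close>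
  define r where "r j y = y \<bullet> e j + c j - Q j (perp y)" for j y
  define psi' where "psi' y = perp y + (\<Sum>j\<in>J. (s j * sqrt (2 * r j y / w j)) *\<^sub>R e j)" for y
  define U where "U = {x. \<forall>j\<in>J. 0 < s j * (x \<bullet> e j)}"
  define V where "V = {y. \<forall>j\<in>J. 0 < r j y}"
  define T where "T = {y. \<forall>j\<in>J. e j \<bullet> y = 0}"
  have ss: "s j * s j = 1" if "j \<in> J" for j using xe[OF that] by (simp add: s_def sgn_real_def)
  have sum_e: "(\<Sum>j\<in>J. a j *\<^sub>R e j) \<bullet> e k = a k" if "k \<in> J" for a k
  proof -
    have "(\<Sum>j\<in>J. a j *\<^sub>R e j) \<bullet> e k = (\<Sum>j\<in>J. a j * (e j \<bullet> e k))" by (simp add: inner_sum_left)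
    also have "\<dots> = (\<Sum>j\<in>J. if j = k then a k else 0)" using that on by (intro sum.cong) auto
    also have "\<dots> = a k" using that finite_J by simp
    finally show ?thesis .
  qed
  have perp_e: "perp x \<bullet> e k = 0" if "k \<in> J" for x k
    using that by (simp add: perp_def inner_diff_left sum_e)
  have lin: "linear perp" unfolding perp_def
    by (intro linearI) (simp_all add: inner_add_left scaleR_add_left sum.distrib algebra_simps scaleR_sum_right)
  have perp_add: "perp (perp x + (\<Sum>j\<in>J. a j *\<^sub>R e j)) = perp x" for x a
  proof -
    have "(\<Sum>j\<in>J. ((perp x + (\<Sum>j\<in>J. a j *\<^sub>R e j)) \<bullet> e j) *\<^sub>R e j) = (\<Sum>j\<in>J. a j *\<^sub>R e j)"
      by (intro sum.cong refl) (simp add: inner_add_left sum_e perp_e)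
    then show ?thesis unfolding perp_def[of "perp x + _"] by simp
  qed
  have comp_e: "(perp x + (\<Sum>j\<in>J. a j *\<^sub>R e j)) \<bullet> e k = a k" if "k \<in> J" for x a k
    using that by (simp add: inner_add_left sum_e perp_e)
  have decomp: "perp x + (\<Sum>j\<in>J. (x \<bullet> e j) *\<^sub>R e j) = x" for x by (simp add: perp_def)
  \<comment> \<open>No mixed terms occur: \<open>e j\<close> is an eigenvector of
    \<open>G j\<close>, and the other \<open>e i\<close> are annihilated by it.\<close>
  have Q_split: "Q j x = w j / 2 * (x \<bullet> e j)\<^sup>2 + Q j (perp x)" if j: "j \<in> J" for j x
  proof -
    have "G j (perp x) = G j x - (\<Sum>i\<in>J. (x \<bullet> e i) *\<^sub>R G j (e i))"
      by (simp add: perp_def linear_diff[OF linear_G] linear_sum[OF linear_G] linear_cmul[OF linear_G])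
    also have "(\<Sum>i\<in>J. (x \<bullet> e i) *\<^sub>R G j (e i)) = (\<Sum>i\<in>J. if i = j then (x \<bullet> e j) *\<^sub>R w j *\<^sub>R e j else 0)"
      using j Ge by (intro sum.cong) auto
    also have "\<dots> = (x \<bullet> e j) *\<^sub>R w j *\<^sub>R e j" using j finite_J by simp
    finally have Gp: "G j (perp x) = G j x - (x \<bullet> e j) *\<^sub>R w j *\<^sub>R e j" .
    have "G j (perp x) \<bullet> perp x = G j x \<bullet> perp x"
      using perp_e[OF j, of x] by (simp add: Gp inner_diff_left inner_commute[of "e j"])
    also have "\<dots> = x \<bullet> G j (perp x)" by (simp add: G_sym)
    also have "\<dots> = G j x \<bullet> x - w j * (x \<bullet> e j)\<^sup>2"
      by (simp add: Gp inner_diff_right inner_commute power2_eq_square)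
    finally show ?thesis by (simp add: Q_def field_simps)
  qed
  have r_psi: "r j (psi x) = w j / 2 * (x \<bullet> e j)\<^sup>2" if j: "j \<in> J" for j x
    using Q_split[OF j, of x] by (simp add: r_def psi_def comp_e[OF j] perp_add)
  have Q_psi': "Q j (psi' y) = y \<bullet> e j + c j" if j: "j \<in> J" and y: "y \<in> V" for j y
  proof -
    have "r j y > 0" using j y by (simp add: V_def)
    then have "(s j * sqrt (2 * r j y / w j))\<^sup>2 = 2 * r j y / w j"
      using ss[OF j] w[OF j] by (simp add: power_mult_distrib power2_eq_square[of "s j"])
    moreover have "psi' y \<bullet> e j = s j * sqrt (2 * r j y / w j)" "perp (psi' y) = perp y"
      by (simp_all add: psi'_def comp_e[OF j] perp_add)
    ultimately have "Q j (psi' y) = w j / 2 * (2 * r j y / w j) + Q j (perp y)"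
      using Q_split[OF j, of "psi' y"] by simp
    moreover have "w j / 2 * (2 * r j y / w j) = r j y" using w[OF j] by simp
    ultimately show ?thesis by (simp add: r_def)
  qed
  have UV: "psi x \<in> V" if "x \<in> U" for x
    unfolding V_def
  proof (intro CollectI ballI)
    fix j assume j: "j \<in> J"
    then have "0 < s j * (x \<bullet> e j)" using that by (simp add: U_def)
    then have "x \<bullet> e j \<noteq> 0" by auto
    then show "0 < r j (psi x)" using w[OF j] by (simp add: r_psi[OF j])
  qed
  have VU: "psi' y \<in> U" if "y \<in> V" for y
    unfolding U_def
  proof (intro CollectI ballI)
    fix j assume j: "j \<in> J"
    have "psi' y \<bullet> e j = s j * sqrt (2 * r j y / w j)" by (simp add: psi'_def comp_e[OF j])
    then have "s j * (psi' y \<bullet> e j) = (s j * s j) * sqrt (2 * r j y / w j)" by simp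
    then have "s j * (psi' y \<bullet> e j) = sqrt (2 * r j y / w j)" unfolding ss[OF j] by simp
    then show "0 < s j * (psi' y \<bullet> e j)" using that j w[OF j] by (simp add: V_def)
  qed
  have inv1: "psi' (psi x) = x" if "x \<in> U" for x
  proof -
    have "s j * sqrt (2 * r j (psi x) / w j) = x \<bullet> e j" if j: "j \<in> J" for j
    proof -
      have "2 * r j (psi x) / w j = (x \<bullet> e j)\<^sup>2" using w[OF j] by (simp add: r_psi[OF j])
      moreover have "0 < s j * (x \<bullet> e j)" using \<open>x \<in> U\<close> j by (simp add: U_def)
      then have "s j * \<bar>x \<bullet> e j\<bar> = x \<bullet> e j"
        by (auto simp: s_def sgn_real_def zero_less_mult_iff split: if_splits)
      ultimately show ?thesis by simp
    qed
    then have "psi' (psi x) = perp (psi x) + (\<Sum>j\<in>J. (x \<bullet> e j) *\<^sub>R e j)" by (simp add: psi'_def)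
    also have "perp (psi x) = perp x" by (simp add: psi_def perp_add)
    finally show ?thesis by (simp add: decomp)
  qed
  have inv2: "psi (psi' y) = y" if y: "y \<in> V" for y
  proof -
    have "psi (psi' y) = perp (psi' y) + (\<Sum>j\<in>J. (y \<bullet> e j) *\<^sub>R e j)"
      using Q_psi'[OF _ y] by (simp add: psi_def)
    also have "perp (psi' y) = perp y" by (simp add: psi'_def perp_add)
    finally show ?thesis by (simp add: decomp)
  qed
  have bl: "bounded_linear perp" using lin by (simp add: linear_conv_bounded_linear)
  have sm1: "smooth_fun U psi" unfolding psi_def
    by (intro smooth_fun_add smooth_fun_sum smooth_fun_scaleR smooth_fun_diff smooth_fun_Q
        smooth_fun_const smooth_fun_ident smooth_fun_bounded_linear[OF bl])
  have sr: "smooth_fun B (r j)" for j B unfolding r_def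
    by (intro smooth_fun_add smooth_fun_diff smooth_fun_inner smooth_fun_Q
        smooth_fun_const smooth_fun_ident smooth_fun_bounded_linear[OF bl])
  have sm2: "smooth_fun V psi'" unfolding psi'_def divide_inverse
    by (intro smooth_fun_add smooth_fun_sum smooth_fun_scaleR smooth_fun_mult smooth_fun_sqrt sr
        smooth_fun_const smooth_fun_ident smooth_fun_bounded_linear[OF bl])
      (use w in \<open>auto simp: V_def\<close>)
  have oU: "open U" unfolding U_def
    by (intro open_Collect_ball_less finite_J continuous_intros)
  have oV: "open V" unfolding V_def
    by (intro open_Collect_ball_less finite_J smooth_fun_imp_continuous_on sr)
  have "homeomorphism U V psi psi'"
    by (rule homeomorphismI)
      (use sm1 sm2 UV VU inv1 inv2 in \<open>auto intro: smooth_fun_imp_continuous_on\<close>)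
  moreover have "x0 \<in> U"
    unfolding U_def
  proof (intro CollectI ballI)
    fix j assume "j \<in> J"
    from xe[OF this] show "0 < s j * (x0 \<bullet> e j)" by (simp add: s_def sgn_real_def)
  qed
  moreover have "subspace T"
    unfolding T_def subspace_def by (auto simp: inner_add_right)
  moreover have "dim T = DIM('a) - card J"
    unfolding T_def by (rule dim_orthogonal_family[OF finite_J]) (use on in fastforce)+
  moreover have "psi ` (quadric \<inter> U) = T \<inter> V"
  proof (intro subset_antisym subsetI)
    fix y assume "y \<in> psi ` (quadric \<inter> U)"
    then obtain x where x: "x \<in> quadric" "x \<in> U" "y = psi x" by blast
    have "e j \<bullet> psi x = 0" if "j \<in> J" for j
      using that x(1) by (simp add: psi_def quadric_def inner_commute[of "e j"] comp_e perp_e)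
    moreover have "psi x \<in> V" using UV x(2) .
    ultimately show "y \<in> T \<inter> V" using x(3) by (simp add: T_def)
  next
    fix y assume y: "y \<in> T \<inter> V"
    then have "psi' y \<in> quadric"
      using Q_psi'[of _ y] by (auto simp: quadric_def T_def inner_commute)
    then show "y \<in> psi ` (quadric \<inter> U)"
      using VU[of y] inv2[of y] y by (intro image_eqI[of _ _ "psi' y"]) auto
  qed
  ultimately show "\<exists>U V (\<psi> :: 'a \<Rightarrow> 'a) \<psi>' T. open U \<and> x0 \<in> U \<and> open V \<and> homeomorphism U V \<psi> \<psi>' \<and>
        smooth_on U \<psi> \<and> smooth_on V \<psi>' \<and> subspace T \<and> dim T = DIM('a) - card J \<and> \<psi> ` (quadric \<inter> U) = T \<inter> V"
    using oU oV smooth_fun_imp_smooth_on[OF sm1 oU] smooth_fun_imp_smooth_on[OF sm2 oV]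
    by - (rule exI[of _ U], rule exI[of _ V], rule exI[of _ psi], rule exI[of _ psi'],
        rule exI[of _ T], simp)
qed

end

section \<open>The quadrics \<open>M_ex\<close> and \<open>S_ex\<close>\<close>

definition scal :: "(3 \<Rightarrow> real) \<Rightarrow> ambient \<Rightarrow> ambient" where
  "scal w = (\<lambda>(q, p, z). (\<chi> i. w i * q $ i, \<chi> i. w i * p $ i, 0))"

definition circ :: "ambient \<Rightarrow> ambient" where
  "circ = (\<lambda>(q, p, z). (0, 0, z))"

text \<open>Weights of quadratic Hamiltonians \<open>(1/2) sum_i w_i |z_i|^2\<close>:
  \<open>wt1 \<alpha>\<close> belongs to \<open>H_(\<alpha>)\<close>, \<open>wt1 0\<close> to
  \<open>H_1\<close>, and \<open>wt1 1\<close> serves as the projection onto the first two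
  planes.\<close>

definition wt1 :: "real \<Rightarrow> 3 \<Rightarrow> real" where
  "wt1 \<alpha> i = (if i = 1 then 1 else if i = 2 then \<alpha> else 0)"

definition wt2 :: "3 \<Rightarrow> real" where
  "wt2 i = (if i = 3 then 1 else 0)"

definition Gm :: "real \<Rightarrow> nat \<Rightarrow> ambient \<Rightarrow> ambient" where
  "Gm \<alpha> j = (if j = 1 then scal (wt1 \<alpha>) else if j = 2 then scal wt2 else circ)"

definition cm :: "nat \<Rightarrow> real" where
  "cm j = (if j = 1 then 1/4 else 1/2)"

lemma linear_scal: "linear (scal w)"
  by (rule linearI) (simp_all add: scal_def case_prod_beta vec_eq_iff algebra_simps)

lemma linear_circ: "linear circ"
  by (rule linearI) (auto simp: circ_def split: prod.splits)

lemma bounded_linear_scal: "bounded_linear (scal w)" and bounded_linear_circ: "bounded_linear circ"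
  using linear_scal linear_circ by (simp_all add: linear_conv_bounded_linear)

lemma scal_scal: "scal w (scal w' x) = scal (\<lambda>i. w i * w' i) x"
  by (simp add: scal_def mult.assoc split: prod.splits)

lemma scal_circ [simp]: "scal w (circ x) = 0" "circ (scal w x) = 0" "circ (circ x) = circ x"
  by (simp_all add: scal_def circ_def zero_prod_def vec_eq_iff split: prod.splits)

lemma inner_scal: "scal w x \<bullet> y = x \<bullet> scal w y"
  by (simp add: scal_def inner_vec_def mult.assoc mult.left_commute split: prod.splits)

lemma inner_circ: "circ x \<bullet> y = x \<bullet> circ y"
  by (simp add: circ_def split: prod.splits)

text \<open>All operators are diagonal, so the relation between \<open>G\<close> and
  \<open>A\<close> concerns products of weights only. Taking \<open>Gm 1\<close> for
  \<open>A\<close> turns the first weight into the indicator of the first two planes.\<close>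

lemma quadrics_ex:
  assumes "\<alpha> > 0" "J \<subseteq> {1, 2, 3}"
  shows "quadrics J (Gm \<alpha>) (Gm 1) cm"
proof (rule quadrics.intro)
  show "finite J" using assms(2) finite_subset by blast
  have "(\<lambda>i. wt1 \<alpha> i * wt1 1 i) = wt1 \<alpha>" "(\<lambda>i. wt2 i * wt2 i) = wt2"
    by (auto simp: wt1_def wt2_def fun_eq_iff)
  moreover have "(\<lambda>i. wt1 \<alpha> i * wt2 i) = (\<lambda>i. 0)" "(\<lambda>i. wt2 i * wt1 1 i) = (\<lambda>i. 0)"
    by (auto simp: wt1_def wt2_def fun_eq_iff)
  moreover have scal0: "scal (\<lambda>i. 0) x = 0" for x
    by (simp add: scal_def zero_prod_def vec_eq_iff split: prod.splits)
  ultimately show "Gm \<alpha> k (Gm 1 j x) = (if j = k then Gm \<alpha> k x else 0)" if "j \<in> J" "k \<in> J" for j k x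
  proof -
    have "j \<in> {1, 2, 3}" "k \<in> {1, 2, 3}" using assms(2) that by blast+
    then show ?thesis
      using \<open>(\<lambda>i. wt1 \<alpha> i * wt1 1 i) = wt1 \<alpha>\<close> \<open>(\<lambda>i. wt2 i * wt2 i) = wt2\<close>
        \<open>(\<lambda>i. wt1 \<alpha> i * wt2 i) = (\<lambda>i. 0)\<close> \<open>(\<lambda>i. wt2 i * wt1 1 i) = (\<lambda>i. 0)\<close> scal0
      by (elim insertE emptyE) (simp_all add: Gm_def scal_scal)
  qed
qed (auto simp: Gm_def cm_def linear_scal linear_circ inner_scal inner_circ)

definition QH :: "(3 \<Rightarrow> real) \<Rightarrow> real \<Rightarrow> ambient \<Rightarrow> real" where
  "QH w c x = (scal w x \<bullet> x) / 2 - c"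

lemma QH_eq: "QH w c (q, p, z) = (\<Sum>i\<in>UNIV. w i * ((q $ i)\<^sup>2 + (p $ i)\<^sup>2)) / 2 - c"
  by (simp add: QH_def scal_def inner_vec_def sum.distrib[symmetric] algebra_simps power2_eq_square)

lemma M_ex_quadric: "\<alpha> > 0 \<Longrightarrow> M_ex = quadrics.quadric {3} (Gm \<alpha>) cm"
  by (subst quadrics.quadric_def[OF quadrics_ex])
    (auto simp: M_ex_def quadrics.Q_def[OF quadrics_ex, of \<alpha> "{3}"] Gm_def cm_def circ_def
      norm_eq_1 split: prod.splits)

lemma S_ex_iff: "x \<in> S_ex \<alpha> \<longleftrightarrow> x \<in> M_ex \<and> QH (wt1 \<alpha>) (1/4) x = 0 \<and> QH wt2 (1/2) x = 0"
  by (cases x) (auto simp: S_ex_def H_ex_def QH_eq sum_3 wt1_def wt2_def field_simps)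

lemma S_ex_quadric: "\<alpha> > 0 \<Longrightarrow> S_ex \<alpha> = quadrics.quadric {1, 2, 3} (Gm \<alpha>) cm"
  by (rule set_eqI)
    (auto simp: S_ex_iff M_ex_quadric quadrics.quadric_def[OF quadrics_ex]
      quadrics.Q_def[OF quadrics_ex[of \<alpha> "{1, 2, 3}"]]
      Gm_def cm_def QH_def conj_ac del: One_nat_def)

lemma tangent_space_M_ex: "x \<in> M_ex \<Longrightarrow> tangent_space M_ex x = {v. circ x \<bullet> v = 0}"
  using quadrics.tangent_space_quadric[OF quadrics_ex[of 1 "{3}"], of x]
  by (simp add: M_ex_quadric[of 1, symmetric] Gm_def)

lemma tangent_space_S_ex:
  assumes "\<alpha> > 0" "x \<in> S_ex \<alpha>"
  shows "tangent_space (S_ex \<alpha>) x = {v. scal (wt1 \<alpha>) x \<bullet> v = 0 \<and> scal wt2 x \<bullet> v = 0 \<and> circ x \<bullet> v = 0}"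
  using quadrics.tangent_space_quadric[OF quadrics_ex[of \<alpha> "{1, 2, 3}"], of x] assms
  by (simp add: S_ex_quadric[symmetric] Gm_def del: One_nat_def)

lemma S_ex_subset_M_ex: "S_ex \<alpha> \<subseteq> M_ex" by (auto simp: S_ex_def)

lemma smooth_fun_QH: "smooth_fun B (QH w c)"
  unfolding QH_def divide_inverse
  by (intro smooth_fun_diff smooth_fun_mult smooth_fun_inner smooth_fun_const smooth_fun_ident
      smooth_fun_bounded_linear[OF bounded_linear_scal])

lemma has_derivative_QH: "(QH w c has_derivative (\<lambda>v. scal w x \<bullet> v)) (at x within B)"
proof -
  have "((\<lambda>x. (scal w x \<bullet> x) / 2 - c) has_derivative (\<lambda>v. (scal w x \<bullet> v + scal w v \<bullet> x) / 2)) (at x within B)"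
    by (auto intro!: derivative_eq_intros bounded_linear.has_derivative[OF bounded_linear_scal])
  moreover have "(\<lambda>v. (scal w x \<bullet> v + scal w v \<bullet> x) / 2) = (\<lambda>v. scal w x \<bullet> v)"
    using inner_scal[of w x] by (simp add: inner_commute)
  ultimately show ?thesis unfolding QH_def by simp
qed

lemma dir_deriv_QH: "v \<in> tangent_space W x \<Longrightarrow> dir_deriv W (QH w c) x v = scal w x \<bullet> v"
  by (rule dir_deriv_eqI[OF has_derivative_QH])

definition eq_vec :: "3 \<Rightarrow> ambient" where "eq_vec i = (axis i 1, 0, 0)"
definition ep_vec :: "3 \<Rightarrow> ambient" where "ep_vec i = (0, axis i 1, 0)"

lemma scal_basis: "scal w (eq_vec i) = w i *\<^sub>R eq_vec i" "scal w (ep_vec i) = w i *\<^sub>R ep_vec i"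
  "circ (eq_vec i) = 0" "circ (ep_vec i) = 0"
  by (auto simp: scal_def circ_def eq_vec_def ep_vec_def vec_eq_iff axis_def zero_prod_def)

text \<open>Each of the three blocks carries a nonzero level of its own form, so at every point one
  coordinate per block is nonzero; these are the coordinates exchanged for the three
  equations.\<close>

lemma embedded_S_ex:
  assumes "\<alpha> > 0"
  shows "embedded_submanifold 5 (S_ex \<alpha>)"
proof -
  interpret quadrics "{1, 2, 3}" "Gm \<alpha>" "Gm 1" cm using quadrics_ex assms by blast
  have "embedded_submanifold (DIM(ambient) - card {1, 2, 3 :: nat}) quadric"
  proof (rule embedded_submanifold_quadric)
    fix x assume "x \<in> quadric"
    then have x: "x \<in> S_ex \<alpha>" using assms by (simp add: S_ex_quadric)
    obtain q p z where xe: "x = (q, p, z)" by (cases x)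
    have "q $ 1 \<noteq> 0 \<or> p $ 1 \<noteq> 0 \<or> q $ 2 \<noteq> 0 \<or> p $ 2 \<noteq> 0"
      using x by (auto simp: xe S_ex_def H_ex_def)
    then obtain i1 where i1: "i1 \<in> {1, 2}" "q $ i1 \<noteq> 0 \<or> p $ i1 \<noteq> 0" by blast
    have eqp: "x \<bullet> eq_vec i = q $ i" "x \<bullet> ep_vec i = p $ i" for i
      by (simp_all add: xe eq_vec_def ep_vec_def inner_axis)
    obtain u where u: "u = eq_vec i1 \<or> u = ep_vec i1" "x \<bullet> u \<noteq> 0" "i1 \<in> {1, 2}"
      using i1 eqp by metis
    have "q $ 3 \<noteq> 0 \<or> p $ 3 \<noteq> 0"
      using x by (auto simp: xe S_ex_def H_ex_def)
    then obtain v where v: "v = eq_vec 3 \<or> v = ep_vec 3" "x \<bullet> v \<noteq> 0"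
      using eqp by metis
    have "z \<noteq> 0" using x by (auto simp: xe S_ex_def M_ex_def)
    then have "Re z \<noteq> 0 \<or> Im z \<noteq> 0" by (auto simp: complex_eq_iff)
    moreover have "z \<bullet> 1 = Re z" "z \<bullet> \<i> = Im z" by (simp_all add: inner_complex_def)
    ultimately obtain \<zeta> where z: "\<zeta> = 1 \<or> \<zeta> = \<i>" "z \<bullet> \<zeta> \<noteq> 0" by metis
    define e :: "nat \<Rightarrow> ambient" where "e j = (if j = 1 then u else if j = 2 then v else (0, 0, \<zeta>))" for j
    define w where "w j = (if j = 1 then wt1 \<alpha> i1 else 1)" for j :: nat
    have gu: "scal w' u = w' i1 *\<^sub>R u" "circ u = 0" for w' using u scal_basis by auto
    have gv: "scal w' v = w' 3 *\<^sub>R v" "circ v = 0" for w' using v scal_basis by auto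
    have gz: "scal w' (0, 0, \<zeta>) = 0" "circ (0, 0, \<zeta>) = (0, 0, \<zeta>)" for w'
      by (auto simp: scal_def circ_def zero_prod_def vec_eq_iff)
    have "wt2 i1 = 0" "wt1 \<alpha> 3 = 0" "wt2 3 = 1" "wt1 \<alpha> i1 > 0"
      using u(3) assms by (auto simp: wt1_def wt2_def)
    moreover have "u \<bullet> u = 1" "v \<bullet> v = 1" "\<zeta> \<bullet> \<zeta> = 1" "u \<bullet> v = 0" "v \<bullet> u = 0"
      "u \<bullet> (0, 0, \<zeta>) = 0" "v \<bullet> (0, 0, \<zeta>) = 0" "(0, 0, \<zeta>) \<bullet> u = 0" "(0, 0, \<zeta>) \<bullet> v = 0"
      using u v z by (auto simp: eq_vec_def ep_vec_def inner_axis_axis inner_complex_def)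
    moreover have "x \<bullet> (0, 0, \<zeta>) \<noteq> 0" using z by (simp add: xe)
    ultimately show "\<exists>e w. (\<forall>i\<in>{1, 2, 3}. \<forall>j\<in>{1, 2, 3}. e i \<bullet> e j = (if i = j then 1 else 0)) \<and>
      (\<forall>i\<in>{1, 2, 3}. \<forall>j\<in>{1, 2, 3}. Gm \<alpha> j (e i) = (if i = j then w j *\<^sub>R e j else 0)) \<and>
      (\<forall>j\<in>{1, 2, 3}. w j > (0::real) \<and> x \<bullet> e j \<noteq> 0)"
      using u(2) v(2) by (intro exI[of _ e] exI[of _ w]) (simp add: e_def w_def Gm_def gu gv gz)
  qed
  then show ?thesis using assms by (simp add: S_ex_quadric)
qed

text \<open>Four independent covectors cut out the space: the Reeb direction is annihilated by the
  conormal vectors of \<open>S_ex \<alpha>\<close> but not by the contact form.\<close>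

lemma dim_contact_S_ex:
  assumes "\<alpha> > 0" "x \<in> S_ex \<alpha>"
  shows "dim {v \<in> tangent_space (S_ex \<alpha>) x. theta_ex x v = 0} = 4"
proof -
  obtain q p z where xe: "x = (q, p, z)" by (cases x)
  have z1: "cmod z = 1" using assms by (auto simp: xe S_ex_def M_ex_def)
  \<comment> \<open>\<open>n0\<close> represents \<open>\<theta>\<close>, and \<open>n3\<close> is its part orthogonal to the conormal vectors of \<open>S\<close>.\<close>
  define n0 :: ambient where "n0 = (- p, 0, \<i> * z)"
  define n1 n2 where "n1 = scal (wt1 \<alpha>) x" and "n2 = scal wt2 x"
  define a1 a2 where "a1 = (n0 \<bullet> n1) / (n1 \<bullet> n1)" and "a2 = (n0 \<bullet> n2) / (n2 \<bullet> n2)"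
  define n3 where "n3 = n0 - a1 *\<^sub>R n1 - a2 *\<^sub>R n2"
  have th: "theta_ex x v = n0 \<bullet> v" for v
    by (cases v) (simp add: xe theta_ex_def n0_def inner_vec_def inner_complex_def sum_negf algebra_simps)
  have zz: "Re z * Re z + Im z * Im z = 1"
    using z1 by (simp add: cmod_def power2_eq_square)
  have n1: "n1 \<noteq> 0"
  proof
    assume "n1 = 0"
    then have "n1 \<bullet> x = 0" by simp
    then show False using assms by (simp add: n1_def S_ex_iff QH_def)
  qed
  have n2: "n2 \<noteq> 0"
  proof
    assume "n2 = 0"
    then have "n2 \<bullet> x = 0" by simp
    then show False using assms by (simp add: n2_def S_ex_iff QH_def)
  qed
  have sum0: "(\<Sum>i\<in>UNIV. wt1 \<alpha> i * a i * (wt2 i * b i)) = 0" for a b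
    by (rule sum.neutral) (auto simp: wt1_def wt2_def)
  have o12: "n1 \<bullet> n2 = 0"
    using sum0 by (simp add: n1_def n2_def scal_def xe inner_vec_def)
  have o1c: "n1 \<bullet> circ x = 0" "n2 \<bullet> circ x = 0"
    by (simp_all add: n1_def n2_def inner_scal)
  have o0c: "n0 \<bullet> circ x = 0" by (simp add: n0_def xe circ_def inner_complex_def)
  have c: "circ x \<bullet> circ x = 1" using zz by (simp add: xe circ_def inner_complex_def)
  have o3: "n3 \<bullet> n1 = 0" "n3 \<bullet> n2 = 0" "n3 \<bullet> circ x = 0"
    using n1 n2 o12 o1c o0c inner_commute[of n2 n1] by (simp_all add: n3_def inner_diff_left a1_def a2_def)
  define R :: ambient where "R = (0, 0, \<i> * z)"
  have "n3 \<bullet> R = 1"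
    using zz by (simp add: n3_def n0_def n1_def n2_def R_def xe scal_def inner_complex_def inner_diff_left algebra_simps)
  then have n3: "n3 \<noteq> 0" by auto
  define n where "n j = (if j = 1 then n1 else if j = 2 then n2 else if j = 3 then circ x else n3)" for j :: nat
  have "{v \<in> tangent_space (S_ex \<alpha>) x. theta_ex x v = 0} = {v. \<forall>j\<in>{1, 2, 3, 4}. n j \<bullet> v = 0}"
    unfolding tangent_space_S_ex[OF assms] th n_def n3_def
    by (auto simp: n1_def[symmetric] n2_def[symmetric] inner_diff_left)
  moreover have "dim {v. \<forall>j\<in>{1, 2, 3, 4 :: nat}. n j \<bullet> v = 0} = DIM(ambient) - card {1, 2, 3, 4 :: nat}"
    by (rule dim_orthogonal_family)
      (use n1 n2 n3 o12 o1c o3 c in \<open>auto simp: n_def inner_commute\<close>)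
  ultimately show ?thesis by simp
qed

section \<open>Contact fields and the Jacobi bracket on open subsets of \<open>M_ex\<close>\<close>

abbreviation qv :: "ambient \<Rightarrow> real ^ 3" where "qv x \<equiv> fst x"
abbreviation pv :: "ambient \<Rightarrow> real ^ 3" where "pv x \<equiv> fst (snd x)"
abbreviation zv :: "ambient \<Rightarrow> complex" where "zv x \<equiv> snd (snd x)"

lemma theta_ex_alt: "theta_ex x v = Im (cnj (zv x) * zv v) - (\<Sum>i\<in>UNIV. pv x $ i * qv v $ i)"
  by (simp add: theta_ex_def split: prod.splits)

lemma bounded_bilinear_theta_ex: "bounded_bilinear theta_ex"
  unfolding bilinear_conv_bounded_bilinear[symmetric] bilinear_def
  by (auto intro!: linearI simp: theta_ex_alt algebra_simps sum.distrib sum_distrib_left)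

interpretation theta: bounded_bilinear theta_ex by (rule bounded_bilinear_theta_ex)

lemma circ_inner: "circ x \<bullet> v = zv x \<bullet> zv v"
  by (simp add: circ_def case_prod_beta inner_prod_def)

text \<open>The Reeb field and the frame of the contact distribution dual to \<open>dp\<^sub>i\<close> and \<open>dq\<^sub>i\<close>.\<close>

definition Rv :: "ambient \<Rightarrow> ambient" where
  "Rv x = (0, 0, \<i> * zv x)"

definition Dv :: "3 \<Rightarrow> ambient \<Rightarrow> ambient" where
  "Dv i x = (axis i 1, 0, (pv x $ i) *\<^sub>R (\<i> * zv x))"

lemma smooth_fun_pv: "smooth_fun B (\<lambda>x. pv x $ i)"
  by (intro smooth_fun_bounded_linear[OF bounded_linear_vec_nth] smooth_fun_fst smooth_fun_snd smooth_fun_ident)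

lemma smooth_fun_Rv: "smooth_fun B Rv"
  unfolding Rv_def
  by (intro smooth_fun_Pair smooth_fun_const smooth_fun_bounded_linear[OF bounded_linear_mult_right]
      smooth_fun_snd smooth_fun_ident)

lemma smooth_fun_Dv: "smooth_fun B (Dv i)"
  unfolding Dv_def
  by (intro smooth_fun_Pair smooth_fun_const smooth_fun_scaleR smooth_fun_pv
      smooth_fun_bounded_linear[OF bounded_linear_mult_right] smooth_fun_snd smooth_fun_ident)

lemma theta_frame:
  assumes "cmod (zv x) = 1"
  shows "theta_ex x (Rv x) = 1" "theta_ex x (ep_vec i) = 0" "theta_ex x (Dv i x) = 0"
proof -
  have z: "Re (zv x) * Re (zv x) + Im (zv x) * Im (zv x) = 1"
    using assms by (simp add: cmod_def power2_eq_square)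
  have 1: "Im (cnj (zv x) * (\<i> * zv x)) = 1" using z by (simp add: algebra_simps)
  show "theta_ex x (Rv x) = 1" using 1 by (simp add: theta_ex_alt Rv_def)
  show "theta_ex x (ep_vec i) = 0" by (simp add: theta_ex_alt ep_vec_def)
  have "Im (cnj (zv x) * (pv x $ i) *\<^sub>R (\<i> * zv x)) = pv x $ i * Im (cnj (zv x) * (\<i> * zv x))"
    by (simp only: mult_scaleR_right scaleR_complex.sel)
  moreover have "(\<Sum>j\<in>UNIV. pv x $ j * axis i 1 $ j) = pv x $ i"
    by (simp add: axis_def if_distrib[of "(*) _"] cong: if_cong)
  ultimately show "theta_ex x (Dv i x) = 0" using 1 by (simp add: theta_ex_alt Dv_def)
qed

lemma tangent_circle:
  fixes z w :: complex
  assumes "cmod z = 1" "z \<bullet> w = 0"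
  shows "w = Im (cnj z * w) *\<^sub>R (\<i> * z)"
proof -
  have z: "Re z * Re z + Im z * Im z = 1"
    using assms by (simp add: cmod_def power2_eq_square)
  have 0: "Re z * Re w + Im z * Im w = 0" using assms(2) by (simp add: inner_complex_def)
  have "Re w = (Re z * Re z + Im z * Im z) * Re w" using z by simp
  also have "\<dots> = - ((Re z * Im w - Im z * Re w) * Im z) + Re z * (Re z * Re w + Im z * Im w)"
    by (simp add: algebra_simps)
  finally have 1: "Re w = - ((Re z * Im w - Im z * Re w) * Im z)" using 0 by simp
  have "Im w = (Re z * Re z + Im z * Im z) * Im w" using z by simp
  also have "\<dots> = (Re z * Im w - Im z * Re w) * Re z + Im z * (Re z * Re w + Im z * Im w)"
    by (simp add: algebra_simps)
  finally have 2: "Im w = (Re z * Im w - Im z * Re w) * Re z" using 0 by simp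
  show ?thesis using 1 2 by (simp add: complex_eq_iff)
qed

text \<open>The contact field of \<open>QH w c\<close> in closed form. It rotates plane
  \<open>i\<close> with speed \<open>w i\<close>; the circle component is the one for which
  \<open>theta_ex\<close> takes the value \<open>QH w c x\<close>.\<close>

definition hv :: "(3 \<Rightarrow> real) \<Rightarrow> real \<Rightarrow> ambient \<Rightarrow> ambient" where
  "hv w c x = (\<chi> i. - w i * pv x $ i, \<chi> i. w i * qv x $ i,
     (QH w c x - (\<Sum>i\<in>UNIV. w i * (pv x $ i)\<^sup>2)) *\<^sub>R (\<i> * zv x))"

lemma scal_alt: "scal w x = (\<chi> i. w i * qv x $ i, \<chi> i. w i * pv x $ i, 0)"
  by (simp add: scal_def split: prod.splits)

locale contact_open =
  fixes W :: "ambient set"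
  assumes openin_W: "openin (top_of_set M_ex) W"
begin

abbreviation D :: "(ambient \<Rightarrow> 'b::euclidean_space) \<Rightarrow> ambient \<Rightarrow> ambient \<Rightarrow> 'b" where
  "D \<equiv> dir_deriv W"

lemma W_subset: "W \<subseteq> M_ex" using openin_W openin_imp_subset by blast

lemma cmod_zv: "x \<in> W \<Longrightarrow> cmod (zv x) = 1"
  using W_subset by (auto simp: M_ex_def)

lemma tangent_W: "x \<in> W \<Longrightarrow> tangent_space W x = {v. circ x \<bullet> v = 0}"
  using tangent_space_openin[OF openin_W] tangent_space_M_ex W_subset by blast

lemma tangent_add: "x \<in> W \<Longrightarrow> v \<in> tangent_space W x \<Longrightarrow> w \<in> tangent_space W x \<Longrightarrow> v + w \<in> tangent_space W x"
  and tangent_diff: "x \<in> W \<Longrightarrow> v \<in> tangent_space W x \<Longrightarrow> w \<in> tangent_space W x \<Longrightarrow> v - w \<in> tangent_space W x"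
  and tangent_scaleR: "x \<in> W \<Longrightarrow> v \<in> tangent_space W x \<Longrightarrow> a *\<^sub>R v \<in> tangent_space W x"
  and tangent_sum: "x \<in> W \<Longrightarrow> (\<And>i. i \<in> I \<Longrightarrow> u i \<in> tangent_space W x) \<Longrightarrow> (\<Sum>i\<in>I. u i) \<in> tangent_space W x"
  by (simp_all add: tangent_W inner_add_right inner_diff_right inner_sum_right)

lemma tangent_frame:
  assumes "x \<in> W"
  shows "Rv x \<in> tangent_space W x" "ep_vec i \<in> tangent_space W x" "Dv i x \<in> tangent_space W x"
  using assms
  by (simp_all add: tangent_W circ_inner Rv_def ep_vec_def Dv_def inner_complex_def)

lemma vector_field_frame: "vector_field W Rv" "vector_field W (\<lambda>x. ep_vec i)" "vector_field W (Dv i)"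
  by (simp_all add: vector_field_def tangent_frame smooth_fun_Rv smooth_fun_Dv smooth_fun_const)

lemma tangent_decompose:
  assumes x: "x \<in> W" and v: "v \<in> tangent_space W x"
  shows "v = theta_ex x v *\<^sub>R Rv x + (\<Sum>i\<in>UNIV. (qv v $ i) *\<^sub>R Dv i x) + (\<Sum>i\<in>UNIV. (pv v $ i) *\<^sub>R ep_vec i)"
proof -
  have z: "zv v = Im (cnj (zv x) * zv v) *\<^sub>R (\<i> * zv x)"
    using tangent_circle[OF cmod_zv[OF x]] v x by (simp add: tangent_W circ_inner)
  have "(\<Sum>i\<in>UNIV. (u $ i) *\<^sub>R axis i (1::real)) = u" for u :: "real ^ 3"
    by (simp add: vec_eq_iff axis_def if_distrib[of "(*) _"] sum.delta cong: if_cong)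
  moreover have "(\<Sum>i\<in>UNIV. (qv v $ i) *\<^sub>R (pv x $ i) *\<^sub>R (\<i> * zv x)) =
      (\<Sum>i\<in>UNIV. pv x $ i * qv v $ i) *\<^sub>R (\<i> * zv x)"
    by (simp add: scaleR_sum_left mult.commute)
  ultimately show ?thesis
    using z
    by (intro prod_eqI)
      (simp_all add: Rv_def Dv_def ep_vec_def fst_sum snd_sum theta_ex_alt scaleR_diff_left)
qed

text \<open>As \<open>theta_ex\<close> is bilinear on the ambient space, its point argument may be a
  vector, and \<open>theta_ex v w\<close> is the derivative of the coefficients of the form. The
  circle part drops out because \<open>zv v\<close> and \<open>zv w\<close> are real multiples of
  the same vector.\<close>

lemma theta_tangent:
  assumes x: "x \<in> W" and v: "v \<in> tangent_space W x" and w: "w \<in> tangent_space W x"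
  shows "theta_ex v w = - (\<Sum>i\<in>UNIV. pv v $ i * qv w $ i)"
proof -
  obtain a where a: "zv v = a *\<^sub>R (\<i> * zv x)"
    using tangent_circle[OF cmod_zv[OF x]] v x by (auto simp: tangent_W circ_inner)
  obtain b where b: "zv w = b *\<^sub>R (\<i> * zv x)"
    using tangent_circle[OF cmod_zv[OF x]] w x by (auto simp: tangent_W circ_inner)
  have "Im (cnj (zv v) * zv w) = 0" by (simp add: a b algebra_simps)
  then show ?thesis by (simp add: theta_ex_alt)
qed

lemma dir_deriv_theta:
  assumes Y: "smooth_fun W Y" and x: "x \<in> W" "v \<in> tangent_space W x"
  shows "D (\<lambda>y. theta_ex y (Y y)) x v = theta_ex x (D Y x v) + theta_ex v (Y x)"
  by (rule dir_deriv_eqI[OF _ x(2)])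
    (rule theta.FDERIV[OF has_derivative_ident smooth_fun_has_derivative[OF Y x(1)]])

text \<open>Cartan's formula; the two sums are \<open>- d\<theta>(X, Y)\<close>, where
  \<open>d\<theta>\<close> is the sum of the 2-forms \<open>dq^i wedge dp_i\<close>.\<close>

lemma theta_lie_bracket:
  assumes X: "vector_field W X" and Y: "vector_field W Y" and x: "x \<in> W"
  shows "theta_ex x (lie_bracket W X Y x) =
    D (\<lambda>y. theta_ex y (Y y)) x (X x) - D (\<lambda>y. theta_ex y (X y)) x (Y x)
    + (\<Sum>i\<in>UNIV. pv (X x) $ i * qv (Y x) $ i) - (\<Sum>i\<in>UNIV. pv (Y x) $ i * qv (X x) $ i)"
proof -
  have t: "X x \<in> tangent_space W x" "Y x \<in> tangent_space W x" "smooth_fun W X" "smooth_fun W Y"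
    using X Y x by (auto simp: vector_field_def)
  show ?thesis
    using dir_deriv_theta[OF t(3) x t(2)] dir_deriv_theta[OF t(4) x t(1)]
      theta_tangent[OF x t(1,2)] theta_tangent[OF x t(2,1)]
    by (simp add: lie_bracket_def theta.diff_right)
qed

text \<open>The candidate for \<open>X_f\<close> in the frame: the Reeb component yields
  \<open>\<theta>(X_f) = f\<close>, and the components along the contact distribution solve
  \<open>d\<theta>(X_f, Y) = - df(Y)\<close> for \<open>Y\<close> in it.\<close>

definition cfield :: "(ambient \<Rightarrow> real) \<Rightarrow> ambient \<Rightarrow> ambient" where
  "cfield f x = f x *\<^sub>R Rv x + (\<Sum>i\<in>UNIV. (- D f x (ep_vec i)) *\<^sub>R Dv i x) + (\<Sum>i\<in>UNIV. D f x (Dv i x) *\<^sub>R ep_vec i)"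

lemma tangent_cfield: "x \<in> W \<Longrightarrow> cfield f x \<in> tangent_space W x"
  unfolding cfield_def by (intro tangent_add tangent_sum tangent_scaleR tangent_frame)

lemma vector_field_cfield:
  assumes "smooth_fun W f" shows "vector_field W (cfield f)"
proof -
  have "smooth_fun W (cfield f)"
    unfolding cfield_def
    by (intro smooth_fun_add smooth_fun_sum smooth_fun_scaleR smooth_fun_minus smooth_fun_Rv smooth_fun_Dv
        smooth_fun_const smooth_fun_dir_deriv[OF assms] vector_field_frame assms)
  then show ?thesis by (simp add: vector_field_def tangent_cfield)
qed

lemma cfield_comps:
  "qv (cfield f x) $ i = - D f x (ep_vec i)" "pv (cfield f x) $ i = D f x (Dv i x)"
  by (simp_all add: cfield_def Rv_def Dv_def ep_vec_def fst_sum snd_sum axis_def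
      if_distrib[of "(*) _"] sum.delta sum_negf cong: if_cong)

lemma theta_cfield: "x \<in> W \<Longrightarrow> theta_ex x (cfield f x) = f x"
  by (simp add: cfield_def theta.add_right theta.sum_right theta.scaleR_right theta.minus_right
      theta_frame cmod_zv)

lemma D_linear:
  assumes "smooth_fun W f" "x \<in> W"
  shows "D f x (v + w) = D f x v + D f x w" "D f x (v - w) = D f x v - D f x w"
    "D f x (a *\<^sub>R v) = a *\<^sub>R D f x v" "D f x (\<Sum>i\<in>I. u i) = (\<Sum>i\<in>I. D f x (u i))"
  using linear_dir_deriv[OF assms] by (simp_all add: linear_add linear_diff linear_cmul linear_sum)

lemma D_cfield:
  assumes "smooth_fun W g" "x \<in> W"
  shows "D g x (cfield f x) = f x * D g x (Rv x)
    - (\<Sum>i\<in>UNIV. D f x (ep_vec i) * D g x (Dv i x)) + (\<Sum>i\<in>UNIV. D f x (Dv i x) * D g x (ep_vec i))"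
  unfolding cfield_def D_linear[OF assms] by (simp add: sum_negf)

lemma preserves_contact_cfield:
  assumes f: "smooth_fun W f"
  shows "preserves_contact W theta_ex (cfield f)"
  unfolding preserves_contact_def
proof (intro allI impI ballI)
  fix Y x assume Y: "vector_field W Y \<and> (\<forall>x\<in>W. theta_ex x (Y x) = 0)" and x: "x \<in> W"
  have Yx: "Y x \<in> tangent_space W x" using Y x by (simp add: vector_field_def)
  have "D (\<lambda>y. theta_ex y (Y y)) x = D (\<lambda>y. 0) x"
    by (rule dir_deriv_cong[OF _ x]) (use Y in simp)
  moreover have "D (\<lambda>y. theta_ex y (cfield f y)) x = D f x"
    by (rule dir_deriv_cong[OF _ x]) (simp add: theta_cfield)
  moreover have "D f x (Y x) = (\<Sum>i\<in>UNIV. qv (Y x) $ i * D f x (Dv i x)) + (\<Sum>i\<in>UNIV. pv (Y x) $ i * D f x (ep_vec i))"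
    by (subst tangent_decompose[OF x Yx]) (use Y x in \<open>simp add: D_linear[OF f x]\<close>)
  ultimately show "theta_ex x (lie_bracket W (cfield f) Y x) = 0"
    using theta_lie_bracket[OF vector_field_cfield[OF f] _ x, of Y] Y
    by (simp add: cfield_comps dir_deriv_const[OF x tangent_cfield[OF x]] sum_negf mult.commute)
qed

text \<open>It is enough to test with the frame fields \<open>ep_vec i\<close> and
  \<open>Dv i\<close>: by Cartan's formula each of them reads off one component of
  \<open>X\<close>.\<close>

lemma preserves_contact_unique:
  assumes f: "smooth_fun W f" and X: "vector_field W X" "preserves_contact W theta_ex X"
    and th: "\<And>x. x \<in> W \<Longrightarrow> theta_ex x (X x) = f x" and x: "x \<in> W"
  shows "X x = cfield f x"
proof -
  have Xx: "X x \<in> tangent_space W x" using X x by (simp add: vector_field_def)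
  have e: "D (\<lambda>y. theta_ex y (X y)) x = D f x"
    by (rule dir_deriv_cong[OF _ x]) (simp add: th)
  have "qv (X x) $ i = - D f x (ep_vec i)" for i
  proof -
    have "theta_ex x (lie_bracket W X (\<lambda>x. ep_vec i) x) = 0"
      using X(2) vector_field_frame(2) x theta_frame(2)[OF cmod_zv]
      unfolding preserves_contact_def by blast
    moreover have "D (\<lambda>y. theta_ex y (ep_vec i)) x = D (\<lambda>y. 0) x"
      by (rule dir_deriv_cong[OF _ x]) (simp add: theta_frame(2)[OF cmod_zv])
    moreover have "(\<Sum>j\<in>UNIV. axis i 1 $ j * qv (X x) $ j) = qv (X x) $ i"
      by (simp add: axis_def if_distrib[of "\<lambda>a. a * _"] cong: if_cong)
    ultimately show ?thesis
      using theta_lie_bracket[OF X(1) vector_field_frame(2)[of i] x] e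
      by (simp add: ep_vec_def[of i] dir_deriv_const[OF x Xx])
  qed
  moreover have "pv (X x) $ i = D f x (Dv i x)" for i
  proof -
    have "theta_ex x (lie_bracket W X (Dv i) x) = 0"
      using X(2) vector_field_frame(3)[of i] x theta_frame(3)[OF cmod_zv]
      unfolding preserves_contact_def by blast
    moreover have "D (\<lambda>y. theta_ex y (Dv i y)) x = D (\<lambda>y. 0) x"
      by (rule dir_deriv_cong[OF _ x]) (simp add: theta_frame(3)[OF cmod_zv])
    moreover have "(\<Sum>j\<in>UNIV. pv (X x) $ j * axis i 1 $ j) = pv (X x) $ i"
      by (simp add: axis_def if_distrib[of "(*) _"] cong: if_cong)
    moreover have "qv (Dv i x) = axis i 1" "pv (Dv i x) = 0" by (simp_all add: Dv_def)
    ultimately show ?thesis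
      using theta_lie_bracket[OF X(1) vector_field_frame(3)[of i] x] e
      by (simp add: dir_deriv_const[OF x Xx])
  qed
  ultimately show ?thesis
    by (subst tangent_decompose[OF x Xx]) (simp add: cfield_def th[OF x])
qed

lemma contact_field_eq:
  assumes f: "smooth_fun W f" and x: "x \<in> W"
  shows "contact_field W theta_ex f x = cfield f x"
proof -
  \<comment> \<open>The description in \<open>contact_field\<close> singles out a field that
    vanishes off \<open>W\<close>, hence the extension by zero.\<close>
  let ?X = "\<lambda>x. if x \<in> W then cfield f x else 0"
  have lb: "lie_bracket W ?X Y y = lie_bracket W (cfield f) Y y" if "y \<in> W" for Y y
    using that dir_deriv_cong[OF _ that, of ?X "cfield f"] by (simp add: lie_bracket_def)
  have "contact_field W theta_ex f = ?X"
    unfolding contact_field_def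
  proof (rule the_equality)
    have "vector_field W ?X"
      using vector_field_cfield[OF f] smooth_fun_cong[of W "cfield f" ?X] by (simp add: vector_field_def)
    moreover have "preserves_contact W theta_ex ?X"
      using preserves_contact_cfield[OF f] lb by (simp add: preserves_contact_def)
    ultimately show "vector_field W ?X \<and> preserves_contact W theta_ex ?X \<and>
        (\<forall>x\<in>W. theta_ex x (?X x) = f x) \<and> (\<forall>x. x \<notin> W \<longrightarrow> ?X x = 0)"
      by (simp add: theta_cfield)
  next
    fix X assume X: "vector_field W X \<and> preserves_contact W theta_ex X \<and>
        (\<forall>x\<in>W. theta_ex x (X x) = f x) \<and> (\<forall>x. x \<notin> W \<longrightarrow> X x = 0)"
    show "X = ?X"
    proof
      fix x
      have "X x = 0" if "x \<notin> W" using X that by blast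
      moreover have "X x = cfield f x" if "x \<in> W"
        using preserves_contact_unique[OF f, of X x] X that by blast
      ultimately show "X x = ?X x" by (cases "x \<in> W") simp_all
    qed
  qed
  then show ?thesis using x by simp
qed

text \<open>The classical expression \<open>X_f g - g R f\<close> of the Jacobi bracket of a contact
  form with Reeb field \<open>R\<close>.\<close>

definition Jac :: "(ambient \<Rightarrow> real) \<Rightarrow> (ambient \<Rightarrow> real) \<Rightarrow> ambient \<Rightarrow> real" where
  "Jac f g x = D g x (cfield f x) - g x * D f x (Rv x)"

lemma jacobi_bracket_eq:
  assumes f: "smooth_fun W f" and g: "smooth_fun W g" and x: "x \<in> W"
  shows "jacobi_bracket W theta_ex f g x = Jac f g x"
proof -
  have c: "D (contact_field W theta_ex h) x = D (cfield h) x" if "smooth_fun W h" for h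
    by (rule dir_deriv_cong[OF _ x]) (simp add: contact_field_eq that)
  have t: "D (\<lambda>y. theta_ex y (cfield h y)) x = D h x" for h
    by (rule dir_deriv_cong[OF _ x]) (simp add: theta_cfield)
  have "jacobi_bracket W theta_ex f g x = theta_ex x (lie_bracket W (cfield f) (cfield g) x)"
    using f g x by (simp add: jacobi_bracket_def lie_bracket_def contact_field_eq c)
  also have "\<dots> = D g x (cfield f x) - D f x (cfield g x)
     + (\<Sum>i\<in>UNIV. pv (cfield f x) $ i * qv (cfield g x) $ i) - (\<Sum>i\<in>UNIV. pv (cfield g x) $ i * qv (cfield f x) $ i)"
    by (simp add: theta_lie_bracket vector_field_cfield f g x t)
  also have "\<dots> = Jac f g x"
    unfolding Jac_def D_cfield[OF f x, of g] cfield_comps by (simp add: sum_negf mult.commute)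
  finally show ?thesis .
qed

lemma Jac_antisym:
  assumes f: "smooth_fun W f" and g: "smooth_fun W g" and x: "x \<in> W"
  shows "Jac f g x = - Jac g f x"
  unfolding Jac_def D_cfield[OF f x] D_cfield[OF g x] by (simp add: mult.commute algebra_simps)

lemma smooth_fun_Jac:
  assumes f: "smooth_fun W f" and g: "smooth_fun W g"
  shows "smooth_fun W (Jac f g)"
  unfolding Jac_def
  by (intro smooth_fun_diff smooth_fun_mult smooth_fun_dir_deriv[OF g vector_field_cfield[OF f]]
      smooth_fun_dir_deriv[OF f vector_field_frame(1)] g)

text \<open>Fields tangent to \<open>W\<close> annihilate \<open>|z|^2 / 2\<close>, which is smooth
  on the whole space; the commutator identity for this function says that the bracket is orthogonal
  to \<open>circ x\<close>.\<close>

lemma D_lie_bracket_tangent: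
  assumes X: "vector_field W X" and Y: "vector_field W Y" and x: "x \<in> W"
  shows "lie_bracket W X Y x \<in> tangent_space W x"
proof -
  let ?h = "\<lambda>x. (circ x \<bullet> x) / 2"
  have sm: "smooth_on UNIV ?h"
    unfolding smooth_fun_open_iff[symmetric, OF open_UNIV] divide_inverse
    by (intro smooth_fun_mult smooth_fun_inner smooth_fun_const smooth_fun_ident
      smooth_fun_bounded_linear[OF bounded_linear_circ])
  have der: "(?h has_derivative (\<lambda>v. circ x \<bullet> v)) (at x within B)" for x B
  proof -
    have "(?h has_derivative (\<lambda>v. (circ x \<bullet> v + circ v \<bullet> x) / 2)) (at x within B)"
      by (auto intro!: derivative_eq_intros bounded_linear.has_derivative[OF bounded_linear_circ])
    moreover have "(\<lambda>v. (circ x \<bullet> v + circ v \<bullet> x) / 2) = (\<lambda>v. circ x \<bullet> v)"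
      using inner_circ[of x] by (simp add: inner_commute)
    ultimately show ?thesis by simp
  qed
  have z: "D ?h y (Z y) = 0" if "y \<in> W" "vector_field W Z" for y Z
    using dir_deriv_eqI[OF der, of "Z y" W y] that by (simp add: vector_field_def tangent_W)
  have zz: "D (\<lambda>y. D ?h y (Z y)) x (Z' x) = 0" if "vector_field W Z" "vector_field W Z'" for Z Z'
  proof -
    have "D (\<lambda>y. D ?h y (Z y)) x = D (\<lambda>y. 0) x"
      by (rule dir_deriv_cong[OF _ x]) (simp add: z that(1))
    then show ?thesis using dir_deriv_const[OF x, of "Z' x" 0] that(2) x by (simp add: vector_field_def)
  qed
  have "frechet_derivative ?h (at x) (lie_bracket W X Y x) = 0"
    using dir_deriv_commutator[OF X Y open_UNIV sm, of ?h x] x by (simp add: zz X Y)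
  then have "circ x \<bullet> lie_bracket W X Y x = 0"
    by (simp add: frechet_derivative_eqI[OF der])
  then show ?thesis by (simp add: tangent_W x)
qed

lemma D_commutator:
  assumes f: "smooth_fun W f" and X: "vector_field W X" and Y: "vector_field W Y" and x: "x \<in> W"
  shows "D (\<lambda>y. D f y (Y y)) x (X x) - D (\<lambda>y. D f y (X y)) x (Y x) = D f x (lie_bracket W X Y x)"
proof -
  obtain U g where U: "open U" "x \<in> U" "smooth_on U g" "\<forall>y\<in>W \<inter> U. f y = g y"
    using f x unfolding smooth_fun_def by blast
  have "D f x (lie_bracket W X Y x) = frechet_derivative g (at x) (lie_bracket W X Y x)"
    by (rule dir_deriv_extension[OF U(1-3)]) (use U x D_lie_bracket_tangent[OF X Y] in auto)
  then show ?thesis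
    using dir_deriv_commutator[OF X Y U(1,3) _ x U(2), of f] U(4) by simp
qed

lemma D_QH_frame:
  assumes "x \<in> W"
  shows "D (QH w c) x (Rv x) = 0" "D (QH w c) x (ep_vec i) = w i * pv x $ i" "D (QH w c) x (Dv i x) = w i * qv x $ i"
  unfolding dir_deriv_QH[OF tangent_frame(1)[OF assms]] dir_deriv_QH[OF tangent_frame(2)[OF assms]]
    dir_deriv_QH[OF tangent_frame(3)[OF assms]]
  by (simp_all add: scal_alt Rv_def ep_vec_def Dv_def inner_axis)

lemma cfield_QH:
  assumes x: "x \<in> W" shows "cfield (QH w c) x = hv w c x"
proof -
  have ax: "(\<Sum>i\<in>UNIV. (a i) *\<^sub>R axis i (1::real)) = (\<chi> i. a i)" for a :: "3 \<Rightarrow> real"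
    by (simp add: vec_eq_iff axis_def if_distrib[of "(*) _"] sum.delta cong: if_cong)
  note ax[of "\<lambda>i. - (w i * pv x $ i)"] ax[of "\<lambda>i. w i * qv x $ i"]
  moreover have "(\<Sum>i\<in>UNIV. (- (w i * pv x $ i)) *\<^sub>R (pv x $ i) *\<^sub>R (\<i> * zv x)) =
      - ((\<Sum>i\<in>UNIV. w i * (pv x $ i)\<^sup>2) *\<^sub>R (\<i> * zv x))"
    by (simp add: scaleR_sum_left sum_negf power2_eq_square mult.assoc)
  ultimately show ?thesis
    unfolding cfield_def D_QH_frame[OF x]
    by (intro prod_eqI) (simp_all add: hv_def Rv_def Dv_def ep_vec_def fst_sum snd_sum scaleR_diff_left)
qed

text \<open>\<open>QH w c\<close> does not depend on the angle, so the Reeb field annihilates it and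
  the term of order zero disappears.\<close>

lemma Jac_QH: "x \<in> W \<Longrightarrow> Jac (QH w c) g x = D g x (hv w c x)"
  by (simp add: Jac_def cfield_QH D_QH_frame)

lemma tangent_hv: "x \<in> W \<Longrightarrow> hv w c x \<in> tangent_space W x"
  using tangent_cfield cfield_QH by metis

lemma vector_field_hv: "vector_field W (hv w c)"
  using vector_field_cfield[OF smooth_fun_QH, of w c] smooth_fun_cong[of W "cfield (QH w c)" "hv w c"]
  by (simp add: vector_field_def cfield_QH)

lemma D_QH_hv: "x \<in> W \<Longrightarrow> D (QH w c) x (hv w' c' x) = 0"
  unfolding dir_deriv_QH[OF tangent_hv]
  by (simp add: scal_alt hv_def inner_vec_def sum.distrib[symmetric] sum_negf[symmetric] algebra_simps)

end

definition zc :: "3 \<Rightarrow> ambient \<Rightarrow> complex" where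
  "zc i x = Complex (qv x $ i) (pv x $ i)"

text \<open>The resonant monomial: when the first two planes rotate with speeds \<open>w 1\<close>
  and \<open>w 2\<close>, its phase moves with speed \<open>a w 1 - b w 2\<close>, which is zero for
  the speeds 1 and \<open>\<alpha> = a / b\<close>.\<close>

definition res :: "nat \<Rightarrow> nat \<Rightarrow> ambient \<Rightarrow> complex" where
  "res a b x = zc 1 x ^ a * cnj (zc 2 x) ^ b"

lemma bounded_linear_zc: "bounded_linear (zc i)"
  unfolding linear_conv_bounded_linear[symmetric]
  by (rule linearI) (simp_all add: zc_def complex_eq_iff)

lemma smooth_fun_res: "smooth_fun B (\<lambda>x. Im (res a b x))"
  unfolding res_def
  by (intro smooth_fun_bounded_linear[OF bounded_linear_Im] smooth_fun_mult smooth_fun_power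
      smooth_fun_bounded_linear[OF bounded_linear_cnj] smooth_fun_bounded_linear_UNIV bounded_linear_zc)

lemma (in contact_open) D_res_hv:
  assumes x: "x \<in> W" and ab: "a > 0" "b > 0"
  shows "D (\<lambda>x. Im (res a b x)) x (hv w c x) = (real a * w 1 - real b * w 2) * Re (res a b x)"
proof -
  have zh: "zc i (hv w c x) = \<i> * w i * zc i x" for i
    by (simp add: zc_def hv_def complex_eq_iff)
  have d: "((\<lambda>x. Im (res a b x)) has_derivative
     (\<lambda>v. Im (zc 1 x ^ a * (of_nat b * cnj (zc 2 v) * cnj (zc 2 x) ^ (b - 1)) +
        of_nat a * zc 1 v * zc 1 x ^ (a - 1) * cnj (zc 2 x) ^ b))) (at x within W)"
    unfolding res_def
    by (intro has_derivative_Im has_derivative_mult has_derivative_power bounded_linear_imp_has_derivative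
        bounded_linear.has_derivative[OF bounded_linear_cnj] bounded_linear_zc)
  have pw: "u * u ^ (n - 1) = u ^ n" if "n > 0" for u :: complex and n
    using that by (metis power_eq_if not_gr_zero)
  have "zc 1 x ^ a * (of_nat b * cnj (zc 2 (hv w c x)) * cnj (zc 2 x) ^ (b - 1)) +
        of_nat a * zc 1 (hv w c x) * zc 1 x ^ (a - 1) * cnj (zc 2 x) ^ b =
      - (\<i> * of_nat b * w 2) * zc 1 x ^ a * (cnj (zc 2 x) * cnj (zc 2 x) ^ (b - 1)) +
        (\<i> * of_nat a * w 1) * (zc 1 x * zc 1 x ^ (a - 1)) * cnj (zc 2 x) ^ b"
    by (simp add: zh algebra_simps)
  also have "\<dots> = \<i> * (complex_of_real (real a * w 1 - real b * w 2) * res a b x)"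
    unfolding pw[OF ab(1)] pw[OF ab(2)] res_def by (simp add: algebra_simps)
  finally show ?thesis
    using dir_deriv_eqI[OF d tangent_hv[OF x, of w c]] by simp
qed

section \<open>First and second order deformations on an open subset of \<open>M_ex\<close>\<close>

context contact_open
begin

lemma D_lincomb:
  fixes g g' :: "ambient \<Rightarrow> real"
  assumes "smooth_fun W g" "smooth_fun W g'" "x \<in> W" "v \<in> tangent_space W x"
  shows "D (\<lambda>y. g y + a * g' y) x v = D g x v + a * D g' x v"
proof -
  have "smooth_fun W (\<lambda>y. a * g' y)" by (intro smooth_fun_mult smooth_fun_const assms)
  then show ?thesis
    using dir_deriv_add[OF assms(1) _ assms(3,4), of "\<lambda>y. a * g' y"]
      dir_deriv_mult[OF smooth_fun_const assms(2-4), of a] dir_deriv_const[OF assms(3,4), of a] by simp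
qed

lemma smooth_fun_lincomb:
  fixes g g' :: "ambient \<Rightarrow> real"
  assumes "smooth_fun W g" "smooth_fun W g'"
  shows "smooth_fun W (\<lambda>y. g y + a * g' y)"
  by (intro smooth_fun_add smooth_fun_mult smooth_fun_const assms)

lemma Jac_cong:
  assumes "\<And>y. y \<in> W \<Longrightarrow> f y = f' y" "\<And>y. y \<in> W \<Longrightarrow> g y = g' y" "x \<in> W"
  shows "Jac f g x = Jac f' g' x"
proof -
  have "D f x = D f' x" "D g x = D g' x" using assms by (auto intro: dir_deriv_cong)
  then show ?thesis using assms by (simp add: Jac_def cfield_def)
qed

lemma Jac_lincomb_right:
  assumes f: "smooth_fun W f" and g: "smooth_fun W g" "smooth_fun W g'" and x: "x \<in> W"
  shows "Jac f (\<lambda>y. g y + a * g' y) x = Jac f g x + a * Jac f g' x"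
  unfolding Jac_def by (simp add: D_lincomb g x tangent_cfield algebra_simps)

text \<open>A derivation of the trivialized line bundle over \<open>W\<close> with symbol \<open>V\<close>.\<close>

definition deriv_op :: "(ambient \<Rightarrow> ambient) \<Rightarrow> (ambient \<Rightarrow> real) \<Rightarrow> (ambient \<Rightarrow> real) \<Rightarrow> ambient \<Rightarrow> real" where
  "deriv_op V \<kappa> f y = D f y (V y) + \<kappa> y * f y"

text \<open>The counterpart over \<open>W\<close> of \<open>lie_deriv\<close> applied to the
  bracket.\<close>

definition lie_Jac :: "(ambient \<Rightarrow> ambient) \<Rightarrow> (ambient \<Rightarrow> real) \<Rightarrow> (ambient \<Rightarrow> real) \<Rightarrow> (ambient \<Rightarrow> real) \<Rightarrow> ambient \<Rightarrow> real" where
  "lie_Jac V \<kappa> f g y =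
     deriv_op V \<kappa> (Jac f g) y - Jac (deriv_op V \<kappa> f) g y - Jac f (deriv_op V \<kappa> g) y"

lemma smooth_fun_deriv_op:
  "vector_field W V \<Longrightarrow> smooth_fun W \<kappa> \<Longrightarrow> smooth_fun W f \<Longrightarrow> smooth_fun W (deriv_op V \<kappa> f)"
  unfolding deriv_op_def by (intro smooth_fun_add smooth_fun_mult smooth_fun_dir_deriv)

lemma deriv_op_cong:
  assumes "\<And>y. y \<in> W \<Longrightarrow> f y = g y" "x \<in> W"
  shows "deriv_op V \<kappa> f x = deriv_op V \<kappa> g x"
  using dir_deriv_cong[OF assms] assms by (simp add: deriv_op_def)

lemma deriv_op_lincomb:
  assumes "vector_field W V" "smooth_fun W g" "smooth_fun W g'" "x \<in> W"
  shows "deriv_op V \<kappa> (\<lambda>y. g y + a * g' y) x = deriv_op V \<kappa> g x + a * deriv_op V \<kappa> g' x"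
proof -
  have "V x \<in> tangent_space W x" using assms by (simp add: vector_field_def)
  then show ?thesis using D_lincomb[OF assms(2-4), of "V x" a] by (simp add: deriv_op_def algebra_simps)
qed

lemma lie_Jac_lincomb_right:
  assumes V: "vector_field W V" and k: "smooth_fun W \<kappa>" and f: "smooth_fun W f"
    and g: "smooth_fun W g" "smooth_fun W g'" and x: "x \<in> W"
  shows "lie_Jac V \<kappa> f (\<lambda>y. g y + a * g' y) x = lie_Jac V \<kappa> f g x + a * lie_Jac V \<kappa> f g' x"
proof -
  have "deriv_op V \<kappa> (Jac f (\<lambda>y. g y + a * g' y)) x = deriv_op V \<kappa> (\<lambda>y. Jac f g y + a * Jac f g' y) x"
    by (rule deriv_op_cong[OF _ x]) (simp add: Jac_lincomb_right f g)
  moreover have "Jac f (deriv_op V \<kappa> (\<lambda>y. g y + a * g' y)) x =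
      Jac f (\<lambda>y. deriv_op V \<kappa> g y + a * deriv_op V \<kappa> g' y) x"
    by (rule Jac_cong[OF _ _ x]) (simp_all add: deriv_op_lincomb V g)
  ultimately show ?thesis
    by (simp add: lie_Jac_def deriv_op_lincomb Jac_lincomb_right smooth_fun_Jac smooth_fun_deriv_op V k f g x
        algebra_simps)
qed

lemma lie_Jac_antisym:
  assumes V: "vector_field W V" and k: "smooth_fun W \<kappa>" and f: "smooth_fun W f" and g: "smooth_fun W g"
    and x: "x \<in> W"
  shows "lie_Jac V \<kappa> f g x = - lie_Jac V \<kappa> g f x"
proof -
  have "deriv_op V \<kappa> (Jac f g) x = deriv_op V \<kappa> (\<lambda>y. 0 + (- 1) * Jac g f y) x"
    by (rule deriv_op_cong[OF _ x]) (simp add: Jac_antisym[OF f g])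
  also have "\<dots> = deriv_op V \<kappa> (\<lambda>y. 0) x + (- 1) * deriv_op V \<kappa> (Jac g f) x"
    by (rule deriv_op_lincomb) (simp_all add: V x smooth_fun_Jac f g smooth_fun_const)
  also have "deriv_op V \<kappa> (\<lambda>y. 0) x = 0"
    using dir_deriv_const[OF x, of "V x" "0::real"] V x by (simp add: deriv_op_def vector_field_def)
  finally show ?thesis
    using Jac_antisym[OF f smooth_fun_deriv_op[OF V k g] x] Jac_antisym[OF smooth_fun_deriv_op[OF V k f] g x]
    by (simp add: lie_Jac_def)
qed

text \<open>The Lie derivative of the bracket is a first order operator because the second order part is a
  commutator of vector fields.\<close>

lemma lie_Jac_jet_zero:
  assumes V: "vector_field W V" and k: "smooth_fun W \<kappa>" and f: "smooth_fun W f" and r: "smooth_fun W r"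
    and x: "x \<in> W" and r0: "r x = 0" and dr: "\<And>v. v \<in> tangent_space W x \<Longrightarrow> D r x v = 0"
  shows "lie_Jac V \<kappa> f r x = 0"
proof -
  have Vx: "V x \<in> tangent_space W x" using V x by (simp add: vector_field_def)
  have J0: "Jac h r x = 0" for h by (simp add: Jac_def r0 dr tangent_cfield[OF x])
  have vf: "vector_field W (cfield f)" by (rule vector_field_cfield[OF f])
  have s1: "smooth_fun W (\<lambda>y. D r y (cfield f y))" "smooth_fun W (\<lambda>y. D f y (Rv y))" "smooth_fun W (\<lambda>y. D r y (V y))"
    using smooth_fun_dir_deriv[OF r vf] smooth_fun_dir_deriv[OF f vector_field_frame(1)] smooth_fun_dir_deriv[OF r V] .
  have 1: "D (Jac f r) x (V x) = D (\<lambda>y. D r y (cfield f y)) x (V x)"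
    unfolding Jac_def
    by (simp add: dir_deriv_diff[OF s1(1) smooth_fun_mult[OF r s1(2)] x Vx] dir_deriv_mult[OF r s1(2) x Vx] r0 dr[OF Vx])
  have 2: "D (deriv_op V \<kappa> r) x (cfield f x) = D (\<lambda>y. D r y (V y)) x (cfield f x)"
    unfolding deriv_op_def
    by (simp add: dir_deriv_add[OF s1(3) smooth_fun_mult[OF k r] x tangent_cfield[OF x]]
        dir_deriv_mult[OF k r x tangent_cfield[OF x]] r0 dr[OF tangent_cfield[OF x]])
  have "D (\<lambda>y. D r y (cfield f y)) x (V x) - D (\<lambda>y. D r y (V y)) x (cfield f x) = 0"
    using D_commutator[OF r V vf x] dr D_lie_bracket_tangent[OF V vf x] by simp
  moreover have "Jac f (deriv_op V \<kappa> r) x = D (deriv_op V \<kappa> r) x (cfield f x)"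
    by (simp add: Jac_def deriv_op_def r0 dr[OF Vx])
  ultimately show ?thesis
    using 1 2 by (simp add: lie_Jac_def J0 deriv_op_def[of V \<kappa> "Jac f r"])
qed

end

text \<open>\<open>W\<close> stands for the image of an arbitrary tubular neighborhood of
  \<open>S_ex \<alpha>\<close>; \<open>a\<close> and \<open>b\<close> are the exponents of the
  resonant monomial.\<close>

locale deformation = contact_open +
  fixes \<alpha> :: real and a b :: nat
  assumes \<alpha>_pos: "\<alpha> > 0" and S_subset: "S_ex \<alpha> \<subseteq> W"
    and ab: "a > 0" "b > 0" "real b * \<alpha> = real a"
begin

abbreviation "S \<equiv> S_ex \<alpha>"
abbreviation "F1 \<equiv> QH (wt1 \<alpha>) (1/4)"
abbreviation "F2 \<equiv> QH wt2 (1/2)"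
abbreviation "X1 \<equiv> hv (wt1 \<alpha>) (1/4)"
abbreviation "X2 \<equiv> hv wt2 (1/2)"
abbreviation "f1 \<equiv> QH (wt1 0) 0"
abbreviation "f2 \<equiv> \<lambda>x. Im (res a b x)"

lemma in_W: "x \<in> S \<Longrightarrow> x \<in> W" using S_subset by blast

lemma F_S: "x \<in> S \<Longrightarrow> F1 x = 0" "x \<in> S \<Longrightarrow> F2 x = 0" by (simp_all add: S_ex_iff)

lemma tangent_S:
  assumes "x \<in> S"
  shows "v \<in> tangent_space S x \<longleftrightarrow> v \<in> tangent_space W x \<and> D F1 x v = 0 \<and> D F2 x v = 0"
  using tangent_space_S_ex[OF \<alpha>_pos assms] tangent_W[OF in_W[OF assms]]
    dir_deriv_QH[of v W x "wt1 \<alpha>"] dir_deriv_QH[of v W x wt2] by auto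

lemma X_tangent_S: "x \<in> S \<Longrightarrow> X1 x \<in> tangent_space S x" "x \<in> S \<Longrightarrow> X2 x \<in> tangent_space S x"
  by (simp_all add: tangent_S in_W tangent_hv D_QH_hv)

lemma D_eq_on_S:
  assumes "smooth_fun W r" "smooth_fun W r'" "\<And>y. y \<in> S \<Longrightarrow> r y = (r' y :: real)" "x \<in> S" "v \<in> tangent_space S x"
  shows "D r x v = D r' x v"
proof -
  have "D (\<lambda>y. r y - r' y) x v = 0"
    by (rule dir_deriv_tangent_zero[OF smooth_fun_diff[OF assms(1,2)] S_subset assms(4,5)]) (simp add: assms(3))
  then show ?thesis
    using dir_deriv_diff[OF assms(1,2) in_W[OF assms(4)], of v] assms(5) tangent_S[OF assms(4)] by simp
qed

lemma smooth_F: "smooth_fun W F1" "smooth_fun W F2" "smooth_fun W f1" "smooth_fun W f2"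
  by (simp_all add: smooth_fun_QH smooth_fun_res)

lemma D_f_X:
  assumes "x \<in> W"
  shows "D f1 x (X1 x) = 0" "D f1 x (X2 x) = 0" "D f2 x (X1 x) = 0" "D f2 x (X2 x) = 0"
  using assms ab by (simp_all add: D_QH_hv D_res_hv wt1_def wt2_def)

lemma Jac_f: "x \<in> W \<Longrightarrow> Jac f1 f2 x = real a * Re (res a b x)"
  by (simp add: Jac_QH D_res_hv ab wt1_def)

lemma Jac_F_F: "x \<in> W \<Longrightarrow> Jac F1 F2 x = 0"
  by (simp add: Jac_QH D_QH_hv)

text \<open>Radial fields which, with \<open>e2\<close>, frame the normal bundle dually to
  \<open>dF1\<close>, \<open>dF2\<close>. On \<open>S\<close> the radial derivative of
  \<open>H_(\<alpha>)\<close> is \<open>2 * (1/4) = 1/2\<close>, hence the factor 2; that of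
  \<open>H_3\<close> is \<open>2 * (1/2) = 1\<close>.\<close>

definition e1 :: "ambient \<Rightarrow> ambient" where "e1 x = 2 *\<^sub>R scal (wt1 1) x"
definition e2 :: "ambient \<Rightarrow> ambient" where "e2 x = scal wt2 x"

lemma smooth_fun_e: "smooth_fun B e1" "smooth_fun B e2"
  unfolding e1_def e2_def
  by (intro smooth_fun_scaleR smooth_fun_const smooth_fun_bounded_linear_UNIV bounded_linear_scal)+

lemma e_dual:
  assumes "x \<in> S"
  shows "scal (wt1 \<alpha>) x \<bullet> e1 x = 1" "scal (wt1 \<alpha>) x \<bullet> e2 x = 0"
    "scal wt2 x \<bullet> e1 x = 0" "scal wt2 x \<bullet> e2 x = 1" "circ x \<bullet> e1 x = 0" "circ x \<bullet> e2 x = 0"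
proof -
  have w: "(\<lambda>i. wt1 1 i * wt1 \<alpha> i) = wt1 \<alpha>" "(\<lambda>i. wt2 i * wt2 i) = wt2"
    "(\<lambda>i. wt2 i * wt1 \<alpha> i) = (\<lambda>i. 0)" "(\<lambda>i. wt1 1 i * wt2 i) = (\<lambda>i. 0)"
    by (auto simp: wt1_def wt2_def fun_eq_iff)
  have s: "scal w x \<bullet> scal w' x = scal (\<lambda>i. w' i * w i) x \<bullet> x" for w w'
    by (metis inner_scal inner_commute scal_scal)
  have z: "scal (\<lambda>i. 0) x \<bullet> x = 0" by (simp add: scal_alt inner_prod_def inner_vec_def)
  show "scal (wt1 \<alpha>) x \<bullet> e1 x = 1" "scal (wt1 \<alpha>) x \<bullet> e2 x = 0"
    "scal wt2 x \<bullet> e1 x = 0" "scal wt2 x \<bullet> e2 x = 1"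
    using F_S[OF assms] by (simp_all add: e1_def e2_def s w z QH_def)
  show "circ x \<bullet> e1 x = 0" "circ x \<bullet> e2 x = 0"
    by (simp_all add: e1_def e2_def inner_circ)
qed

lemma tangent_e: "x \<in> S \<Longrightarrow> e1 x \<in> tangent_space W x" "x \<in> S \<Longrightarrow> e2 x \<in> tangent_space W x"
  by (simp_all add: tangent_W in_W e_dual)

lemma D_F_e:
  assumes "x \<in> S"
  shows "D F1 x (e1 x) = 1" "D F1 x (e2 x) = 0" "D F2 x (e1 x) = 0" "D F2 x (e2 x) = 1"
  using assms by (simp_all add: dir_deriv_QH tangent_e e_dual)

lemma tangent_S_part:
  assumes x: "x \<in> S" and v: "v \<in> tangent_space W x"
  shows "v - D F1 x v *\<^sub>R e1 x - D F2 x v *\<^sub>R e2 x \<in> tangent_space S x"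
proof -
  note l = D_linear[OF smooth_F(1) in_W[OF x]] D_linear[OF smooth_F(2) in_W[OF x]]
  show ?thesis
    unfolding tangent_S[OF x] l D_F_e[OF x]
    using x v by (auto intro!: tangent_diff tangent_scaleR tangent_e simp: in_W)
qed

text \<open>Without its components along \<open>e1\<close> and \<open>e2\<close>, the vector
  \<open>v\<close> becomes tangent to \<open>S\<close>, and on such vectors the differential of
  \<open>r\<close> vanishes.\<close>

lemma conormal_expand:
  assumes x: "x \<in> S" and r: "smooth_fun W r" and c: "\<And>v. v \<in> tangent_space S x \<Longrightarrow> D r x v = (0::real)"
    and v: "v \<in> tangent_space W x"
  shows "D r x v = D F1 x v * D r x (e1 x) + D F2 x v * D r x (e2 x)"
  using c[OF tangent_S_part[OF x v]] by (simp add: D_linear[OF r in_W[OF x]])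

text \<open>Modulo \<open>TS\<close> this determines \<open>V\<close> along \<open>S\<close>; it is
  all that the first and second order computations retain of a vertical derivation.\<close>

definition moves :: "(ambient \<Rightarrow> ambient) \<Rightarrow> bool" where
  "moves V \<longleftrightarrow> vector_field W V \<and> (\<forall>x\<in>S. D F1 x (V x) = f1 x \<and> D F2 x (V x) = f2 x)"

lemma deriv_op_F:
  assumes "moves V" "x \<in> S"
  shows "deriv_op V \<kappa> F1 x = f1 x" "deriv_op V \<kappa> F2 x = f2 x"
  using assms by (simp_all add: deriv_op_def moves_def F_S)

text \<open>On \<open>S\<close> the term with \<open>\<kappa>\<close> vanishes together with
  \<open>F1\<close> and \<open>F2\<close>, so there the functions agree with \<open>f1\<close>,
  \<open>f2\<close>; and \<open>X1\<close>, \<open>X2\<close> are tangent to \<open>S\<close> and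
  annihilate \<open>f1\<close>, \<open>f2\<close>.\<close>

lemma D_deriv_op_F_X:
  assumes V: "moves V" and k: "smooth_fun W \<kappa>" and x: "x \<in> S"
  shows "D (deriv_op V \<kappa> F1) x (X1 x) = 0" "D (deriv_op V \<kappa> F1) x (X2 x) = 0"
    "D (deriv_op V \<kappa> F2) x (X1 x) = 0" "D (deriv_op V \<kappa> F2) x (X2 x) = 0"
proof -
  have Vf: "vector_field W V" using V by (simp add: moves_def)
  have "D (deriv_op V \<kappa> F1) x v = D f1 x v" "D (deriv_op V \<kappa> F2) x v = D f2 x v" if "v \<in> tangent_space S x" for v
    by (rule D_eq_on_S; simp add: smooth_fun_deriv_op Vf k smooth_F deriv_op_F V x that)+
  then show "D (deriv_op V \<kappa> F1) x (X1 x) = 0" "D (deriv_op V \<kappa> F1) x (X2 x) = 0"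
    "D (deriv_op V \<kappa> F2) x (X1 x) = 0" "D (deriv_op V \<kappa> F2) x (X2 x) = 0"
    by (simp_all add: X_tangent_S x D_f_X in_W)
qed

text \<open>\<open>F1\<close> and \<open>F2\<close> commute on all of \<open>W\<close>, so the only
  surviving brackets are those of one \<open>F\<close> with the derivation of the other.\<close>

lemma lie_Jac_F_W:
  assumes V: "vector_field W V" and k: "smooth_fun W \<kappa>" and x: "x \<in> W"
  shows "lie_Jac V \<kappa> F1 F2 x = D (deriv_op V \<kappa> F1) x (X2 x) - D (deriv_op V \<kappa> F2) x (X1 x)"
proof -
  have "deriv_op V \<kappa> (Jac F1 F2) x = deriv_op V \<kappa> (\<lambda>y. 0) x"
    by (rule deriv_op_cong[OF _ x]) (simp add: Jac_F_F)
  also have "\<dots> = 0"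
    using dir_deriv_const[OF x, of "V x" "0::real"] V x by (simp add: deriv_op_def vector_field_def)
  finally show ?thesis
    using Jac_antisym[OF smooth_fun_deriv_op[OF V k smooth_F(1)] smooth_F(2) x]
    by (simp add: lie_Jac_def Jac_QH x)
qed

text \<open>The first order condition. The form sees 1-jets only, and at \<open>x\<close> a function
  with conormal jet has the jet of a combination of \<open>F1\<close> and \<open>F2\<close>; on this
  pair the condition is the invariance of \<open>f1\<close>, \<open>f2\<close> along the
  leaves.\<close>

lemma lie_Jac_conormal:
  assumes V: "moves V" and k: "smooth_fun W \<kappa>" and x: "x \<in> S"
    and f: "smooth_fun W f" "f x = 0" "\<And>v. v \<in> tangent_space S x \<Longrightarrow> D f x v = 0"
    and g: "smooth_fun W g" "g x = 0" "\<And>v. v \<in> tangent_space S x \<Longrightarrow> D g x v = 0"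
  shows "lie_Jac V \<kappa> f g x = 0"
proof -
  have Vf: "vector_field W V" using V by (simp add: moves_def)
  note xW = in_W[OF x]
  have red: "lie_Jac V \<kappa> h r x = D r x (e1 x) * lie_Jac V \<kappa> h F1 x + D r x (e2 x) * lie_Jac V \<kappa> h F2 x"
    if h: "smooth_fun W h" and r: "smooth_fun W r" "r x = 0" "\<And>v. v \<in> tangent_space S x \<Longrightarrow> D r x v = 0" for h r
  proof -
    \<comment> \<open>Subtracting the right multiples of \<open>F1\<close> and \<open>F2\<close>
      leaves a function with vanishing 1-jet at \<open>x\<close>.\<close>
    define r1 where "r1 = (\<lambda>y. r y + (- D r x (e1 x)) * F1 y)"
    define r2 where "r2 = (\<lambda>y. r1 y + (- D r x (e2 x)) * F2 y)"
    have s1: "smooth_fun W r1" unfolding r1_def by (intro smooth_fun_lincomb r smooth_F)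
    have s2: "smooth_fun W r2" unfolding r2_def by (intro smooth_fun_lincomb s1 smooth_F)
    have "lie_Jac V \<kappa> h r2 x = 0"
    proof (rule lie_Jac_jet_zero[OF Vf k h s2 xW])
      show "r2 x = 0" by (simp add: r2_def r1_def r(2) F_S[OF x])
      fix v assume v: "v \<in> tangent_space W x"
      show "D r2 x v = 0"
        unfolding r2_def D_lincomb[OF s1 smooth_F(2) xW v]
        unfolding r1_def D_lincomb[OF r(1) smooth_F(1) xW v]
        using conormal_expand[OF x r(1,3) v] by (simp add: mult.commute)
    qed
    moreover have "lie_Jac V \<kappa> h r2 x = lie_Jac V \<kappa> h r1 x + (- D r x (e2 x)) * lie_Jac V \<kappa> h F2 x"
      unfolding r2_def by (rule lie_Jac_lincomb_right[OF Vf k h s1 smooth_F(2) xW])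
    moreover have "lie_Jac V \<kappa> h r1 x = lie_Jac V \<kappa> h r x + (- D r x (e1 x)) * lie_Jac V \<kappa> h F1 x"
      unfolding r1_def by (rule lie_Jac_lincomb_right[OF Vf k h r(1) smooth_F(1) xW])
    ultimately show ?thesis by simp
  qed
  have 12: "lie_Jac V \<kappa> F1 F2 x = 0"
    by (simp add: lie_Jac_F_W[OF Vf k xW] D_deriv_op_F_X[OF V k x])
  have 21: "lie_Jac V \<kappa> F2 F1 x = 0"
    using lie_Jac_antisym[OF Vf k smooth_F(1,2) xW] 12 by simp
  have d: "lie_Jac V \<kappa> h h x = 0" if "smooth_fun W h" for h
    using lie_Jac_antisym[OF Vf k that that xW] by simp
  have "lie_Jac V \<kappa> F1 f x = 0" "lie_Jac V \<kappa> F2 f x = 0"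
    using red[OF smooth_F(1) f] red[OF smooth_F(2) f] 12 21 d[OF smooth_F(1)] d[OF smooth_F(2)] by simp_all
  then have "lie_Jac V \<kappa> f F1 x = 0" "lie_Jac V \<kappa> f F2 x = 0"
    using lie_Jac_antisym[OF Vf k f(1) _ xW] smooth_F by simp_all
  then show ?thesis using red[OF f(1) g] by simp
qed

text \<open>The commutators of \<open>V\<close> with \<open>X\<^sub>1\<close>, \<open>X\<^sub>2\<close> are tangent to \<open>S\<close>, so they do not see the difference
  \<open>p - f\<close>, which vanishes on \<open>S\<close>.\<close>

lemma D_swap:
  assumes V: "moves V" and Z: "Z = X1 \<or> Z = X2" and x: "x \<in> S"
    and p: "smooth_fun W p" and f: "smooth_fun W f" and pf: "\<And>y. y \<in> S \<Longrightarrow> p y = (f y :: real)"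
    and fZ: "\<And>y. y \<in> W \<Longrightarrow> D f y (Z y) = 0"
  shows "D (\<lambda>y. D p y (Z y)) x (V x) = D (\<lambda>y. D p y (V y) - D f y (V y)) x (Z x)"
proof -
  note xW = in_W[OF x]
  have Vf: "vector_field W V" using V by (simp add: moves_def)
  have Zf: "vector_field W Z" using Z vector_field_hv by auto
  have Vx: "V x \<in> tangent_space W x" using Vf xW by (simp add: vector_field_def)
  have Zx: "Z x \<in> tangent_space S x" using Z X_tangent_S[OF x] by auto
  \<comment> \<open>In \<open>[V, Z] F = V (Z F) - Z (V F)\<close> the first term is zero as
    \<open>Z F = 0\<close> on \<open>W\<close>, the second because \<open>V F\<close> agrees on
    \<open>S\<close> with a function that \<open>Z\<close> annihilates at \<open>x\<close>.\<close>
  have F0: "D F x (lie_bracket W V Z x) = 0"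
    if "smooth_fun W F" "\<And>y. y \<in> W \<Longrightarrow> D F y (Z y) = 0" "smooth_fun W h" "\<And>y. y \<in> S \<Longrightarrow> D F y (V y) = h y"
      "D h x (Z x) = 0" for F h :: "ambient \<Rightarrow> real"
  proof -
    have "D (\<lambda>y. D F y (Z y)) x = D (\<lambda>y. 0) x"
      by (rule dir_deriv_cong[OF _ xW]) (simp add: that(2))
    moreover have "D (\<lambda>y. D F y (V y)) x (Z x) = D h x (Z x)"
      by (rule D_eq_on_S[OF smooth_fun_dir_deriv[OF that(1) Vf] that(3) that(4) x Zx])
    ultimately show ?thesis
      using D_commutator[OF that(1) Vf Zf xW] dir_deriv_const[OF xW Vx, of "0::real"] that(5) by simp
  qed
  have FZ: "D F1 y (Z y) = 0" "D F2 y (Z y) = 0" "D f1 y (Z y) = 0" "D f2 y (Z y) = 0" if "y \<in> W" for y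
    using Z D_f_X[OF that] D_QH_hv[OF that] by auto
  have "D F1 x (lie_bracket W V Z x) = 0"
    by (rule F0[OF smooth_F(1) FZ(1) smooth_F(3) _ FZ(3)[OF xW]]) (use V in \<open>auto simp: moves_def\<close>)
  moreover have "D F2 x (lie_bracket W V Z x) = 0"
    by (rule F0[OF smooth_F(2) FZ(2) smooth_F(4) _ FZ(4)[OF xW]]) (use V in \<open>auto simp: moves_def\<close>)
  ultimately have b: "lie_bracket W V Z x \<in> tangent_space S x"
    using D_lie_bracket_tangent[OF Vf Zf xW] by (simp add: tangent_S[OF x])
  let ?r = "\<lambda>y. p y - f y"
  have r: "smooth_fun W ?r" by (rule smooth_fun_diff[OF p f])
  have "D ?r x (lie_bracket W V Z x) = 0"
    by (rule dir_deriv_tangent_zero[OF r S_subset x b]) (simp add: pf)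
  then have "D (\<lambda>y. D ?r y (Z y)) x (V x) = D (\<lambda>y. D ?r y (V y)) x (Z x)"
    using D_commutator[OF r Vf Zf xW] by simp
  moreover have "D ?r y (U y) = D p y (U y) - D f y (U y)" if "y \<in> W" "vector_field W U" for y U
    using dir_deriv_diff[OF p f that(1), of "U y"] that by (simp add: vector_field_def)
  then have "D (\<lambda>y. D ?r y (Z y)) x = D (\<lambda>y. D p y (Z y)) x"
    "D (\<lambda>y. D ?r y (V y)) x = D (\<lambda>y. D p y (V y) - D f y (V y)) x"
    by (auto intro!: dir_deriv_cong[OF _ xW] simp: Zf Vf fZ)
  ultimately show ?thesis by simp
qed

text \<open>By antisymmetry, invariance of \<open>g\<close> in the two leaf directions at
  \<open>x\<close> says that \<open>X_g\<close> annihilates \<open>F1\<close> and \<open>F2\<close>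
  there, so it is tangent to \<open>S\<close>, where \<open>r\<close> is zero.\<close>

lemma Jac_vanish_on_S:
  assumes g: "smooth_fun W g" and gX: "D g x (X1 x) = 0" "D g x (X2 x) = 0"
    and r: "smooth_fun W r" "\<And>y. y \<in> S \<Longrightarrow> r y = 0" and x: "x \<in> S"
  shows "Jac g r x = 0"
proof -
  note xW = in_W[OF x]
  have "Jac g F1 x = 0" "Jac g F2 x = 0"
    using Jac_antisym[OF g smooth_F(1) xW] Jac_antisym[OF g smooth_F(2) xW] gX by (simp_all add: Jac_QH xW)
  then have "cfield g x \<in> tangent_space S x"
    by (simp add: tangent_S[OF x] tangent_cfield[OF xW] Jac_def F_S[OF x])
  then show ?thesis
    using dir_deriv_tangent_zero[OF r(1) S_subset x _ r(2)] r(2)[OF x] by (simp add: Jac_def)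
qed

text \<open>The bracket descends to leafwise constant functions on \<open>S\<close>; this is what
  identifies the cross term of the second order equation. One argument is exchanged at a time, with
  an invariant function in the other slot.\<close>

lemma Jac_eq_on_S:
  assumes g: "smooth_fun W g" "smooth_fun W g'" and f: "smooth_fun W f" "smooth_fun W f'"
    and gX: "D g x (X1 x) = 0" "D g x (X2 x) = 0" and fX: "D f' x (X1 x) = 0" "D f' x (X2 x) = 0"
    and eq: "\<And>y. y \<in> S \<Longrightarrow> g y = g' y" "\<And>y. y \<in> S \<Longrightarrow> f y = f' y" and x: "x \<in> S"
  shows "Jac g f x = Jac g' f' x"
proof -
  note xW = in_W[OF x]
  have "Jac g (\<lambda>y. f y + (- 1) * f' y) x = 0"
    by (rule Jac_vanish_on_S[OF g(1) gX smooth_fun_lincomb[OF f] _ x]) (simp add: eq)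
  moreover have "Jac f' (\<lambda>y. g y + (- 1) * g' y) x = 0"
    by (rule Jac_vanish_on_S[OF f(2) fX smooth_fun_lincomb[OF g] _ x]) (simp add: eq)
  ultimately have "Jac g f x = Jac g f' x" "Jac f' g x = Jac f' g' x"
    using Jac_lincomb_right[OF g(1) f xW, of "- 1"] Jac_lincomb_right[OF f(2) g xW, of "- 1"] by simp_all
  then show ?thesis
    using Jac_antisym[OF f(2) g(1) xW] Jac_antisym[OF f(2) g(2) xW] by simp
qed

definition lie2_Jac :: "(ambient \<Rightarrow> ambient) \<Rightarrow> (ambient \<Rightarrow> real) \<Rightarrow> (ambient \<Rightarrow> real) \<Rightarrow> (ambient \<Rightarrow> real) \<Rightarrow> ambient \<Rightarrow> real" where
  "lie2_Jac V \<kappa> f g y = deriv_op V \<kappa> (lie_Jac V \<kappa> f g) y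
     - lie_Jac V \<kappa> (deriv_op V \<kappa> f) g y - lie_Jac V \<kappa> f (deriv_op V \<kappa> g) y"

text \<open>The second order condition says that \<open>{f\<^sub>1, f\<^sub>2}\<close> is exact along the characteristic foliation.\<close>

lemma second_order_exact:
  assumes V: "moves V" and k: "smooth_fun W \<kappa>" and V': "vector_field W V'" "smooth_fun W \<kappa>'"
    and eq: "\<And>x. x \<in> S \<Longrightarrow> lie_Jac V' \<kappa>' F1 F2 x + lie2_Jac V \<kappa> F1 F2 x / 2 = 0"
  shows "\<exists>G1 G2. smooth_fun W G1 \<and> smooth_fun W G2 \<and>
    (\<forall>x\<in>S. real a * Re (res a b x) = D G2 x (X1 x) - D G1 x (X2 x))"
proof -
  have Vf: "vector_field W V" using V by (simp add: moves_def)
  let ?d = "deriv_op V \<kappa>"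
  define p1 p2 where "p1 = ?d F1" and "p2 = ?d F2"
  define q1 q2 where "q1 = ?d p1" and "q2 = ?d p2"
  \<comment> \<open>By \<open>D_swap\<close>, on \<open>S\<close> the derivatives of
    \<open>u1\<close> along \<open>X2\<close> and of \<open>u2\<close> along \<open>X1\<close> are
    \<open>V (X2 p1)\<close> and \<open>V (X1 p2)\<close>.\<close>
  define u1 u2 where "u1 = (\<lambda>y. D p1 y (V y) - D f1 y (V y))" and "u2 = (\<lambda>y. D p2 y (V y) - D f2 y (V y))"
  define k1 k2 where "k1 = deriv_op V' \<kappa>' F1" and "k2 = deriv_op V' \<kappa>' F2"
  \<comment> \<open>Collects the three kinds of leafwise derivatives: \<open>u1\<close> from the
    mixed terms, \<open>q1\<close> from applying the derivation twice to \<open>F1\<close>, with the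
    1/2 of the exponential series, and \<open>k1\<close> from the section of order two.\<close>
  define G1 where "G1 = (\<lambda>y. (u1 y + (- 1/2) * q1 y) + 1 * k1 y)"
  define G2 where "G2 = (\<lambda>y. (u2 y + (- 1/2) * q2 y) + 1 * k2 y)"
  have sp: "smooth_fun W p1" "smooth_fun W p2"
    unfolding p1_def p2_def by (simp_all add: smooth_fun_deriv_op Vf k smooth_F)
  have sq: "smooth_fun W q1" "smooth_fun W q2"
    unfolding q1_def q2_def by (simp_all add: smooth_fun_deriv_op Vf k sp)
  have su: "smooth_fun W u1" "smooth_fun W u2"
    unfolding u1_def u2_def
    by (simp_all add: smooth_fun_diff smooth_fun_dir_deriv Vf sp smooth_F)
  have sk: "smooth_fun W k1" "smooth_fun W k2"
    unfolding k1_def k2_def by (simp_all add: smooth_fun_deriv_op V' smooth_F)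
  have sG: "smooth_fun W G1" "smooth_fun W G2"
    unfolding G1_def G2_def by (intro smooth_fun_lincomb su sq sk)+
  have sX: "smooth_fun W (\<lambda>y. D p1 y (X2 y))" "smooth_fun W (\<lambda>y. D p2 y (X1 y))"
    by (intro smooth_fun_dir_deriv sp vector_field_hv)+
  have pS: "p1 y = f1 y" "p2 y = f2 y" if "y \<in> S" for y
    unfolding p1_def p2_def by (simp_all add: deriv_op_F[OF V that])
  have pX: "D p1 x (X1 x) = 0" "D p1 x (X2 x) = 0" "D p2 x (X1 x) = 0" "D p2 x (X2 x) = 0" if "x \<in> S" for x
    unfolding p1_def p2_def by (simp_all add: D_deriv_op_F_X[OF V k that])
  have "real a * Re (res a b x) = D G2 x (X1 x) - D G1 x (X2 x)" if x: "x \<in> S" for x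
  proof -
    note xW = in_W[OF x]
    have Vx: "V x \<in> tangent_space W x" using Vf xW by (simp add: vector_field_def)
    have s1: "D (\<lambda>y. D p1 y (X2 y)) x (V x) = D u1 x (X2 x)"
      unfolding u1_def by (rule D_swap[OF V _ x sp(1) smooth_F(3) pS(1)]) (simp_all add: D_f_X)
    have s2: "D (\<lambda>y. D p2 y (X1 y)) x (V x) = D u2 x (X1 x)"
      unfolding u2_def by (rule D_swap[OF V _ x sp(2) smooth_F(4) pS(2)]) (simp_all add: D_f_X)
    have d1: "?d (\<lambda>y. D p1 y (X2 y)) x = D u1 x (X2 x)" and d2: "?d (\<lambda>y. D p2 y (X1 y)) x = D u2 x (X1 x)"
      by (simp_all add: deriv_op_def s1 s2 pX[OF x])
    \<comment> \<open>The factor \<open>- 2\<close> writes the negative as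
      \<open>g + (- 2) * g\<close>, a linear combination.\<close>
    have dneg: "?d (\<lambda>y. - D p1 y (X2 y)) x = - D u1 x (X2 x)"
      using deriv_op_lincomb[OF Vf sX(1) sX(1) xW, of \<kappa> "- 2"] d1 by simp
    have JK: "Jac p1 p2 x = real a * Re (res a b x)"
      using Jac_eq_on_S[OF sp(1) smooth_F(3) sp(2) smooth_F(4) _ _ _ _ pS x] pX[OF x] D_f_X[OF xW] Jac_f[OF xW]
      by simp
    have A: "?d (lie_Jac V \<kappa> F1 F2) x = D u1 x (X2 x) - D u2 x (X1 x)"
    proof -
      have "?d (lie_Jac V \<kappa> F1 F2) x = ?d (\<lambda>y. D p1 y (X2 y) + (- 1) * D p2 y (X1 y)) x"
        by (rule deriv_op_cong[OF _ xW]) (simp add: lie_Jac_F_W[OF Vf k] p1_def p2_def)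
      also have "\<dots> = D u1 x (X2 x) - D u2 x (X1 x)"
        using deriv_op_lincomb[OF Vf sX xW, of \<kappa> "- 1"] d1 d2 by simp
      finally show ?thesis .
    qed
    \<comment> \<open>The cross term \<open>{p1, p2}\<close> occurs once in each of the two
      remaining terms of the second Lie derivative, hence with coefficient 1 after division by
      2.\<close>
    have "?d (Jac p1 F2) x = ?d (\<lambda>y. - D p1 y (X2 y)) x"
      by (rule deriv_op_cong[OF _ xW]) (simp add: Jac_antisym[OF sp(1) smooth_F(2)] Jac_QH)
    then have B: "lie_Jac V \<kappa> p1 F2 x = - D u1 x (X2 x) + D q1 x (X2 x) - real a * Re (res a b x)"
      using Jac_antisym[OF sq(1) smooth_F(2) xW]
      by (simp add: lie_Jac_def q1_def[symmetric] p2_def[symmetric] JK dneg Jac_QH xW)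
    have "?d (Jac F1 p2) x = ?d (\<lambda>y. D p2 y (X1 y)) x"
      by (rule deriv_op_cong[OF _ xW]) (simp add: Jac_QH)
    then have C: "lie_Jac V \<kappa> F1 p2 x = D u2 x (X1 x) - real a * Re (res a b x) - D q2 x (X1 x)"
      by (simp add: lie_Jac_def q2_def[symmetric] p1_def[symmetric] JK d2 Jac_QH xW)
    have E: "lie_Jac V' \<kappa>' F1 F2 x = D k1 x (X2 x) - D k2 x (X1 x)"
      by (simp add: lie_Jac_F_W[OF V' xW] k1_def k2_def)
    have 1: "D G1 x (X2 x) = D u1 x (X2 x) + (- 1/2) * D q1 x (X2 x) + D k1 x (X2 x)"
      unfolding G1_def D_lincomb[OF smooth_fun_lincomb[OF su(1) sq(1)] sk(1) xW tangent_hv[OF xW]]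
        D_lincomb[OF su(1) sq(1) xW tangent_hv[OF xW]] by simp
    have 2: "D G2 x (X1 x) = D u2 x (X1 x) + (- 1/2) * D q2 x (X1 x) + D k2 x (X1 x)"
      unfolding G2_def D_lincomb[OF smooth_fun_lincomb[OF su(2) sq(2)] sk(2) xW tangent_hv[OF xW]]
        D_lincomb[OF su(2) sq(2) xW tangent_hv[OF xW]] by simp
    have "lie_Jac V' \<kappa>' F1 F2 x + (?d (lie_Jac V \<kappa> F1 F2) x - lie_Jac V \<kappa> p1 F2 x - lie_Jac V \<kappa> F1 p2 x) / 2 = 0"
      using eq[OF x] by (simp add: lie2_Jac_def p1_def p2_def)
    then show ?thesis unfolding A B C E 1 2 by (simp add: field_simps)
  qed
  then show ?thesis using sG by blast
qed

end

section \<open>A two-parameter flow along a leaf\<close>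

text \<open>Polar coordinates in the three planes. The angle is shifted by
  \<open>sum_i q^i p_i / 2\<close> because on the zero level of \<open>QH w c\<close> the field
  \<open>hv w c\<close> lowers the angle minus this sum at the constant rate \<open>c\<close>; all
  parameters then move linearly.\<close>

definition torus_pt :: "(3 \<Rightarrow> real) \<Rightarrow> (3 \<Rightarrow> real) \<Rightarrow> real \<Rightarrow> ambient" where
  "torus_pt rad \<theta> \<phi> = (\<chi> i. rad i * cos (\<theta> i), \<chi> i. rad i * sin (\<theta> i),
     cis (\<phi> + (\<Sum>i\<in>UNIV. (rad i)\<^sup>2 * cos (\<theta> i) * sin (\<theta> i)) / 2))"

lemma QH_torus_pt: "QH w c (torus_pt rad \<theta> \<phi>) = (\<Sum>i\<in>UNIV. w i * (rad i)\<^sup>2) / 2 - c"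
proof -
  have "(rad i * cos (\<theta> i))\<^sup>2 + (rad i * sin (\<theta> i))\<^sup>2 = (rad i)\<^sup>2" for i
    by (simp add: power_mult_distrib distrib_left[symmetric])
  then show ?thesis by (simp add: torus_pt_def QH_eq)
qed

lemma torus_pt_in_M_ex: "torus_pt rad \<theta> \<phi> \<in> M_ex"
  by (simp add: torus_pt_def M_ex_def)

lemma has_vector_derivative_vec_lambda:
  fixes f :: "real \<Rightarrow> 'n::finite \<Rightarrow> real"
  assumes "\<And>i. ((\<lambda>t. f t i) has_real_derivative f' i) (at t within T)"
  shows "((\<lambda>t. \<chi> i. f t i) has_vector_derivative (\<chi> i. f' i)) (at t within T)"
proof -
  have "((\<lambda>t. \<Sum>i\<in>UNIV. f t i *\<^sub>R axis i (1::real)) has_vector_derivative (\<Sum>i\<in>UNIV. f' i *\<^sub>R axis i 1)) (at t within T)"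
    using assms
    by (intro has_vector_derivative_sum) (auto intro!: derivative_eq_intros)
  moreover have "(\<Sum>i\<in>UNIV. u i *\<^sub>R axis i (1::real)) = (\<chi> i. u i)" for u :: "'n \<Rightarrow> real"
    by (simp add: vec_eq_iff axis_def if_distrib[of "(*) _"] sum.delta cong: if_cong)
  ultimately show ?thesis by simp
qed

lemma has_vector_derivative_cis:
  assumes "(g has_real_derivative g') (at t within T)"
  shows "((\<lambda>t. cis (g t)) has_vector_derivative g' *\<^sub>R (\<i> * cis (g t))) (at t within T)"
proof -
  have "((\<lambda>t. complex_of_real (cos (g t)) + \<i> * complex_of_real (sin (g t))) has_vector_derivative
      complex_of_real (- sin (g t) * g') + \<i> * complex_of_real (cos (g t) * g')) (at t within T)"
    using assms
    by (intro has_vector_derivative_add has_vector_derivative_of_real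
        bounded_linear.has_vector_derivative[OF bounded_linear_mult_right]
        has_real_derivative_iff_has_vector_derivative[THEN iffD1])
      (auto intro!: derivative_eq_intros)
  moreover have "complex_of_real (cos u) + \<i> * complex_of_real (sin u) = cis u" for u
    by (simp add: complex_eq_iff)
  moreover have "complex_of_real (- sin (g t) * g') + \<i> * complex_of_real (cos (g t) * g') = g' *\<^sub>R (\<i> * cis (g t))"
    by (simp add: complex_eq_iff)
  ultimately show ?thesis by simp
qed

lemma torus_pt_flow:
  assumes "(\<Sum>i\<in>UNIV. w i * (rad i)\<^sup>2) / 2 = c"
  shows "((\<lambda>u. torus_pt rad (\<lambda>i. \<theta> i + u * w i) (\<phi> - u * c)) has_vector_derivative
    hv w c (torus_pt rad (\<lambda>i. \<theta> i + u * w i) (\<phi> - u * c))) (at u within T)"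
proof -
  let ?a = "\<lambda>u i. \<theta> i + u * w i"
  let ?g = "\<lambda>u. \<phi> - u * c + (\<Sum>i\<in>UNIV. (rad i)\<^sup>2 * cos (?a u i) * sin (?a u i)) / 2"
  define g' where "g' = - c + (\<Sum>i\<in>UNIV. (rad i)\<^sup>2 * ((cos (?a u i))\<^sup>2 - (sin (?a u i))\<^sup>2) * w i) / 2"
  have q: "((\<lambda>u. \<chi> i. rad i * cos (?a u i)) has_vector_derivative (\<chi> i. - w i * (rad i * sin (?a u i)))) (at u within T)"
    by (rule has_vector_derivative_vec_lambda) (auto intro!: derivative_eq_intros)
  have p: "((\<lambda>u. \<chi> i. rad i * sin (?a u i)) has_vector_derivative (\<chi> i. w i * (rad i * cos (?a u i)))) (at u within T)"
    by (rule has_vector_derivative_vec_lambda) (auto intro!: derivative_eq_intros)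
  have "((\<lambda>u. \<Sum>i\<in>UNIV. (rad i)\<^sup>2 * cos (?a u i) * sin (?a u i)) has_real_derivative
     (\<Sum>i\<in>UNIV. (rad i)\<^sup>2 * ((cos (?a u i))\<^sup>2 - (sin (?a u i))\<^sup>2) * w i)) (at u within T)"
    by (rule DERIV_sum) (auto intro!: derivative_eq_intros simp: power2_eq_square algebra_simps)
  moreover have "((\<lambda>u. \<phi> - u * c + N u / 2) has_real_derivative - c + N' / 2) (at u within T)"
    if "(N has_real_derivative N') (at u within T)" for N N'
    using that by (auto intro!: derivative_eq_intros)
  ultimately have "(?g has_real_derivative g') (at u within T)"
    unfolding g'_def by blast
  then have z: "((\<lambda>u. cis (?g u)) has_vector_derivative g' *\<^sub>R (\<i> * cis (?g u))) (at u within T)"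
    by (rule has_vector_derivative_cis)
  have "((rad i)\<^sup>2 * ((cos (?a u i))\<^sup>2 - (sin (?a u i))\<^sup>2) * w i) = w i * (rad i)\<^sup>2 - 2 * (w i * (rad i * sin (?a u i))\<^sup>2)" for i
    by (simp add: cos_squared_eq power_mult_distrib algebra_simps)
  then have "(\<Sum>i\<in>UNIV. (rad i)\<^sup>2 * ((cos (?a u i))\<^sup>2 - (sin (?a u i))\<^sup>2) * w i) =
      2 * c - 2 * (\<Sum>i\<in>UNIV. w i * (rad i * sin (?a u i))\<^sup>2)"
    using assms by (simp add: sum_subtractf sum_distrib_left)
  then have g': "g' = - (\<Sum>i\<in>UNIV. w i * (rad i * sin (?a u i))\<^sup>2)" by (simp add: g'_def diff_divide_distrib)
  have Q0: "QH w c (torus_pt rad (?a u) (\<phi> - u * c)) = 0" using assms by (simp add: QH_torus_pt)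
  have "hv w c (torus_pt rad (?a u) (\<phi> - u * c)) =
    (\<chi> i. - w i * (rad i * sin (?a u i)), \<chi> i. w i * (rad i * cos (?a u i)), g' *\<^sub>R (\<i> * cis (?g u)))"
    unfolding hv_def Q0 by (simp add: torus_pt_def g')
  moreover have "((\<lambda>u. torus_pt rad (?a u) (\<phi> - u * c)) has_vector_derivative
    (\<chi> i. - w i * (rad i * sin (?a u i)), \<chi> i. w i * (rad i * cos (?a u i)), g' *\<^sub>R (\<i> * cis (?g u)))) (at u within T)"
    unfolding torus_pt_def by (intro has_vector_derivative_Pair q p z)
  ultimately show ?thesis by simp
qed

text \<open>The phases \<open>a * \<theta> 1\<close> and \<open>b * \<theta> 2\<close> cancel, so
  along such points the monomial is a real constant.\<close>

lemma res_torus_pt: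
  assumes "real b * \<alpha> = real a" "\<theta> 2 = \<alpha> * \<theta> 1" "rad 1 = c" "rad 2 = c"
  shows "res a b (torus_pt rad \<theta> \<phi>) = of_real (c ^ (a + b))"
proof -
  have z: "zc i (torus_pt rad \<theta> \<phi>) = of_real (rad i) * cis (\<theta> i)" for i
    by (simp add: zc_def torus_pt_def complex_eq_iff)
  have "res a b (torus_pt rad \<theta> \<phi>) =
      of_real c ^ a * cis (\<theta> 1) ^ a * (of_real c ^ b * cis (- (\<alpha> * \<theta> 1)) ^ b)"
    by (simp add: res_def z assms(2-4) power_mult_distrib cis_cnj)
  also have "\<dots> = of_real (c ^ (a + b)) * (cis (\<theta> 1) ^ a * cis (- (\<alpha> * \<theta> 1)) ^ b)"
    by (simp add: power_add)
  also have "cis (\<theta> 1) ^ a * cis (- (\<alpha> * \<theta> 1)) ^ b = cis (real a * \<theta> 1 + real b * (- (\<alpha> * \<theta> 1)))"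
    by (simp only: Complex.DeMoivre cis_mult)
  also have "real a * \<theta> 1 + real b * (- (\<alpha> * \<theta> 1)) = 0"
    using assms(1) by (metis add.right_inverse mult.assoc mult_minus_right)
  finally show ?thesis by simp
qed

lemma norm_torus_pt: "norm (torus_pt rad \<theta> \<phi>) \<le> 2 * (\<Sum>i\<in>UNIV. \<bar>rad i\<bar>) + 1"
proof -
  have n: "norm (\<chi> i. rad i * u i) \<le> (\<Sum>i\<in>UNIV. \<bar>rad i\<bar>)" if "\<And>i. \<bar>u i\<bar> \<le> 1" for u :: "3 \<Rightarrow> real"
  proof -
    have "norm (\<chi> i. rad i * u i) \<le> (\<Sum>i\<in>UNIV. \<bar>rad i * u i\<bar>)"
      using norm_le_l1_cart[of "\<chi> i. rad i * u i"] by simp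
    also have "\<dots> \<le> (\<Sum>i\<in>UNIV. \<bar>rad i\<bar>)"
      using that by (intro sum_mono) (simp add: abs_mult mult_left_le)
    finally show ?thesis .
  qed
  have "norm (torus_pt rad \<theta> \<phi>) \<le> norm (\<chi> i. rad i * cos (\<theta> i)) + (norm (\<chi> i. rad i * sin (\<theta> i)) + 1)"
    unfolding torus_pt_def by (rule order_trans[OF norm_Pair_le add_mono[OF order_refl]]) (rule order_trans[OF norm_Pair_le], simp)
  also have "\<dots> \<le> 2 * (\<Sum>i\<in>UNIV. \<bar>rad i\<bar>) + 1"
    using n[of "\<lambda>i. cos (\<theta> i)"] n[of "\<lambda>i. sin (\<theta> i)"] by simp
  finally show ?thesis .
qed

text \<open>Integrating over a square of side \<open>T\<close>, the left side grows like \<open>T\<^sup>2\<close> but the right side only like \<open>T\<close>.\<close>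

lemma bounded_cocycle_zero:
  fixes g1 g2 h k :: "real \<Rightarrow> real \<Rightarrow> real"
  assumes ds: "\<And>s t. ((\<lambda>s. g2 s t) has_real_derivative h s t) (at s)"
    and dt: "\<And>s t. ((\<lambda>t. g1 s t) has_real_derivative k s t) (at t)"
    and ch: "continuous_on UNIV (\<lambda>(s, t). h s t)" and ck: "continuous_on UNIV (\<lambda>(s, t). k s t)"
    and bd: "\<And>s t. \<bar>g1 s t\<bar> \<le> B" "\<And>s t. \<bar>g2 s t\<bar> \<le> B"
    and eq: "\<And>s t. h s t - k s t = K"
  shows "K = 0"
proof (rule ccontr)
  assume K: "K \<noteq> 0"
  have B: "B \<ge> 0" using bd(1)[of 0 0] by linarith
  have est: "\<bar>K\<bar> * T * T \<le> 4 * B * T" if T: "T > 0" for T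
  proof -
    have ik: "integral {0..T} (k s) = g1 s T - g1 s 0" for s
      by (rule integral_unique[OF fundamental_theorem_of_calculus])
        (use T dt in \<open>auto simp: has_real_derivative_iff_has_vector_derivative[symmetric]
          intro: has_field_derivative_at_within\<close>)
    have ih: "integral {0..T} (\<lambda>s. h s t) = g2 T t - g2 0 t" for t
      by (rule integral_unique[OF fundamental_theorem_of_calculus])
        (use T ds in \<open>auto simp: has_real_derivative_iff_has_vector_derivative[symmetric]
          intro: has_field_derivative_at_within\<close>)
    have ch': "continuous_on (cbox (0, 0) (T, T)) (\<lambda>(s, t). h s t)"
      using continuous_on_subset[OF ch] by blast
    have cP: "continuous_on {0..T} (\<lambda>t. (s, t))" for s :: real
      by (rule continuous_on_Pair[OF continuous_on_const continuous_on_id])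
    have hc: "continuous_on {0..T} (\<lambda>t. h s t)" "continuous_on {0..T} (\<lambda>t. k s t)" for s
      using continuous_on_compose2[OF ch cP[of s]] continuous_on_compose2[OF ck cP[of s]] by simp_all
    have kh: "k s t = h s t - K" for s t using eq[of s t] by simp
    have ihs: "integral {0..T} (h s) = (g1 s T - g1 s 0) + K * T" for s
    proof -
      have "integral {0..T} (h s) = integral {0..T} (\<lambda>t. k s t + K)"
        by (simp add: kh)
      also have "\<dots> = integral {0..T} (k s) + integral {0..T} (\<lambda>t. K)"
        using hc by (intro integral_add integrable_continuous_real) (auto intro: continuous_intros)
      finally show ?thesis using T by (simp add: ik mult.commute)
    qed
    have sw: "integral {0..T} (\<lambda>s. integral {0..T} (h s)) = integral {0..T} (\<lambda>t. integral {0..T} (\<lambda>s. h s t))"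
      using integral_swap_continuous[of 0 0 T T h] ch' by (simp add: cbox_interval)
    have g1c: "continuous_on {0..T} (\<lambda>s. integral {0..T} (h s))"
    proof -
      have "continuous_on {0..T} (\<lambda>s. integral (cbox 0 T) (h s))"
        using ch by (intro integral_continuous_on_param) (auto intro: continuous_on_subset)
      then show ?thesis by (simp add: cbox_interval)
    qed
    \<comment> \<open>Only differentiability in \<open>t\<close> is available for \<open>g1\<close>;
      integrability in \<open>s\<close> is inherited from the inner integral, which differs from
      this function by a constant.\<close>
    have g1i: "(\<lambda>s. g1 s T - g1 s 0) integrable_on {0..T}"
    proof -
      have "continuous_on {0..T} (\<lambda>s. integral {0..T} (h s) - K * T)" by (intro continuous_intros g1c)
      then show ?thesis by (intro integrable_continuous_real) (simp add: ihs)
    qed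
    have "integral {0..T} (\<lambda>s. integral {0..T} (h s)) = integral {0..T} (\<lambda>s. g1 s T - g1 s 0) + K * T * T"
      unfolding ihs using T g1i by (subst integral_add) (auto simp: mult.commute)
    then have "K * T * T = integral {0..T} (\<lambda>t. g2 T t - g2 0 t) - integral {0..T} (\<lambda>s. g1 s T - g1 s 0)"
      using sw by (simp add: ih)
    moreover have "\<bar>integral {0..T} (\<lambda>s. g1 s T - g1 s 0)\<bar> \<le> 2 * B * T"
    proof -
      have "norm (integral {0..T} (\<lambda>s. g1 s T - g1 s 0)) \<le> integral {0..T} (\<lambda>s. 2 * B)"
      proof (rule integral_norm_bound_integral[OF g1i])
        fix s show "norm (g1 s T - g1 s 0) \<le> 2 * B" using bd(1)[of s T] bd(1)[of s 0] by simp
      qed auto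
      then show ?thesis using T by (simp add: mult_ac)
    qed
    moreover have "\<bar>integral {0..T} (\<lambda>t. g2 T t - g2 0 t)\<bar> \<le> 2 * B * T"
    proof -
      have g2i: "(\<lambda>t. g2 T t - g2 0 t) integrable_on {0..T}"
      proof -
        have "continuous_on UNIV (\<lambda>(t, s). h s t)"
          using continuous_on_compose2[OF ch, of UNIV "\<lambda>p. (snd p, fst p)"]
            continuous_on_Pair[OF continuous_on_snd[OF continuous_on_id] continuous_on_fst[OF continuous_on_id], of UNIV]
          by (simp add: case_prod_beta)
        then have "continuous_on {0..T} (\<lambda>t. integral (cbox 0 T) (\<lambda>s. h s t))"
          by (intro integral_continuous_on_param) (auto intro: continuous_on_subset)
        then show ?thesis by (intro integrable_continuous_real) (simp add: cbox_interval ih)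
      qed
      have "norm (integral {0..T} (\<lambda>t. g2 T t - g2 0 t)) \<le> integral {0..T} (\<lambda>s. 2 * B)"
      proof (rule integral_norm_bound_integral[OF g2i])
        fix t show "norm (g2 T t - g2 0 t) \<le> 2 * B" using bd(2)[of T t] bd(2)[of 0 t] by simp
      qed auto
      then show ?thesis using T by (simp add: mult_ac)
    qed
    ultimately have "\<bar>K * T * T\<bar> \<le> 4 * B * T" by linarith
    then show ?thesis using T by (simp add: abs_mult)
  qed
  \<comment> \<open>Any side longer than \<open>4 * B / \<bar>K\<bar>\<close> contradicts the
    estimate.\<close>
  define T where "T = (4 * B + 1) / \<bar>K\<bar>"
  have "T > 0" using B K by (simp add: T_def)
  then have "\<bar>K\<bar> * T \<le> 4 * B" using est[of T] by simp
  moreover have "\<bar>K\<bar> * T = 4 * B + 1" using K by (simp add: T_def)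
  ultimately show False by simp
qed

context deformation
begin

text \<open>Supplies the bounds for the primitives along a leaf.\<close>

lemma compact_leaf_set: "compact {x \<in> S. norm x \<le> r}"
proof -
  have "{x \<in> S. norm x \<le> r} = cball 0 r \<inter> ({x. cmod (zv x) = 1} \<inter> ({x. F1 x = 0} \<inter> {x. F2 x = 0}))"
    by (auto simp: S_ex_iff M_ex_def split: prod.splits)
  moreover have "continuous_on UNIV F1" "continuous_on UNIV F2"
    by (rule smooth_fun_imp_continuous_on[OF smooth_fun_QH])+
  then have "closed {x. F1 x = 0}" "closed {x. F2 x = 0}"
    by (auto intro!: closed_Collect_eq continuous_on_const)
  moreover have "closed {x :: ambient. cmod (zv x) = 1}"
    by (intro closed_Collect_eq continuous_intros)
  ultimately show ?thesis by (auto intro!: compact_Int_closed)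
qed

lemma no_exact:
  assumes G: "smooth_fun W G1" "smooth_fun W G2"
    and eq: "\<And>x. x \<in> S \<Longrightarrow> real a * Re (res a b x) = D G2 x (X1 x) - D G1 x (X2 x)"
  shows False
proof -
  \<comment> \<open>Equal radii \<open>c\<close> in the first two planes give
    \<open>H_(\<alpha>) = (1 + \<alpha>) c^2 / 2 = 1/4\<close>; radius 1 in the third gives
    \<open>H_3 = 1/2\<close>.\<close>
  define c where "c = sqrt (1 / (2 * (1 + \<alpha>)))"
  define rad :: "3 \<Rightarrow> real" where "rad i = (if i = 3 then 1 else c)" for i
  \<comment> \<open>The flow of \<open>X1\<close> for time \<open>s\<close> and of \<open>X2\<close>
    for time \<open>t\<close>; the phase rates 1/4 and 1/2 are the levels of the two
    Hamiltonians.\<close>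
  define ga where "ga s t = torus_pt rad (\<lambda>i. s * wt1 \<alpha> i + t * wt2 i) (- s / 4 - t / 2)" for s t
  have c: "c > 0" "c\<^sup>2 = 1 / (2 * (1 + \<alpha>))" using \<alpha>_pos by (simp_all add: c_def)
  have q: "(\<Sum>i\<in>UNIV. wt1 \<alpha> i * (rad i)\<^sup>2) / 2 = 1/4" "(\<Sum>i\<in>UNIV. wt2 i * (rad i)\<^sup>2) / 2 = 1/2"
    using c(2) \<alpha>_pos by (simp_all add: sum_3 wt1_def wt2_def rad_def field_simps)
  have gS: "ga s t \<in> S" for s t
    by (simp add: S_ex_iff ga_def torus_pt_in_M_ex QH_torus_pt q)
  have d1: "((\<lambda>s. ga s t) has_vector_derivative X1 (ga s t)) (at s)" for s t
  proof -
    have "ga s t = torus_pt rad (\<lambda>i. t * wt2 i + s * wt1 \<alpha> i) (- t / 2 - s * (1/4))" for s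
      unfolding ga_def by (rule arg_cong2[where f = "torus_pt rad"]) (auto simp: algebra_simps)
    then show ?thesis using torus_pt_flow[OF q(1), of "\<lambda>i. t * wt2 i" "- t / 2"] by simp
  qed
  have d2: "((\<lambda>t. ga s t) has_vector_derivative X2 (ga s t)) (at t)" for s t
  proof -
    have "ga s t = torus_pt rad (\<lambda>i. s * wt1 \<alpha> i + t * wt2 i) (- s / 4 - t * (1/2))" for t
      by (simp add: ga_def)
    then show ?thesis using torus_pt_flow[OF q(2), of "\<lambda>i. s * wt1 \<alpha> i" "- s / 4"] by simp
  qed
  have res: "Re (res a b (ga s t)) = c ^ (a + b)" for s t
    unfolding ga_def
    by (subst res_torus_pt[OF ab(3), of _ _ c]) (simp_all add: wt1_def wt2_def rad_def)
  have cont: "continuous_on UNIV (\<lambda>(s, t). ga s t)"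
  proof -
    have ang: "continuous_on UNIV (\<lambda>p :: real \<times> real. fst p * k + snd p * l)" for k l
      by (intro continuous_on_add continuous_on_mult continuous_on_const continuous_on_fst continuous_on_snd continuous_on_id)
    have phase: "continuous_on UNIV (\<lambda>p :: real \<times> real. - fst p / 4 - snd p / 2)"
      using ang[of "- 1/4" "- 1/2"] by simp
    show ?thesis
      unfolding ga_def torus_pt_def case_prod_beta
      by (intro continuous_on_Pair continuous_on_vec_lambda continuous_on_cis continuous_on_add phase
          continuous_on_divide continuous_on_sum continuous_on_mult continuous_on_const continuous_on_cos
          continuous_on_sin ang) simp_all
  qed
  let ?C = "{x \<in> S. norm x \<le> 2 * (\<Sum>i\<in>UNIV. \<bar>rad i\<bar>) + 1}"
  have gC: "ga s t \<in> ?C" for s t using gS norm_torus_pt by (simp add: ga_def)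
  have bd: "\<exists>B. \<forall>s t. \<bar>G (ga s t)\<bar> \<le> B" if "smooth_fun W G" for G :: "ambient \<Rightarrow> real"
  proof -
    have "?C \<subseteq> W" using S_subset by blast
    then have "compact (G ` ?C)"
      by (intro compact_continuous_image compact_leaf_set
          continuous_on_subset[OF smooth_fun_imp_continuous_on[OF that]])
    then have "bounded (G ` ?C)" by (rule compact_imp_bounded)
    then obtain B where B: "\<forall>y\<in>G ` ?C. norm y \<le> B" unfolding bounded_iff by blast
    have "\<bar>G (ga s t)\<bar> \<le> B" for s t
      using B[rule_format, OF imageI[OF gC[of s t]]] by simp
    then show ?thesis by blast
  qed
  obtain B1 where B1: "\<And>s t. \<bar>G1 (ga s t)\<bar> \<le> B1" using bd[OF G(1)] by blast
  obtain B2 where B2: "\<And>s t. \<bar>G2 (ga s t)\<bar> \<le> B2" using bd[OF G(2)] by blast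
  have gW: "ga s t \<in> W" for s t using gS S_subset by blast
  have cc: "continuous_on UNIV (\<lambda>(s, t). H (ga s t))" if "smooth_fun W H" for H :: "ambient \<Rightarrow> real"
    using continuous_on_compose2[OF smooth_fun_imp_continuous_on[OF that] cont] gW
    by (auto simp: case_prod_beta)
  have "real a * c ^ (a + b) = 0"
  proof (rule bounded_cocycle_zero)
    show "((\<lambda>s. G2 (ga s t)) has_real_derivative D G2 (ga s t) (X1 (ga s t))) (at s)" for s t
      unfolding has_real_derivative_iff_has_vector_derivative
      using has_vector_derivative_dir_deriv[OF G(2) d1[of t s]] gW by auto
    show "((\<lambda>t. G1 (ga s t)) has_real_derivative D G1 (ga s t) (X2 (ga s t))) (at t)" for s t
      unfolding has_real_derivative_iff_has_vector_derivative
      using has_vector_derivative_dir_deriv[OF G(1) d2[of s t]] gW by auto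
    show "continuous_on UNIV (\<lambda>(s, t). D G2 (ga s t) (X1 (ga s t)))"
      by (rule cc[OF smooth_fun_dir_deriv[OF G(2) vector_field_hv]])
    show "continuous_on UNIV (\<lambda>(s, t). D G1 (ga s t) (X2 (ga s t)))"
      by (rule cc[OF smooth_fun_dir_deriv[OF G(1) vector_field_hv]])
    show "\<bar>G1 (ga s t)\<bar> \<le> max B1 B2" "\<bar>G2 (ga s t)\<bar> \<le> max B1 B2" for s t
      using B1[of s t] B2[of s t] by auto
    show "D G2 (ga s t) (X1 (ga s t)) - D G1 (ga s t) (X2 (ga s t)) = real a * c ^ (a + b)" for s t
      using eq[OF gS[of s t]] by (simp add: res)
  qed
  then show False using ab(1) c(1) by simp
qed

end

section \<open>Transport along a fat tubular neighborhood\<close>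

text \<open>The set \<open>A\<close> contains the lines in the direction of \<open>w\<close> but
  need not be open; along these lines any local extension computes the derivative, which is
  therefore smooth again. The lines will be fiberwise translations in \<open>TM|_S\<close>.\<close>

lemma line_derivative:
  assumes g: "smooth_fun A g" and w: "smooth_fun A w"
    and line: "\<And>p t. p \<in> A \<Longrightarrow> p + t *\<^sub>R w p \<in> A"
  defines "dg \<equiv> (\<lambda>p. vector_derivative (\<lambda>t. g (p + t *\<^sub>R w p)) (at 0))"
  shows "smooth_fun A dg"
    and "p \<in> A \<Longrightarrow> ((\<lambda>t. g (p + t *\<^sub>R w p)) has_vector_derivative dg p) (at 0)"
proof -
  have *: "((\<lambda>t. g (p + t *\<^sub>R w p)) has_vector_derivative frechet_derivative g1 (at p) (w p)) (at 0)"
    if U: "open U" "p \<in> U" "smooth_on U g1" "\<forall>y\<in>A \<inter> U. g y = g1 y" and p: "p \<in> A" for p U g1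
  proof -
    have l: "((\<lambda>t. p + t *\<^sub>R w p) has_vector_derivative w p) (at 0)" by (auto intro!: derivative_eq_intros)
    have d: "(g1 has_derivative frechet_derivative g1 (at p)) (at (p + 0 *\<^sub>R w p))"
      using smooth_on_has_derivative[OF U(3,2)] by simp
    have "((\<lambda>t. g1 (p + t *\<^sub>R w p)) has_derivative (\<lambda>h. frechet_derivative g1 (at p) (h *\<^sub>R w p))) (at 0)"
      by (rule has_derivative_compose[OF l[unfolded has_vector_derivative_def] d])
    then have "((\<lambda>t. g1 (p + t *\<^sub>R w p)) has_vector_derivative frechet_derivative g1 (at p) (w p)) (at 0)"
      using has_derivative_linear[OF d] by (simp add: has_vector_derivative_def linear_cmul)
    moreover have "open ((\<lambda>t. p + t *\<^sub>R w p) -` U)"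
      by (intro open_vimage U(1) continuous_intros)
    ultimately show ?thesis
      by (elim has_vector_derivative_transform_within_open) (use U line[OF p] in auto)
  qed
  show "((\<lambda>t. g (p + t *\<^sub>R w p)) has_vector_derivative dg p) (at 0)" if p: "p \<in> A" for p
  proof -
    obtain U g1 where U: "open U" "p \<in> U" "smooth_on U g1" "\<forall>y\<in>A \<inter> U. g y = g1 y"
      using g p unfolding smooth_fun_def by blast
    show ?thesis using *[OF U p] vector_derivative_at[OF *[OF U p]] by (simp add: dg_def)
  qed
  show "smooth_fun A dg"
    unfolding smooth_fun_def
  proof
    fix x assume x: "x \<in> A"
    obtain U g1 where U: "open U" "x \<in> U" "smooth_on U g1" "\<forall>y\<in>A \<inter> U. g y = g1 y"
      using g x unfolding smooth_fun_def by blast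
    obtain V w1 where V: "open V" "x \<in> V" "smooth_on V w1" "\<forall>y\<in>A \<inter> V. w y = w1 y"
      using w x unfolding smooth_fun_def by blast
    have "smooth_on (U \<inter> V) (\<lambda>x. frechet_derivative g1 (at x) (w1 x))"
      using U V by (intro smooth_on_frechet_derivative_along) (auto intro: smooth_on_subset)
    moreover have "dg y = frechet_derivative g1 (at y) (w1 y)" if "y \<in> A" "y \<in> U \<inter> V" for y
    proof -
      have "dg y = frechet_derivative g1 (at y) (w y)"
        unfolding dg_def by (rule vector_derivative_at, rule *[OF U(1) _ U(3,4) that(1)]) (use that in simp)
      then show ?thesis using V(4) that by simp
    qed
    ultimately show "\<exists>U h. open U \<and> x \<in> U \<and> smooth_on U h \<and> (\<forall>y\<in>A \<inter> U. dg y = h y)"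
      using U V by (intro exI[of _ "U \<inter> V"] exI[of _ "\<lambda>x. frechet_derivative g1 (at x) (w1 x)"] conjI ballI)
        (simp_all add: open_Int)
  qed
qed

locale fat_nbhd =
  fixes \<alpha> :: real and a b :: nat and \<tau> :: "ambient \<times> ambient set \<Rightarrow> ambient" and h :: "ambient \<times> ambient set \<Rightarrow> real"
  assumes fat_\<alpha>: "\<alpha> > 0" and fat_ab: "a > 0" "b > 0" "real b * \<alpha> = real a"
    and fat: "fat_tubular_nbhd M_ex (S_ex \<alpha>) \<tau> h"
begin

abbreviation "NS \<equiv> normal_bundle M_ex (S_ex \<alpha>)"
abbreviation "W \<equiv> \<tau> ` NS"
abbreviation "TA \<equiv> tangent_along M_ex (S_ex \<alpha>)"
abbreviation "inv\<tau> \<equiv> the_inv_into NS \<tau>"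
abbreviation "J_NS \<equiv> jacobi_NS M_ex theta_ex (S_ex \<alpha>) \<tau> h"

text \<open>The quotient map from \<open>TM|_S\<close> to \<open>NS\<close>, by which functions of
  cosets are pulled back to a subset of a Euclidean space.\<close>

definition NC :: "ambient \<times> ambient \<Rightarrow> ambient \<times> ambient set" where
  "NC p = (fst p, normal_class (S_ex \<alpha>) (fst p) (snd p))"

lemma tangent_space_S: "x \<in> S_ex \<alpha> \<Longrightarrow>
    tangent_space (S_ex \<alpha>) x = {v. scal (wt1 \<alpha>) x \<bullet> v = 0 \<and> scal wt2 x \<bullet> v = 0 \<and> circ x \<bullet> v = 0}"
  by (rule tangent_space_S_ex[OF fat_\<alpha>])

lemma TA_iff: "p \<in> TA \<longleftrightarrow> fst p \<in> S_ex \<alpha> \<and> circ (fst p) \<bullet> snd p = 0"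
proof -
  have "p \<in> TA \<longleftrightarrow> fst p \<in> S_ex \<alpha> \<and> snd p \<in> tangent_space M_ex (fst p)"
    by (simp add: tangent_along_def case_prod_unfold)
  moreover have "tangent_space M_ex (fst p) = {v. circ (fst p) \<bullet> v = 0}" if "fst p \<in> S_ex \<alpha>"
    using tangent_space_M_ex S_ex_subset_M_ex that by blast
  ultimately show ?thesis by (cases "fst p \<in> S_ex \<alpha>") simp_all
qed

lemma NS_eq: "NS = NC ` TA"
  by (simp add: normal_bundle_def NC_def[abs_def] case_prod_unfold)

lemma smooth_NS_iff: "smooth_NS M_ex (S_ex \<alpha>) u \<longleftrightarrow> smooth_fun TA (\<lambda>p. u (NC p))"
  by (simp add: smooth_NS_def NC_def case_prod_unfold)

lemma smooth_\<tau>: "smooth_fun TA (\<lambda>p. \<tau> (NC p))" and smooth_h: "smooth_fun TA (\<lambda>p. h (NC p))"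
  and inj_\<tau>: "inj_on \<tau> NS" and openin_\<tau>: "openin (top_of_set M_ex) W"
  and h_nz: "\<nu> \<in> NS \<Longrightarrow> h \<nu> \<noteq> 0"
  and smooth_inv: "smooth_NS M_ex (S_ex \<alpha>) (u :: _ \<Rightarrow> real) \<Longrightarrow> smooth_fun W (\<lambda>y. u (inv\<tau> y))"
  using fat by (auto simp: fat_tubular_nbhd_def smooth_NS_iff o_def)

lemma zero_point_NC: "zero_point (S_ex \<alpha>) x = NC (x, 0)"
  by (simp add: zero_point_def NC_def)

lemma zero_TA: "x \<in> S_ex \<alpha> \<Longrightarrow> (x, 0) \<in> TA" by (simp add: TA_iff)

lemma zero_NS: "x \<in> S_ex \<alpha> \<Longrightarrow> NC (x, 0) \<in> NS" using zero_TA by (simp add: NS_eq)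

lemma zero_\<tau>: "x \<in> S_ex \<alpha> \<Longrightarrow> \<tau> (NC (x, 0)) = x" "x \<in> S_ex \<alpha> \<Longrightarrow> h (NC (x, 0)) = 1"
  using fat by (auto simp: fat_tubular_nbhd_def zero_point_NC)

lemma inv_\<tau>: "\<nu> \<in> NS \<Longrightarrow> inv\<tau> (\<tau> \<nu>) = \<nu>" "y \<in> W \<Longrightarrow> \<tau> (inv\<tau> y) = y" "y \<in> W \<Longrightarrow> inv\<tau> y \<in> NS"
  using the_inv_into_f_f[OF inj_\<tau>] f_the_inv_into_f[OF inj_\<tau>] the_inv_into_into[OF inj_\<tau> _ subset_refl] by auto

lemma inv_zero: "x \<in> S_ex \<alpha> \<Longrightarrow> inv\<tau> x = NC (x, 0)"
  using inv_\<tau>(1)[OF zero_NS] zero_\<tau>(1) by metis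

sublocale deformation W \<alpha> a b
proof
  show "S_ex \<alpha> \<subseteq> W" using zero_NS zero_\<tau>(1) by (metis image_eqI subsetI)
qed (use fat_\<alpha> fat_ab openin_\<tau> in auto)

section \<open>Cosets, fiber coordinates and representatives\<close>

lemma tangent_S_subspace:
  assumes "x \<in> S"
  shows "v \<in> tangent_space S x \<Longrightarrow> w \<in> tangent_space S x \<Longrightarrow> v + w \<in> tangent_space S x"
    "v \<in> tangent_space S x \<Longrightarrow> w \<in> tangent_space S x \<Longrightarrow> v - w \<in> tangent_space S x"
    "v \<in> tangent_space S x \<Longrightarrow> t *\<^sub>R v \<in> tangent_space S x" "0 \<in> tangent_space S x"
  using assms by (simp_all add: tangent_space_S inner_add_right inner_diff_right)

lemma normal_class_iff: "u \<in> normal_class S x v \<longleftrightarrow> u - v \<in> tangent_space S x"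
proof
  assume "u \<in> normal_class S x v"
  then obtain w where "u = v + w" "w \<in> tangent_space S x" unfolding normal_class_def by blast
  then show "u - v \<in> tangent_space S x" by simp
next
  assume "u - v \<in> tangent_space S x"
  moreover have "u = v + (u - v)" by simp
  ultimately show "u \<in> normal_class S x v" unfolding normal_class_def by blast
qed

lemma normal_class_eqI:
  assumes x: "x \<in> S" and d: "v - v' \<in> tangent_space S x"
  shows "normal_class S x v = normal_class S x v'"
proof (rule set_eqI)
  fix u
  have "u - v' = (u - v) + (v - v')" "u - v = (u - v') - (v - v')" by simp_all
  then show "u \<in> normal_class S x v \<longleftrightarrow> u \<in> normal_class S x v'"
    unfolding normal_class_iff using tangent_S_subspace(1,2)[OF x] d by metis
qed

text \<open>Evaluates the set of sums in \<open>vert_deriv\<close> on representatives; vertical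
  differentiation becomes differentiation along a line in \<open>TM|_S\<close>.\<close>

lemma normal_class_line:
  assumes x: "x \<in> S"
  shows "{u + t *\<^sub>R u' | u u'. u \<in> normal_class S x v \<and> u' \<in> normal_class S x w} = normal_class S x (v + t *\<^sub>R w)"
    (is "?L = ?R")
proof (intro subset_antisym subsetI)
  fix y assume "y \<in> ?L"
  then obtain u u' where u: "y = u + t *\<^sub>R u'" "u - v \<in> tangent_space S x" "u' - w \<in> tangent_space S x"
    by (auto simp: normal_class_iff)
  have e: "y - (v + t *\<^sub>R w) = (u - v) + t *\<^sub>R (u' - w)" by (simp add: u(1) algebra_simps)
  show "y \<in> ?R"
    unfolding normal_class_iff e by (rule tangent_S_subspace(1)[OF x u(2) tangent_S_subspace(3)[OF x u(3)]])
next
  fix y assume "y \<in> ?R"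
  then have "y - t *\<^sub>R w \<in> normal_class S x v" by (simp add: normal_class_iff algebra_simps)
  moreover have "w \<in> normal_class S x w" using tangent_S_subspace(4)[OF x] by (simp add: normal_class_iff)
  moreover have "y = (y - t *\<^sub>R w) + t *\<^sub>R w" by simp
  ultimately show "y \<in> ?L" by blast
qed

text \<open>For the weights of \<open>F\<^sub>1\<close>, \<open>F\<^sub>2\<close> the value does not depend on the chosen representative of the coset.\<close>

definition fib :: "(3 \<Rightarrow> real) \<Rightarrow> ambient \<times> ambient set \<Rightarrow> real" where
  "fib w \<nu> = scal w (fst \<nu>) \<bullet> (SOME v. v \<in> snd \<nu>)"

text \<open>Fiber coordinates as functions on \<open>W\<close>. They are linear along the images of
  the fibers, where the behavior of \<open>F1\<close> and \<open>F2\<close> depends on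
  \<tau>.\<close>

definition U1 :: "ambient \<Rightarrow> real" where "U1 y = fib (wt1 \<alpha>) (inv\<tau> y)"
definition U2 :: "ambient \<Rightarrow> real" where "U2 y = fib wt2 (inv\<tau> y)"

lemma fib_NC:
  assumes "p \<in> TA" "w = wt1 \<alpha> \<or> w = wt2"
  shows "fib w (NC p) = scal w (fst p) \<bullet> snd p"
proof -
  have x: "fst p \<in> S" using assms by (simp add: TA_iff)
  have "snd p \<in> normal_class S (fst p) (snd p)"
    using tangent_S_subspace(4)[OF x] by (simp add: normal_class_iff)
  then have "(SOME v. v \<in> normal_class S (fst p) (snd p)) \<in> normal_class S (fst p) (snd p)" by (rule someI)
  then show ?thesis
    using assms(2) by (auto simp: fib_def NC_def normal_class_iff tangent_space_S[OF x] inner_diff_right)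
qed

lemma smooth_fib:
  assumes "w = wt1 \<alpha> \<or> w = wt2" shows "smooth_NS M_ex S (fib w)"
  unfolding smooth_NS_iff
proof (rule smooth_fun_cong)
  show "scal w (fst p) \<bullet> snd p = fib w (NC p)" if "p \<in> TA" for p
    using fib_NC[OF that assms] by simp
  show "smooth_fun TA (\<lambda>p. scal w (fst p) \<bullet> snd p)"
    by (intro smooth_fun_inner smooth_fun_bounded_linear[OF bounded_linear_scal] smooth_fun_fst
        smooth_fun_snd smooth_fun_ident)
qed

lemma smooth_U: "smooth_fun W U1" "smooth_fun W U2"
  unfolding U1_def U2_def by (intro smooth_inv smooth_fib; simp)+

lemma U_NC:
  assumes "p \<in> TA"
  shows "U1 (\<tau> (NC p)) = scal (wt1 \<alpha>) (fst p) \<bullet> snd p" "U2 (\<tau> (NC p)) = scal wt2 (fst p) \<bullet> snd p"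
proof -
  have "NC p \<in> NS" using assms by (simp add: NS_eq)
  then show "U1 (\<tau> (NC p)) = scal (wt1 \<alpha>) (fst p) \<bullet> snd p" "U2 (\<tau> (NC p)) = scal wt2 (fst p) \<bullet> snd p"
    using assms by (simp_all add: U1_def U2_def inv_\<tau> fib_NC)
qed

lemma U_S: "x \<in> S \<Longrightarrow> U1 x = 0" "x \<in> S \<Longrightarrow> U2 x = 0"
  using U_NC[OF zero_TA] zero_\<tau>(1) by simp_all

text \<open>A smooth right inverse of \<open>TM|\<^sub>S \<rightarrow> NS \<rightarrow> W\<close>.\<close>

definition lift :: "ambient \<Rightarrow> ambient \<times> ambient" where
  "lift y = (fst (inv\<tau> y), U1 y *\<^sub>R e1 (fst (inv\<tau> y)) + U2 y *\<^sub>R e2 (fst (inv\<tau> y)))"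

lemma smooth_base: "smooth_fun W (\<lambda>y. fst (inv\<tau> y))"
proof (rule smooth_fun_componentwise)
  fix c :: ambient assume "c \<in> Basis"
  have "smooth_fun TA (\<lambda>p. fst p \<bullet> c)"
    by (intro smooth_fun_inner smooth_fun_fst smooth_fun_ident smooth_fun_const)
  then have "smooth_NS M_ex S (\<lambda>\<nu>. fst \<nu> \<bullet> c)" by (simp add: smooth_NS_iff NC_def)
  then show "smooth_fun W (\<lambda>y. fst (inv\<tau> y) \<bullet> c)" by (rule smooth_inv)
qed

lemma smooth_lift: "smooth_fun W lift"
  unfolding lift_def
  by (intro smooth_fun_Pair smooth_fun_add smooth_fun_scaleR smooth_U smooth_base
      smooth_fun_compose[OF smooth_base smooth_fun_e(1)[of UNIV]] smooth_fun_compose[OF smooth_base smooth_fun_e(2)[of UNIV]])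
    auto

text \<open>Two fiber coordinates determine a normal class, and by duality the combination of
  \<open>e1\<close>, \<open>e2\<close> with these coefficients represents it.\<close>

lemma lift:
  assumes y: "y \<in> W"
  shows "lift y \<in> TA" "NC (lift y) = inv\<tau> y" "\<tau> (NC (lift y)) = y"
proof -
  obtain p where p: "p \<in> TA" "inv\<tau> y = NC p" using inv_\<tau>(3)[OF y] by (auto simp: NS_eq)
  have x: "fst p \<in> S" and c: "circ (fst p) \<bullet> snd p = 0" using p by (simp_all add: TA_iff)
  have f: "fst (inv\<tau> y) = fst p" by (simp add: p NC_def)
  have yp: "y = \<tau> (NC p)" using inv_\<tau>(2)[OF y] p by simp
  have l: "lift y = (fst p, (scal (wt1 \<alpha>) (fst p) \<bullet> snd p) *\<^sub>R e1 (fst p) + (scal wt2 (fst p) \<bullet> snd p) *\<^sub>R e2 (fst p))"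
    unfolding lift_def f using U_NC[OF p(1)] yp by simp
  show "lift y \<in> TA" using x by (simp add: l TA_iff inner_add_right e_dual)
  have "normal_class S (fst p) (snd (lift y)) = normal_class S (fst p) (snd p)"
    by (rule normal_class_eqI[OF x])
      (simp add: tangent_space_S[OF x] l inner_add_right inner_diff_right e_dual[OF x] c)
  then show n: "NC (lift y) = inv\<tau> y" by (simp add: p(2) NC_def l)
  then show "\<tau> (NC (lift y)) = y" using inv_\<tau>(2)[OF y] by simp
qed

lemma lift_S: "x \<in> S \<Longrightarrow> lift x = (x, 0)"
  by (simp add: lift_def inv_zero NC_def U_S)

text \<open>The section \<open>u\<close> of \<open>L\<^sub>N\<^sub>S\<close> corresponds to the section \<open>f\<close> of \<open>L\<close> over \<open>W\<close>.\<close>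

definition rep :: "(ambient \<times> ambient set \<Rightarrow> real) \<Rightarrow> (ambient \<Rightarrow> real) \<Rightarrow> bool" where
  "rep u f \<longleftrightarrow> smooth_fun W f \<and> (\<forall>\<nu>\<in>NS. h \<nu> * u \<nu> = f (\<tau> \<nu>))"

lemma rep_push:
  assumes "smooth_NS M_ex S u" shows "rep u (push_section M_ex S \<tau> h u)"
proof -
  have "smooth_NS M_ex S (\<lambda>\<nu>. h \<nu> * u \<nu>)"
    using assms smooth_h unfolding smooth_NS_iff by (intro smooth_fun_mult)
  from smooth_inv[OF this] have "smooth_fun W (push_section M_ex S \<tau> h u)"
    by (simp add: push_section_def o_def)
  then show ?thesis by (simp add: rep_def push_section_def inv_\<tau>)
qed

lemma push_rep: "rep u f \<Longrightarrow> y \<in> W \<Longrightarrow> push_section M_ex S \<tau> h u y = f y"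
  using inv_\<tau>(2,3) by (auto simp: rep_def push_section_def)

lemma rep_zero: "rep u f \<Longrightarrow> x \<in> S \<Longrightarrow> u (zero_point S x) = f x"
  using zero_NS[of x] zero_\<tau>[of x] by (auto simp: rep_def zero_point_NC)

lemma rep_diff: "rep u f \<Longrightarrow> rep w g \<Longrightarrow> rep (\<lambda>\<nu>. u \<nu> - w \<nu>) (\<lambda>y. f y - g y)"
  by (auto simp: rep_def right_diff_distrib intro: smooth_fun_diff)

lemma rep_mult:
  assumes f: "smooth_NS M_ex S f" and l: "rep l g"
  shows "rep (\<lambda>\<nu>. f \<nu> * l \<nu>) (\<lambda>y. f (inv\<tau> y) * g y)"
proof -
  have "smooth_fun W (\<lambda>y. f (inv\<tau> y) * g y)"
    using l by (intro smooth_fun_mult smooth_inv[OF f]) (simp add: rep_def)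
  moreover have "h \<nu> * (f \<nu> * l \<nu>) = f \<nu> * g (\<tau> \<nu>)" if "\<nu> \<in> NS" for \<nu>
    using l that by (metis rep_def mult.left_commute)
  ultimately show ?thesis by (simp add: rep_def inv_\<tau>)
qed

lemma rep_J:
  assumes u: "rep u f" and w: "rep w g"
  shows "rep (J_NS u w) (Jac f g)"
proof -
  have s: "smooth_fun W f" "smooth_fun W g" using u w by (simp_all add: rep_def)
  have su: "smooth_fun W (push_section M_ex S \<tau> h u)" "smooth_fun W (push_section M_ex S \<tau> h w)"
    using smooth_fun_cong[OF _ s(1)] smooth_fun_cong[OF _ s(2)] push_rep[OF u] push_rep[OF w] by metis+
  have "h \<nu> * J_NS u w \<nu> = Jac f g (\<tau> \<nu>)" if "\<nu> \<in> NS" for \<nu>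
  proof -
    have "h \<nu> * J_NS u w \<nu> = Jac (push_section M_ex S \<tau> h u) (push_section M_ex S \<tau> h w) (\<tau> \<nu>)"
      using that h_nz[OF that] by (simp add: jacobi_NS_def jacobi_bracket_eq[OF su])
    also have "\<dots> = Jac f g (\<tau> \<nu>)"
      by (rule Jac_cong) (use that push_rep[OF u] push_rep[OF w] in auto)
    finally show ?thesis .
  qed
  then show ?thesis using smooth_fun_Jac[OF s] by (simp add: rep_def)
qed

section \<open>Vertical derivations as first order operators on \<open>W\<close>\<close>

definition rep_section :: "(ambient \<Rightarrow> ambient set) \<Rightarrow> (ambient \<Rightarrow> ambient) \<Rightarrow> bool" where
  "rep_section s w \<longleftrightarrow> smooth_fun S w \<and> (\<forall>x\<in>S. circ x \<bullet> w x = 0 \<and> s x = normal_class S x (w x))"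

lemma section_NS_iff: "section_NS M_ex S s \<longleftrightarrow> (\<exists>w. rep_section s w)"
  using tangent_space_M_ex S_ex_subset_M_ex unfolding section_NS_def rep_section_def by blast

text \<open>\<open>V\<close> and \<open>\<kappa>\<close> express \<open>I(s)\<close> in the
  trivialization of \<open>L\<close> over \<open>W\<close>, so that computations with cosets become
  computations with functions on \<open>W\<close>.\<close>

definition transported :: "(ambient \<Rightarrow> ambient set) \<Rightarrow> (ambient \<Rightarrow> ambient) \<Rightarrow> (ambient \<Rightarrow> real) \<Rightarrow> bool" where
  "transported s V \<kappa> \<longleftrightarrow> vector_field W V \<and> smooth_fun W \<kappa> \<and>
     (\<forall>u f. rep u f \<longrightarrow> rep (vert_deriv s u) (deriv_op V \<kappa> f))"

text \<open>\<open>V\<close> is the push-forward of the constant vertical field, found by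
  differentiating \<tau> along fiber lines. A section \<open>u\<close> corresponds to
  \<open>h u\<close>, so the quotient rule makes \<open>\<kappa>\<close> minus the logarithmic
  derivative of \<open>h\<close>. The last clause holds because the fiber coordinates are linear on
  these lines.\<close>

lemma exists_transported:
  assumes sw: "rep_section s w"
  shows "\<exists>V \<kappa>. transported s V \<kappa> \<and>
    (\<forall>x\<in>S. D U1 x (V x) = scal (wt1 \<alpha>) x \<bullet> w x \<and> D U2 x (V x) = scal wt2 x \<bullet> w x)"
proof -
  have w: "smooth_fun S w" "\<And>x. x \<in> S \<Longrightarrow> circ x \<bullet> w x = 0" "\<And>x. x \<in> S \<Longrightarrow> s x = normal_class S x (w x)"
    using sw by (auto simp: rep_section_def)
  define wp where "wp p = (0 :: ambient, w (fst p))" for p :: "ambient \<times> ambient"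
  have swp: "smooth_fun TA wp" unfolding wp_def
    by (intro smooth_fun_Pair smooth_fun_const smooth_fun_compose[OF _ w(1)] smooth_fun_fst smooth_fun_ident)
      (auto simp: TA_iff)
  have line: "p + t *\<^sub>R wp p \<in> TA" if "p \<in> TA" for p t
    using that w(2)[of "fst p"] by (simp add: TA_iff wp_def inner_add_right)
  define dt where "dt = (\<lambda>p. vector_derivative (\<lambda>t. \<tau> (NC (p + t *\<^sub>R wp p))) (at 0))"
  define dh where "dh = (\<lambda>p. vector_derivative (\<lambda>t. h (NC (p + t *\<^sub>R wp p))) (at 0))"
  have sdt: "smooth_fun TA dt" and dt: "\<And>p. p \<in> TA \<Longrightarrow> ((\<lambda>t. \<tau> (NC (p + t *\<^sub>R wp p))) has_vector_derivative dt p) (at 0)"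
    using line_derivative[OF smooth_\<tau> swp line] by (simp_all add: dt_def)
  have sdh: "smooth_fun TA dh" and dh: "\<And>p. p \<in> TA \<Longrightarrow> ((\<lambda>t. h (NC (p + t *\<^sub>R wp p))) has_vector_derivative dh p) (at 0)"
    using line_derivative[OF smooth_h swp line] by (simp_all add: dh_def)
  define V where "V y = dt (lift y)" for y
  define \<kappa> where "\<kappa> y = - (dh (lift y) / h (NC (lift y)))" for y
  have TAN: "NC p \<in> NS" if "p \<in> TA" for p using that by (simp add: NS_eq)
  have inW: "\<tau> (NC p) \<in> W" if "p \<in> TA" for p using TAN[OF that] by blast
  have sV: "smooth_fun W V" unfolding V_def
    by (rule smooth_fun_compose[OF smooth_lift sdt]) (use lift(1) in blast)
  have sk: "smooth_fun W \<kappa>" unfolding \<kappa>_def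
  proof (intro smooth_fun_minus smooth_fun_divide)
    show "smooth_fun W (\<lambda>y. dh (lift y))" "smooth_fun W (\<lambda>y. h (NC (lift y)))"
      by (rule smooth_fun_compose[OF smooth_lift sdh], use lift(1) in blast)
        (rule smooth_fun_compose[OF smooth_lift smooth_h], use lift(1) in blast)
    show "h (NC (lift y)) \<noteq> 0" if "y \<in> W" for y using h_nz[OF TAN[OF lift(1)[OF that]]] .
  qed
  have Vt: "V y \<in> tangent_space W y" if y: "y \<in> W" for y
  proof -
    let ?c = "\<lambda>t::real. \<tau> (NC (lift y + t *\<^sub>R wp (lift y)))"
    have "smooth_fun {-1<..<1} (\<lambda>t::real. lift y + t *\<^sub>R wp (lift y))"
      by (intro smooth_fun_add smooth_fun_const smooth_fun_scaleR smooth_fun_ident)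
    then have "smooth_fun {-1<..<1} ?c"
      by (rule smooth_fun_compose[OF _ smooth_\<tau>]) (use line[OF lift(1)[OF y]] in blast)
    then have "smooth_on {-1<..<1} ?c" by (rule smooth_fun_imp_smooth_on) simp
    moreover have "?c ` {-1<..<1} \<subseteq> W" using inW[OF line[OF lift(1)[OF y]]] by blast
    moreover have "?c 0 = y" using lift(3)[OF y] by simp
    moreover have "(?c has_vector_derivative V y) (at 0)" unfolding V_def by (rule dt[OF lift(1)[OF y]])
    ultimately show ?thesis
      unfolding tangent_space_def by (intro CollectI exI[of _ ?c] exI[of _ 1]) simp
  qed
  have Vf: "vector_field W V" using sV Vt by (simp add: vector_field_def)
  have along: "((\<lambda>t. f (\<tau> (NC (lift y + t *\<^sub>R wp (lift y))))) has_real_derivative D f y (V y)) (at 0)"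
    if f: "smooth_fun W f" and y: "y \<in> W" for f :: "ambient \<Rightarrow> real" and y
    using has_vector_derivative_dir_deriv[OF f dt[OF lift(1)[OF y]]] inW[OF line[OF lift(1)[OF y]]] lift(3)[OF y]
    unfolding has_real_derivative_iff_has_vector_derivative V_def by auto
  have tr: "rep (vert_deriv s u) (deriv_op V \<kappa> f)" if r: "rep u f" for u f
  proof -
    have f: "smooth_fun W f" using r by (simp add: rep_def)
    have "h \<nu> * vert_deriv s u \<nu> = deriv_op V \<kappa> f (\<tau> \<nu>)" if \<nu>: "\<nu> \<in> NS" for \<nu>
    proof -
      define y where "y = \<tau> \<nu>"
      have y: "y \<in> W" using \<nu> by (simp add: y_def)
      define p where "p = lift y"
      have p: "p \<in> TA" "NC p = \<nu>" using lift[OF y] inv_\<tau>(1)[OF \<nu>] by (simp_all add: p_def y_def)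
      have x: "fst p \<in> S" using p by (simp add: TA_iff)
      have h0: "h \<nu> \<noteq> 0" using h_nz[OF \<nu>] .
      have hp: "h (NC (p + t *\<^sub>R wp p)) \<noteq> 0" for t using h_nz[OF TAN[OF line[OF p(1)]]] .
      have "vert_deriv s u \<nu> = deriv (\<lambda>t. u (NC (p + t *\<^sub>R wp p))) 0"
        unfolding p(2)[symmetric]
        by (simp only: vert_deriv_def NC_def prod.case w(3)[OF x] normal_class_line[OF x] wp_def fst_add snd_add
            fst_scaleR snd_scaleR fst_conv snd_conv scaleR_zero_right add_0_right)
      also have "(\<lambda>t. u (NC (p + t *\<^sub>R wp p))) = (\<lambda>t. f (\<tau> (NC (p + t *\<^sub>R wp p))) / h (NC (p + t *\<^sub>R wp p)))"
      proof
        fix t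
        have "h (NC (p + t *\<^sub>R wp p)) * u (NC (p + t *\<^sub>R wp p)) = f (\<tau> (NC (p + t *\<^sub>R wp p)))"
          using r TAN[OF line[OF p(1)]] by (simp add: rep_def)
        then show "u (NC (p + t *\<^sub>R wp p)) = f (\<tau> (NC (p + t *\<^sub>R wp p))) / h (NC (p + t *\<^sub>R wp p))"
          using hp[of t] by (simp add: field_simps)
      qed
      also have "deriv \<dots> 0 = (D f y (V y) * h \<nu> - f y * dh p) / (h \<nu> * h \<nu>)"
      proof (rule DERIV_imp_deriv)
        have 1: "((\<lambda>t. f (\<tau> (NC (p + t *\<^sub>R wp p)))) has_real_derivative D f y (V y)) (at 0)"
          using along[OF f y] by (simp add: p_def)
        have 2: "((\<lambda>t. h (NC (p + t *\<^sub>R wp p))) has_real_derivative dh p) (at 0)"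
          using dh[OF p(1)] by (simp add: has_real_derivative_iff_has_vector_derivative)
        show "((\<lambda>t. f (\<tau> (NC (p + t *\<^sub>R wp p))) / h (NC (p + t *\<^sub>R wp p))) has_real_derivative
            (D f y (V y) * h \<nu> - f y * dh p) / (h \<nu> * h \<nu>)) (at 0)"
          using DERIV_divide[OF 1 2] hp[of 0] p(2) y_def by simp
      qed
      finally have "h \<nu> * vert_deriv s u \<nu> = D f y (V y) - (dh p / h \<nu>) * f y"
        using h0 by (simp add: field_simps)
      then show ?thesis using p(2) by (simp add: deriv_op_def \<kappa>_def p_def[symmetric] y_def[symmetric])
    qed
    then show ?thesis using smooth_fun_deriv_op[OF Vf sk f] by (simp add: rep_def)
  qed
  have "D U1 x (V x) = scal (wt1 \<alpha>) x \<bullet> w x \<and> D U2 x (V x) = scal wt2 x \<bullet> w x" if x: "x \<in> S" for x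
  proof -
    \<comment> \<open>On \<open>S\<close> the lift is the zero vector, so the line consists of the
      vectors \<open>t w(x)\<close>, with fiber coordinates \<open>t\<close> times those of
      \<open>w(x)\<close>.\<close>
    have lx: "lift x + t *\<^sub>R wp (lift x) = (x, t *\<^sub>R w x)" for t using lift_S[OF x] by (simp add: wp_def)
    have l: "(x, t *\<^sub>R w x) \<in> TA" for t using x w(2)[OF x] by (simp add: TA_iff)
    have lin: "((\<lambda>t. t * k) has_real_derivative k) (at 0)" for k :: real
      by (auto intro!: derivative_eq_intros)
    have "((\<lambda>t. t * (scal (wt1 \<alpha>) x \<bullet> w x)) has_real_derivative D U1 x (V x)) (at 0)"
      "((\<lambda>t. t * (scal wt2 x \<bullet> w x)) has_real_derivative D U2 x (V x)) (at 0)"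
      using along[OF smooth_U(1) in_W[OF x]] along[OF smooth_U(2) in_W[OF x]] unfolding lx U_NC[OF l] by simp_all
    then show ?thesis using DERIV_unique lin by blast
  qed
  then show ?thesis using Vf sk tr unfolding transported_def by blast
qed

text \<open>Stated for an arbitrary operation \<open>B\<close>, so that it applies to the bracket
  and then again to its Lie derivative.\<close>

lemma rep_lie_deriv:
  assumes t: "transported s V \<kappa>"
    and B: "\<And>u f w g. rep u f \<Longrightarrow> rep w g \<Longrightarrow> rep (B u w) (B' f g)" and u: "rep u f" and w: "rep w g"
  shows "rep (lie_deriv (vert_deriv s) B u w)
    (\<lambda>y. deriv_op V \<kappa> (B' f g) y - B' (deriv_op V \<kappa> f) g y - B' f (deriv_op V \<kappa> g) y)"
proof -
  have d: "rep (vert_deriv s u) (deriv_op V \<kappa> f)" if "rep u f" for u f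
    using t that by (simp add: transported_def)
  show ?thesis unfolding lie_deriv_def by (intro rep_diff d B u w)
qed

lemma rep_lie_J:
  assumes t: "transported s V \<kappa>" and u: "rep u f" and w: "rep w g"
  shows "rep (lie_deriv (vert_deriv s) J_NS u w) (lie_Jac V \<kappa> f g)"
  unfolding lie_Jac_def by (rule rep_lie_deriv[OF t rep_J u w])

lemma rep_lie2_J:
  assumes t: "transported s V \<kappa>" and u: "rep u f" and w: "rep w g"
  shows "rep (lie_deriv (vert_deriv s) (lie_deriv (vert_deriv s) J_NS) u w) (lie2_Jac V \<kappa> f g)"
  unfolding lie2_Jac_def by (rule rep_lie_deriv[OF t rep_lie_J[OF t] u w])

end

section \<open>The obstructed deformation\<close>

text \<open>The power \<open>n = 1\<close> contributes the second section, \<open>n = 2\<close> the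
  first section twice with the factor \<open>1 / fact 2\<close>; the other summands are zero or act
  on a zero coefficient.\<close>

lemma exp_lie_coeff_2:
  "exp_lie_coeff s B 2 u w \<nu> = lie_deriv (vert_deriv (s 2)) B u w \<nu>
     + lie_deriv (vert_deriv (s 1)) (lie_deriv (vert_deriv (s 1)) B) u w \<nu> / 2"
proof -
  have v0: "vert_deriv s' (\<lambda>\<nu>. 0) = (\<lambda>\<nu>. 0)" for s' :: "'b::euclidean_space \<Rightarrow> 'b set"
    by (auto simp: vert_deriv_def fun_eq_iff)
  have l0: "lie_deriv (vert_deriv s') (\<lambda>u w \<nu>. 0) = (\<lambda>u w \<nu>. 0)" for s' :: "'b::euclidean_space \<Rightarrow> 'b set"
    by (auto simp: lie_deriv_def v0 fun_eq_iff)
  have c00: "lie_power_coeff s B 0 0 = B" and c01: "lie_power_coeff s B 0 (Suc 0) = (\<lambda>u w \<nu>. 0)"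
    and c10: "lie_power_coeff s B (Suc 0) 0 = (\<lambda>u w \<nu>. 0)"
    by (simp_all add: fun_eq_iff)
  have c11: "lie_power_coeff s B (Suc 0) (Suc 0) = lie_deriv (vert_deriv (s 1)) B"
    by (simp add: c00 fun_eq_iff del: lie_power_coeff.simps(1))
  have i2: "{Suc 0..2} = {Suc 0, 2}" by auto
  have c12: "lie_power_coeff s B (Suc 0) 2 = lie_deriv (vert_deriv (s 2)) B"
    by (simp add: i2 c00 c01 l0 fun_eq_iff del: lie_power_coeff.simps(1))
  have c22: "lie_power_coeff s B 2 2 = lie_deriv (vert_deriv (s 1)) (lie_deriv (vert_deriv (s 1)) B)"
  proof -
    have "lie_power_coeff s B (Suc (Suc 0)) 2 = (\<lambda>u w \<nu>. \<Sum>i=1..2. lie_deriv (vert_deriv (s i)) (lie_power_coeff s B (Suc 0) (2 - i)) u w \<nu>)"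
      by (rule lie_power_coeff.simps(2))
    also have "\<dots> = lie_deriv (vert_deriv (s 1)) (lie_deriv (vert_deriv (s 1)) B)"
      by (simp add: i2 c10 c11 l0 fun_eq_iff del: lie_power_coeff.simps)
    finally show ?thesis by (simp only: numeral_2_eq_2)
  qed
  have a2: "{..2::nat} = {0, Suc 0, 2}" by auto
  show ?thesis
    unfolding exp_lie_coeff_def a2 using c12 c22 by (simp add: del: lie_power_coeff.simps(2))
qed

context fat_nbhd
begin

text \<open>Along \<open>S\<close>, the fiber coordinates and \<open>F\<^sub>1\<close>, \<open>F\<^sub>2\<close> have the same kernel since \<open>\<tau>\<close> is a diffeomorphism.\<close>

lemma D_U_expand:
  assumes x: "x \<in> S" and v: "v \<in> tangent_space W x"
  shows "D U1 x v = D F1 x v * D U1 x (e1 x) + D F2 x v * D U1 x (e2 x)"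
    "D U2 x v = D F1 x v * D U2 x (e1 x) + D F2 x v * D U2 x (e2 x)"
  using conormal_expand[OF x smooth_U(1) _ v] conormal_expand[OF x smooth_U(2) _ v]
    dir_deriv_tangent_zero[OF smooth_U(1) S_subset x _ U_S(1)]
    dir_deriv_tangent_zero[OF smooth_U(2) S_subset x _ U_S(2)] by auto

lemma rep_section_e: "rep_section (\<lambda>x. normal_class S x (e1 x)) e1" "rep_section (\<lambda>x. normal_class S x (e2 x)) e2"
  by (simp_all add: rep_section_def smooth_fun_e e_dual)

text \<open>Pushing forward the vertical fields of \<open>e1\<close> and \<open>e2\<close> realizes
  both unit vectors as values of \<open>(dU1, dU2)\<close>. This pair factors through
  \<open>(dF1, dF2)\<close>, so the 2 by 2 matrix between them is invertible.\<close>

lemma D_U_injective: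
  assumes x: "x \<in> S" and v: "v \<in> tangent_space W x" and 0: "D U1 x v = 0" "D U2 x v = 0"
  shows "D F1 x v = 0" "D F2 x v = 0"
proof -
  obtain V \<kappa> where V: "transported (\<lambda>x. normal_class S x (e1 x)) V \<kappa>"
    "D U1 x (V x) = scal (wt1 \<alpha>) x \<bullet> e1 x" "D U2 x (V x) = scal wt2 x \<bullet> e1 x"
    using exists_transported[OF rep_section_e(1)] x by blast
  obtain V' \<kappa>' where V': "transported (\<lambda>x. normal_class S x (e2 x)) V' \<kappa>'"
    "D U1 x (V' x) = scal (wt1 \<alpha>) x \<bullet> e2 x" "D U2 x (V' x) = scal wt2 x \<bullet> e2 x"
    using exists_transported[OF rep_section_e(2)] x by blast
  have t: "V x \<in> tangent_space W x" "V' x \<in> tangent_space W x"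
    using V(1) V'(1) vector_field_tangent[OF _ in_W[OF x]] unfolding transported_def by blast+
  define p q r s where "p = D U1 x (e1 x)" and "q = D U1 x (e2 x)" and "r = D U2 x (e1 x)" and "s = D U2 x (e2 x)"
  define A A' C C' where "A = D F1 x (V x)" and "A' = D F2 x (V x)" and "C = D F1 x (V' x)" and "C' = D F2 x (V' x)"
  define a1 a2 where "a1 = D F1 x v" and "a2 = D F2 x v"
  have eqs: "A * p + A' * q = 1" "A * r + A' * s = 0" "C * p + C' * q = 0" "C * r + C' * s = 1"
    "a1 * p + a2 * q = 0" "a1 * r + a2 * s = 0"
    using V(2,3) V'(2,3) 0 D_U_expand[OF x t(1)] D_U_expand[OF x t(2)] D_U_expand[OF x v]
    by (simp_all add: e_dual[OF x] p_def q_def r_def s_def A_def A'_def C_def C'_def a1_def a2_def)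
  \<comment> \<open>Multiplicativity of the determinant; by \<open>eqs\<close> the right side equals
    1.\<close>
  have "(p * s - q * r) * (A * C' - A' * C) = (A * p + A' * q) * (C * r + C' * s) - (A * r + A' * s) * (C * p + C' * q)"
    by (simp add: algebra_simps)
  then have det: "p * s - q * r \<noteq> 0" unfolding eqs by auto
  have "a1 * (p * s - q * r) = (a1 * p + a2 * q) * s - (a1 * r + a2 * s) * q"
    "a2 * (p * s - q * r) = (a1 * r + a2 * s) * p - (a1 * p + a2 * q) * r"
    by (simp_all add: algebra_simps)
  then show "D F1 x v = 0" "D F2 x v = 0"
    unfolding eqs using det by (simp_all add: a1_def[symmetric] a2_def[symmetric])
qed

text \<open>The vector field \<open>shift\<close> prescribes the first order motion of \<open>F\<^sub>1\<close>, \<open>F\<^sub>2\<close>; \<open>shift_section\<close> is the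
  section of \<open>NS\<close> whose image under the vertical derivative of \<open>\<tau>\<close> is the class of \<open>shift\<close>.\<close>

definition shift :: "ambient \<Rightarrow> ambient" where
  "shift x = f1 x *\<^sub>R e1 x + f2 x *\<^sub>R e2 x"

definition shift_vec :: "ambient \<Rightarrow> ambient" where
  "shift_vec x = D U1 x (shift x) *\<^sub>R e1 x + D U2 x (shift x) *\<^sub>R e2 x"

definition shift_section :: "ambient \<Rightarrow> ambient set" where
  "shift_section x = normal_class S x (shift_vec x)"

lemma vector_field_shift: "vector_field W shift"
proof -
  have "smooth_fun W shift"
    unfolding shift_def by (intro smooth_fun_add smooth_fun_scaleR smooth_F smooth_fun_e)
  moreover have "circ x \<bullet> shift x = 0" for x
    by (simp add: shift_def e1_def e2_def inner_add_right inner_circ)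
  ultimately show ?thesis by (simp add: vector_field_def tangent_W)
qed

lemma rep_shift_section: "rep_section shift_section shift_vec"
proof -
  have "smooth_fun W shift_vec"
    unfolding shift_vec_def
    by (intro smooth_fun_add smooth_fun_scaleR smooth_fun_e smooth_fun_dir_deriv smooth_U vector_field_shift)
  then have "smooth_fun S shift_vec" using smooth_fun_subset S_subset by blast
  then show ?thesis
    by (simp add: rep_section_def shift_section_def shift_vec_def inner_add_right e_dual)
qed

text \<open>Along \<open>S\<close> the push-forward of \<open>shift_section\<close> and the field
  \<open>shift\<close> have the same derivatives of \<open>U1\<close>, \<open>U2\<close>, so their
  difference is annihilated by \<open>dF1\<close> and \<open>dF2\<close> as well.\<close>

lemma exists_moves: "\<exists>V \<kappa>. transported shift_section V \<kappa> \<and> moves V"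
proof -
  obtain V \<kappa> where V: "transported shift_section V \<kappa>"
    and U: "\<And>x. x \<in> S \<Longrightarrow> D U1 x (V x) = scal (wt1 \<alpha>) x \<bullet> shift_vec x"
      "\<And>x. x \<in> S \<Longrightarrow> D U2 x (V x) = scal wt2 x \<bullet> shift_vec x"
    using exists_transported[OF rep_shift_section] by blast
  have Vf: "vector_field W V" using V by (simp add: transported_def)
  have "D F1 x (V x) = f1 x \<and> D F2 x (V x) = f2 x" if x: "x \<in> S" for x
  proof -
    have t: "V x \<in> tangent_space W x" "shift x \<in> tangent_space W x"
      using vector_field_tangent[OF _ in_W[OF x]] Vf vector_field_shift by blast+
    have "D U1 x (V x) = D U1 x (shift x)" "D U2 x (V x) = D U2 x (shift x)"
      using U[OF x] by (simp_all add: shift_vec_def inner_add_right e_dual[OF x])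
    then have "D F1 x (V x - shift x) = 0" "D F2 x (V x - shift x) = 0"
      using D_U_injective[OF x tangent_diff[OF in_W[OF x] t]]
      by (simp_all add: D_linear[OF smooth_U(1) in_W[OF x]] D_linear[OF smooth_U(2) in_W[OF x]])
    then have "D F1 x (V x) = D F1 x (shift x)" "D F2 x (V x) = D F2 x (shift x)"
      by (simp_all add: D_linear[OF smooth_F(1) in_W[OF x]] D_linear[OF smooth_F(2) in_W[OF x]])
    then show ?thesis
      by (simp add: shift_def D_linear[OF smooth_F(1) in_W[OF x]] D_linear[OF smooth_F(2) in_W[OF x]] D_F_e[OF x])
  qed
  then show ?thesis using V Vf by (auto simp: moves_def)
qed

lemma infinitesimal_shift: "infinitesimal_coisotropic_deformation M_ex theta_ex S \<tau> h shift_section"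
proof -
  obtain V \<kappa> where V: "transported shift_section V \<kappa>" "moves V" using exists_moves by blast
  have Vk: "vector_field W V" "smooth_fun W \<kappa>" using V by (simp_all add: transported_def)
  let ?B = "lie_deriv (vert_deriv shift_section) J_NS"
  have "P_form S ?B f l g m x = 0"
    if x: "x \<in> S" and sm: "smooth_NS M_ex S f" "smooth_NS M_ex S l" "smooth_NS M_ex S g" "smooth_NS M_ex S m"
      and con: "conormal_at S f x" "conormal_at S g x" for x f l g m
  proof -
    note xW = in_W[OF x]
    define L where "L = lie_Jac V \<kappa>"
    define fh gh where "fh = (\<lambda>y. f (inv\<tau> y))" and "gh = (\<lambda>y. g (inv\<tau> y))"
    define lh mh where "lh = push_section M_ex S \<tau> h l" and "mh = push_section M_ex S \<tau> h m"
    have rl: "rep l lh" "rep m mh" unfolding lh_def mh_def using sm by (simp_all add: rep_push)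
    have rf: "rep (\<lambda>\<nu>. f \<nu> * l \<nu>) (\<lambda>y. fh y * lh y)" "rep (\<lambda>\<nu>. g \<nu> * m \<nu>) (\<lambda>y. gh y * mh y)"
      unfolding fh_def gh_def using rep_mult sm rl by blast+
    have s: "smooth_fun W fh" "smooth_fun W gh" "smooth_fun W lh" "smooth_fun W mh"
      using smooth_inv sm rl by (simp_all add: fh_def gh_def rep_def)
    have sp: "smooth_fun W (\<lambda>y. fh y * lh y)" "smooth_fun W (\<lambda>y. gh y * mh y)"
      using s by (intro smooth_fun_mult; simp)+
    have z: "f (zero_point S x) = fh x" "g (zero_point S x) = gh x"
      by (simp_all add: fh_def gh_def inv_zero[OF x] zero_point_NC)
    have Bz: "?B u w (zero_point S x) = L p q x" if "rep u p" "rep w q" for u w p q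
      unfolding L_def by (rule rep_zero[OF rep_lie_J[OF V(1) that] x])
    have dh: "D (\<lambda>y. k (inv\<tau> y)) x v = 0" if k: "smooth_NS M_ex S k" "conormal_at S k x" and v: "v \<in> tangent_space S x"
      for k :: "ambient \<times> ambient set \<Rightarrow> real" and v
    proof -
      have "dir_deriv S (\<lambda>y. k (inv\<tau> y)) x = dir_deriv S (\<lambda>y. k (zero_point S y)) x"
        by (rule dir_deriv_cong[OF _ x]) (simp add: inv_zero zero_point_NC)
      moreover have "dir_deriv S (\<lambda>y. k (zero_point S y)) x v = 0"
        using k(2) v unfolding conormal_at_def by blast
      ultimately show ?thesis
        using dir_deriv_subset[OF smooth_inv[OF k(1)] S_subset x v] by simp
    qed
    \<comment> \<open>By bilinearity the four terms of \<open>P_form\<close> add up to the form on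
      \<open>(f - f(x)) l\<close> and \<open>(g - g(x)) m\<close>, which vanish at \<open>x\<close>
      and have conormal differential there.\<close>
    define p q where "p = (\<lambda>y. fh y * lh y + (- fh x) * lh y)" and "q = (\<lambda>y. gh y * mh y + (- gh x) * mh y)"
    have spq: "smooth_fun W p" "smooth_fun W q"
      unfolding p_def q_def by (intro smooth_fun_lincomb sp s)+
    have T: "v \<in> tangent_space W x" if "v \<in> tangent_space S x" for v
      using that tangent_S[OF x] by blast
    have dp: "D p x v = 0" if v: "v \<in> tangent_space S x" for v
      unfolding p_def D_lincomb[OF sp(1) s(3) xW T[OF v]] dir_deriv_mult[OF s(1,3) xW T[OF v]]
      using dh[OF sm(1) con(1) v] by (simp add: fh_def)
    have dq: "D q x v = 0" if v: "v \<in> tangent_space S x" for v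
      unfolding q_def D_lincomb[OF sp(2) s(4) xW T[OF v]] dir_deriv_mult[OF s(2,4) xW T[OF v]]
      using dh[OF sm(3) con(2) v] by (simp add: gh_def)
    have "L p q x = 0"
      unfolding L_def by (rule lie_Jac_conormal[OF V(2) Vk(2) x spq(1) _ dp spq(2) _ dq]) (simp_all add: p_def q_def)
    moreover have right: "L k q x = L k (\<lambda>y. gh y * mh y) x - gh x * L k mh x" if "smooth_fun W k" for k
      unfolding q_def L_def using lie_Jac_lincomb_right[OF Vk that sp(2) s(4) xW, of "- gh x"] by simp
    moreover have "L p q x = L (\<lambda>y. fh y * lh y) q x - fh x * L lh q x"
    proof -
      have "L q p x = L q (\<lambda>y. fh y * lh y) x - fh x * L q lh x"
        unfolding p_def L_def using lie_Jac_lincomb_right[OF Vk spq(2) sp(1) s(3) xW, of "- fh x"] by simp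
      then show ?thesis
        using lie_Jac_antisym[OF Vk spq(2) spq(1) xW] lie_Jac_antisym[OF Vk spq(2) sp(1) xW]
          lie_Jac_antisym[OF Vk spq(2) s(3) xW] by (simp add: L_def)
    qed
    ultimately have "L (\<lambda>y. fh y * lh y) (\<lambda>y. gh y * mh y) x - gh x * L (\<lambda>y. fh y * lh y) mh x
        - fh x * (L lh (\<lambda>y. gh y * mh y) x - gh x * L lh mh x) = 0"
      using right[OF sp(1)] right[OF s(3)] by simp
    then show ?thesis
      unfolding P_form_def Let_def Bz[OF rf(1) rf(2)] Bz[OF rl(1) rf(2)] Bz[OF rf(1) rl(2)] Bz[OF rl(1) rl(2)] z
      by (simp add: algebra_simps)
  qed
  then show ?thesis
    unfolding infinitesimal_coisotropic_deformation_def P_zero_def section_NS_iff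
    using rep_shift_section by blast
qed

lemma not_prolongable_shift: "\<not> formally_prolongable M_ex theta_ex S \<tau> h shift_section"
proof
  assume "formally_prolongable M_ex theta_ex S \<tau> h shift_section"
  then obtain s where s: "formal_coisotropic_deformation M_ex theta_ex S \<tau> h s" "\<forall>x\<in>S. s 1 x = shift_section x"
    unfolding formally_prolongable_def by blast
  obtain V \<kappa> where V: "transported shift_section V \<kappa>" "moves V" using exists_moves by blast
  \<comment> \<open>\<open>s 1\<close> and \<open>shift_section\<close> agree on \<open>S\<close>
    only, which is all that points of \<open>NS\<close> can see.\<close>
  have vd: "vert_deriv (s 1) u \<nu> = vert_deriv shift_section u \<nu>" if "\<nu> \<in> NS" for u \<nu>
  proof -
    have "fst \<nu> \<in> S" using that by (auto simp: NS_eq NC_def TA_iff)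
    then show ?thesis using s(2) by (simp add: vert_deriv_def case_prod_unfold)
  qed
  have "rep (vert_deriv (s 1) u) f \<longleftrightarrow> rep (vert_deriv shift_section u) f" for u f
    by (simp add: rep_def vd del: One_nat_def)
  then have V1: "transported (s 1) V \<kappa>"
    using V(1) by (simp add: transported_def)
  have "section_NS M_ex S (s 2)"
    using s(1) unfolding formal_coisotropic_deformation_def by simp
  then obtain w where "rep_section (s 2) w" unfolding section_NS_iff by blast
  then obtain V' \<kappa>' where V': "transported (s 2) V' \<kappa>'" using exists_transported by blast
  have P: "P_zero M_ex S (exp_lie_coeff s J_NS 2)"
    using s(1) by (simp add: formal_coisotropic_deformation_def)
  have eq: "lie_Jac V' \<kappa>' F1 F2 x + lie2_Jac V \<kappa> F1 F2 x / 2 = 0" if x: "x \<in> S" for x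
  proof -
    \<comment> \<open>Cancels the factor \<open>h\<close> of the trivialization, so that
      \<open>u1 * l\<close> and \<open>u2 * l\<close> correspond to \<open>F1\<close> and
      \<open>F2\<close> over \<open>W\<close>.\<close>
    define l where "l \<nu> = inverse (h \<nu>)" for \<nu>
    define u1 u2 where "u1 \<nu> = F1 (\<tau> \<nu>)" and "u2 \<nu> = F2 (\<tau> \<nu>)" for \<nu>
    have hn: "h (NC p) \<noteq> 0" if "p \<in> TA" for p using h_nz that by (simp add: NS_eq)
    have sl: "smooth_NS M_ex S l"
      unfolding smooth_NS_iff l_def by (intro smooth_fun_inverse smooth_h hn)
    have su: "smooth_NS M_ex S u1" "smooth_NS M_ex S u2"
      unfolding smooth_NS_iff u1_def u2_def
      by (rule smooth_fun_compose[OF smooth_\<tau> smooth_fun_QH[of UNIV]]; simp)+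
    have z: "u1 (zero_point S y) = 0" "u2 (zero_point S y) = 0" if "y \<in> S" for y
      using that by (simp_all add: u1_def u2_def zero_point_NC zero_\<tau> F_S)
    have con: "conormal_at S u x" if "\<And>y. y \<in> S \<Longrightarrow> u (zero_point S y) = 0" for u
    proof -
      have "dir_deriv S (\<lambda>y. u (zero_point S y)) x = dir_deriv S (\<lambda>y. 0) x"
        by (rule dir_deriv_cong[OF _ x]) (simp add: that)
      then show ?thesis using dir_deriv_const[OF x, of _ "0::real"] by (simp add: conormal_at_def)
    qed
    have r: "rep (\<lambda>\<nu>. u1 \<nu> * l \<nu>) F1" "rep (\<lambda>\<nu>. u2 \<nu> * l \<nu>) F2"
      using h_nz by (simp_all add: rep_def smooth_F u1_def u2_def l_def)
    have "P_form S (exp_lie_coeff s J_NS 2) u1 l u2 l x = 0"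
      using P x su sl con[of u1] con[of u2] z unfolding P_zero_def by blast
    \<comment> \<open>\<open>u1\<close> and \<open>u2\<close> vanish on the zero section, which
      leaves the first of the four terms of \<open>P_form\<close>.\<close>
    then have "exp_lie_coeff s J_NS 2 (\<lambda>\<nu>. u1 \<nu> * l \<nu>) (\<lambda>\<nu>. u2 \<nu> * l \<nu>) (zero_point S x) = 0"
      by (simp add: P_form_def Let_def z[OF x])
    then show ?thesis
      unfolding exp_lie_coeff_2 rep_zero[OF rep_lie_J[OF V' r] x] rep_zero[OF rep_lie2_J[OF V1 r] x] .
  qed
  have "smooth_fun W \<kappa>" "vector_field W V'" "smooth_fun W \<kappa>'"
    using V(1) V' by (simp_all add: transported_def)
  from second_order_exact[OF V(2) this eq] no_exact show False by blast
qed

end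

text \<open>A function \<open>f\<close> that vanishes on \<open>S_ex \<alpha>\<close> has zero
  derivative along the contact fields of the two defining functions, as these are tangent to it; by
  antisymmetry of the bracket, \<open>X_f\<close> annihilates the defining functions there.\<close>

lemma regular_coisotropic_S_ex:
  assumes "\<alpha> > 0"
  shows "regular_coisotropic_submanifold M_ex theta_ex 5 (S_ex \<alpha>)"
proof -
  interpret contact_open M_ex by unfold_locales simp
  let ?S = "S_ex \<alpha>" and ?F1 = "QH (wt1 \<alpha>) (1/4)" and ?F2 = "QH wt2 (1/2)"
  have tan: "v \<in> tangent_space ?S x \<longleftrightarrow> v \<in> tangent_space M_ex x \<and> D ?F1 x v = 0 \<and> D ?F2 x v = 0"
    if "x \<in> ?S" for x v
    using tangent_space_S_ex[OF assms that] tangent_space_M_ex[OF subsetD[OF S_ex_subset_M_ex that]]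
      dir_deriv_QH[of v M_ex x "wt1 \<alpha>"] dir_deriv_QH[of v M_ex x wt2] by auto
  have "coisotropic M_ex theta_ex ?S"
    unfolding coisotropic_def
  proof (intro allI impI ballI)
    fix f :: "ambient \<Rightarrow> real" and x
    assume f: "smooth_fun M_ex f \<and> (\<forall>x\<in>?S. f x = 0)" and x: "x \<in> ?S"
    have xM: "x \<in> M_ex" using x S_ex_subset_M_ex by blast
    have "D (QH w c) x (cfield f x) = 0" if "hv w c x \<in> tangent_space ?S x" "QH w c x = 0" for w c
    proof -
      have "Jac (QH w c) f x = 0"
        unfolding Jac_QH[OF xM]
        by (rule dir_deriv_tangent_zero[OF _ S_ex_subset_M_ex x that(1)]) (use f in auto)
      then have "Jac f (QH w c) x = 0"
        using Jac_antisym[OF _ smooth_fun_QH xM, of f] f by simp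
      then show ?thesis using that(2) by (simp add: Jac_def)
    qed
    then show "contact_field M_ex theta_ex f x \<in> tangent_space ?S x"
      using x xM f by (simp add: contact_field_eq tan tangent_cfield tangent_hv D_QH_hv S_ex_iff)
  qed
  then show ?thesis
    using assms embedded_S_ex dim_contact_S_ex S_ex_subset_M_ex
    by (simp add: regular_coisotropic_submanifold_def)
qed

text \<open>A positive rational is a quotient of two positive naturals, the exponents of the
  resonant monomial. The obstructed section depends on the tubular neighborhood and is built anew
  for each.\<close>

lemma formally_obstructed_S_ex:
  assumes "\<alpha> > 0" "\<alpha> \<in> \<rat>"
  shows "formally_obstructed M_ex theta_ex (S_ex \<alpha>)"
proof -
  obtain a b :: nat where ab: "b \<noteq> 0" "\<bar>\<alpha>\<bar> = real a / real b"
    using Rats_abs_nat_div_natE[OF assms(2)] by metis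
  then have "a > 0" "b > 0" "real b * \<alpha> = real a"
    using assms(1) by (auto simp: field_simps intro: gr0I)
  then have "fat_nbhd \<alpha> a b \<tau> h" if "fat_tubular_nbhd M_ex (S_ex \<alpha>) \<tau> h" for \<tau> h
    using assms(1) that by unfold_locales auto
  then show ?thesis
    unfolding formally_obstructed_def
    using fat_nbhd.infinitesimal_shift fat_nbhd.not_prolongable_shift by blast
qed

theorem proposition6p2:
  fixes \<alpha> :: real
  assumes "\<alpha> > 0"
  shows "regular_coisotropic_submanifold M_ex theta_ex 5 (S_ex \<alpha>) \<and>
    (\<alpha> \<in> \<rat> \<longrightarrow> formally_obstructed M_ex theta_ex (S_ex \<alpha>))"
  using regular_coisotropic_S_ex[OF assms] formally_obstructed_S_ex[OF assms] by blast

end
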